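(* Let $R$ be a rational function of degree at least $2$ whose Julia set $J(R)$ is a finitely irreducible continuum. Then either (1) $J(R)$ contains an indecomposable subcontinuum with non-empty interior relative to $J(R)$, or (2) $J(R)$ is irreducible between two points and admits a continuous monotone surjection $m:J(R)\to[0,1]$ such that (a) $m^{-1}(x)$ is nowhere dense in $J(R)$ for every $x\in[0,1]$, and (b) $m$ semiconjugates $R|_{J(R)}$ to a map $g:[0,1]\to[0,1]$ (i.e. $m\circ R|_{J(R)}=g\circ m$) which is open, topologically exact, and at most $\deg(R)$-to-one.
   Context: A continuum is a non-empty compact connected metric space. A continuum $X$ is irreducible about a set $A\subset X$ if no proper subcontinuum of $X$ contains $A$; $X$ is finitely irreducible if it is irreducible about some finite subset, and irreducible between two points $p,q$ if no proper subcontinuum contains $\{p,q\}$. A continuum is indecomposable if it is not the union of two proper subcontinua. A map is monotone if its point preimages are connected. A map $g$ of a space $Y$ is topologically exact if for every non-empty open $U\subset Y$ there is $k\in\mathbb N$ with $g^k(U)=Y$. *)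

theory Defs
  imports "HOL-Analysis.Analysis" "HOL-Computational_Algebra.Polynomial_Factorial"
begin

text \<open>Riemann sphere: complex option (None = infinity), embedded into the unit sphere
of R^3 by inverse stereographic projection; the topology/metric used is the one induced
from R^3 (chordal metric).\<close>

type_synonym pt = "real \<times> real \<times> real"

definition stereo_inv :: "complex option \<Rightarrow> pt" where
  "stereo_inv w = (case w of None \<Rightarrow> (0, 0, 1)
     | Some z \<Rightarrow> (2 * Re z / (1 + (cmod z)\<^sup>2), 2 * Im z / (1 + (cmod z)\<^sup>2),
                  ((cmod z)\<^sup>2 - 1) / ((cmod z)\<^sup>2 + 1)))"

definition riemann_sphere :: "pt set" where
  "riemann_sphere = range stereo_inv"

text \<open>The rational map p/q on the extended plane (p, q coprime).\<close>
definition rat_map :: "complex poly \<Rightarrow> complex poly \<Rightarrow> complex option \<Rightarrow> complex option" where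
  "rat_map p q w = (case w of
      Some z \<Rightarrow> (if poly q z = 0 then None else Some (poly p z / poly q z))
    | None \<Rightarrow> (if degree p > degree q then None
               else if degree p = degree q then Some (lead_coeff p / lead_coeff q)
               else Some 0))"

definition rat_degree :: "complex poly \<Rightarrow> complex poly \<Rightarrow> nat" where
  "rat_degree p q = max (degree p) (degree q)"

definition sphere_map :: "complex poly \<Rightarrow> complex poly \<Rightarrow> pt \<Rightarrow> pt" where
  "sphere_map p q x = stereo_inv (rat_map p q (inv stereo_inv x))"

definition normal_iterates_on :: "(pt \<Rightarrow> pt) \<Rightarrow> pt set \<Rightarrow> bool" where
  "normal_iterates_on f U \<longleftrightarrow>
     (\<forall>n :: nat \<Rightarrow> nat. \<exists>r g. strict_mono r \<and>
        (\<forall>x\<in>U. \<exists>V. openin (top_of_set riemann_sphere) V \<and> x \<in> V \<and> V \<subseteq> U \<and>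
             uniform_limit V (\<lambda>k. (f ^^ n (r k))) g sequentially))"

definition fatou_set :: "(pt \<Rightarrow> pt) \<Rightarrow> pt set" where
  "fatou_set f = {x \<in> riemann_sphere. \<exists>U. openin (top_of_set riemann_sphere) U \<and> x \<in> U \<and>
                    normal_iterates_on f U}"

definition julia_set :: "(pt \<Rightarrow> pt) \<Rightarrow> pt set" where
  "julia_set f = riemann_sphere - fatou_set f"

definition continuum :: "'a::metric_space set \<Rightarrow> bool" where
  "continuum K \<longleftrightarrow> K \<noteq> {} \<and> compact K \<and> connected K"

definition irreducible_about :: "'a::metric_space set \<Rightarrow> 'a set \<Rightarrow> bool" where
  "irreducible_about X A \<longleftrightarrow> A \<subseteq> X \<and> \<not> (\<exists>K. continuum K \<and> K \<subset> X \<and> A \<subseteq> K)"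

definition finitely_irreducible :: "'a::metric_space set \<Rightarrow> bool" where
  "finitely_irreducible X \<longleftrightarrow> (\<exists>A. finite A \<and> irreducible_about X A)"

definition irreducible_between :: "'a::metric_space set \<Rightarrow> 'a \<Rightarrow> 'a \<Rightarrow> bool" where
  "irreducible_between X a b \<longleftrightarrow> irreducible_about X {a, b}"

definition indecomposable :: "'a::metric_space set \<Rightarrow> bool" where
  "indecomposable K \<longleftrightarrow> continuum K \<and>
     \<not> (\<exists>A B. continuum A \<and> continuum B \<and> A \<subset> K \<and> B \<subset> K \<and> K = A \<union> B)"

definition topologically_exact_on :: "'a::topological_space set \<Rightarrow> ('a \<Rightarrow> 'a) \<Rightarrow> bool" where
  "topologically_exact_on S g \<longleftrightarrow>
     (\<forall>U. openin (top_of_set S) U \<and> U \<noteq> {} \<longrightarrow> (\<exists>k::nat. (g ^^ k) ` U = S))"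

end

theory Submission
  imports Defs "HOL-Complex_Analysis.Complex_Analysis" "HOL-Computational_Algebra.Fundamental_Theorem_Algebra"
begin

text \<open>
  Let \<open>X\<close> be the Julia set and suppose that every indecomposable subcontinuum of \<open>X\<close> is nowhere dense.
  If \<open>X\<close> is irreducible between two disjoint subcontinua \<open>A\<close> and \<open>B\<close>, then the closure of the gap \<open>X - A - B\<close> is
  a continuum with interior, hence decomposable, and a decomposition enlarges \<open>A\<close> and \<open>B\<close> to subcontinua covering
  \<open>X\<close>. Iterating this over the dyadic rationals as in Urysohn's lemma gives a map of \<open>X\<close> to the unit interval
  whose sublevel and superlevel sets are connected; any two such maps are monotone with respect to each other, so a
  weighted sum of countably many of them has nowhere dense fibres. These fibres are exactly the maximal nowhere
  dense subcontinua of \<open>X\<close>, a notion preserved by open finite-to-one maps.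

  If \<open>X\<close> were irreducible only about three or more points, it would contain a branching place. The forward images
  of any open set cover \<open>X\<close>, so this place would be the image of an interior fibre, which has only two sides, a
  contradiction. Hence \<open>X\<close> is irreducible between two points, the fibre map semiconjugates the dynamics to an open
  interval map \<open>g\<close>, and since \<open>g\<close> permutes or identifies the end points and forward images of open sets cover the
  interval, \<open>g\<close> is exact.

  The covering property on the Julia set follows from Montel's theorem, because a finite backward invariant set
  consists of superattracting periodic points and so lies in the Fatou set.
\<close>

section \<open>Irreducible continua whose indecomposable subcontinua are nowhere dense\<close>

text \<open>The sets to be collapsed have to be recognisable from \<open>X\<close> alone, for
  otherwise the dynamics cannot be pushed to the quotient. One level map does not achieve this: its
  fibres may be fat and depend on the decompositions chosen. Comonotonicity is what allows many
  level maps to be averaged without losing connected sublevel sets. The transfer of maximality from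
  a fibre to its image rests on confluence of open maps: every component of the preimage of a
  continuum maps onto that continuum.

  In the reduction to two points the level map runs from a point to a fat continuum
  \<open>D\<close>, so its last fibre need not be thin, and the place where the rest of
  \<open>X\<close> reaches \<open>D\<close> is not given as a fibre. Maximality still places it
  inside the image of a thin interior fibre, whose two sides can then be followed.

  The covering property only gives a union over all iterates. A single exponent is extracted on the
  interval, where a neighbourhood of a fixed end point is always comparable with its image; two end
  points that are swapped force a passage to the second iterate.\<close>

definition nowhere_dense_in :: "'a::metric_space set \<Rightarrow> 'a set \<Rightarrow> bool" where
  "nowhere_dense_in X N \<longleftrightarrow> X \<subseteq> closure (X - N)"

text \<open>Irreducibility between two continua instead of two points. \<open>K\<close> is only
  asked to contain the gap, because it may meet \<open>A\<close> and \<open>B\<close> in small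
  pieces; this form survives enlarging the two ends.\<close>

definition irreducible_from :: "'a::metric_space set \<Rightarrow> 'a set \<Rightarrow> 'a set \<Rightarrow> bool" where
  "irreducible_from X A B \<longleftrightarrow>
     continuum A \<and> continuum B \<and> A \<subseteq> X \<and> B \<subseteq> X \<and> A \<inter> B = {} \<and>
     (\<forall>K. continuum K \<and> K \<subseteq> X \<and> K \<inter> A \<noteq> {} \<and> K \<inter> B \<noteq> {} \<longrightarrow> X \<subseteq> A \<union> K \<union> B)"

text \<open>Connectedness is imposed on sublevel and superlevel sets rather than on fibres: the
  Urysohn construction yields it, and it makes two such maps comparable. Closedness on both sides
  encodes continuity on \<open>X\<close>.\<close>

definition level_map :: "'a::metric_space set \<Rightarrow> 'a set \<Rightarrow> 'a set \<Rightarrow> ('a \<Rightarrow> real) \<Rightarrow> bool" where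
  "level_map X A B m \<longleftrightarrow>
     (\<forall>x\<in>A. m x = 0) \<and> (\<forall>x\<in>B. m x = 1) \<and> (\<forall>x\<in>X. 0 \<le> m x \<and> m x \<le> 1) \<and>
     (\<forall>t. closed {x\<in>X. m x \<le> t} \<and> connected {x\<in>X. m x \<le> t}) \<and>
     (\<forall>t. closed {x\<in>X. t \<le> m x} \<and> connected {x\<in>X. t \<le> m x})"

lemma continuumD:
  assumes "continuum K"
  shows "K \<noteq> {}" "compact K" "closed K" "connected K"
  using assms by (auto simp: continuum_def compact_imp_closed)

lemma continuum_Un:
  assumes "continuum K" "continuum L" "K \<inter> L \<noteq> {}"
  shows "continuum (K \<union> L)"
  using assms by (auto simp: continuum_def connected_Un)

lemma continuum_closed_subset:
  assumes "continuum X" "closed K" "K \<subseteq> X" "connected K" "K \<noteq> {}"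
  shows "continuum K"
  using assms compact_Int_closed[of X K] by (auto simp: continuum_def Int_absorb1)

text \<open>The notion is density of the complement, that is, empty relative interior. No closure of
  \<open>N\<close> is taken, so it is nowhere density in the usual sense when \<open>N\<close> is
  closed.\<close>

lemma nowhere_dense_in_iff_open:
  "nowhere_dense_in X N \<longleftrightarrow> (\<forall>V. open V \<and> V \<inter> X \<subseteq> N \<longrightarrow> V \<inter> X = {})"
proof
  assume *: "nowhere_dense_in X N"
  show "\<forall>V. open V \<and> V \<inter> X \<subseteq> N \<longrightarrow> V \<inter> X = {}"
  proof (intro allI impI)
    fix V assume V: "open V \<and> V \<inter> X \<subseteq> N"
    then have "V \<inter> closure (X - N) = {}"
      using open_Int_closure_eq_empty[of V "X - N"] by blast
    then show "V \<inter> X = {}" using * unfolding nowhere_dense_in_def by blast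
  qed
next
  assume *: "\<forall>V. open V \<and> V \<inter> X \<subseteq> N \<longrightarrow> V \<inter> X = {}"
  have "(- closure (X - N)) \<inter> X \<subseteq> N"
    using closure_subset[of "X - N"] by blast
  then have "(- closure (X - N)) \<inter> X = {}"
    using * by blast
  then show "nowhere_dense_in X N"
    unfolding nowhere_dense_in_def by blast
qed

lemma nowhere_dense_in_subset:
  "nowhere_dense_in X N \<Longrightarrow> M \<subseteq> N \<Longrightarrow> nowhere_dense_in X M"
  unfolding nowhere_dense_in_def by (meson Diff_mono closure_mono order.trans order_refl)

lemma nowhere_dense_in_Un:
  assumes "nowhere_dense_in X M" "nowhere_dense_in X N" "closed M"
  shows "nowhere_dense_in X (M \<union> N)"
  unfolding nowhere_dense_in_iff_open
proof (intro allI impI)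
  fix V assume V: "open V \<and> V \<inter> X \<subseteq> M \<union> N"
  then have "open (V - M)" "(V - M) \<inter> X \<subseteq> N"
    using assms(3) by auto
  then have "(V - M) \<inter> X = {}"
    using assms(2) unfolding nowhere_dense_in_iff_open by blast
  then have "V \<inter> X \<subseteq> M" by blast
  then show "V \<inter> X = {}"
    using assms(1) V unfolding nowhere_dense_in_iff_open by blast
qed

lemma connected_imp_singleton_nowhere_dense:
  fixes X :: "'a::metric_space set"
  assumes "connected X" "X \<noteq> {a}"
  shows "nowhere_dense_in X {a}"
  unfolding nowhere_dense_in_iff_open
proof (intro allI impI)
  fix V assume V: "open V \<and> V \<inter> X \<subseteq> {a}"
  show "V \<inter> X = {}"
  proof (rule ccontr)
    assume "V \<inter> X \<noteq> {}"
    with V have "X \<inter> V = {a}" by blast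
    then have "openin (top_of_set X) {a}" "closedin (top_of_set X) {a}"
      using V by (metis openin_open_Int, metis Int_lower1 closed_singleton closed_subset)
    then show False
      using assms by (metis connected_clopen insert_not_empty)
  qed
qed

section \<open>Irreducibility between two disjoint subcontinua\<close>

lemma irreducible_fromD:
  assumes "irreducible_from X A B"
  shows "continuum A" "closed A" "A \<subseteq> X" "A \<noteq> {}" "continuum B" "closed B" "B \<subseteq> X" "B \<noteq> {}" "A \<inter> B = {}"
  using assms by (auto simp: irreducible_from_def dest: continuumD)

lemma irreducible_from_sym: "irreducible_from X A B \<Longrightarrow> irreducible_from X B A"
  unfolding irreducible_from_def by (simp add: Int_commute Un_ac)

text \<open>\<open>K \<union> A'\<close> is again a continuum and meets the smaller end
  \<open>A\<close>, so irreducibility from \<open>A\<close> applies to it.\<close>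

lemma irreducible_from_mono:
  assumes irr: "irreducible_from X A B" and A': "continuum A'" "A \<subseteq> A'" "A' \<subseteq> X" "A' \<inter> B = {}"
  shows "irreducible_from X A' B"
  unfolding irreducible_from_def
proof (intro conjI allI impI)
  fix K assume K: "continuum K \<and> K \<subseteq> X \<and> K \<inter> A' \<noteq> {} \<and> K \<inter> B \<noteq> {}"
  have "continuum (K \<union> A')" "K \<union> A' \<subseteq> X"
    using K A' continuum_Un by blast+
  moreover have "(K \<union> A') \<inter> A \<noteq> {}" "(K \<union> A') \<inter> B \<noteq> {}"
    using K A' irr continuumD(1)[of A] by (auto simp: irreducible_from_def)
  ultimately have "X \<subseteq> A \<union> (K \<union> A') \<union> B"
    using irr unfolding irreducible_from_def by blast
  then show "X \<subseteq> A' \<union> K \<union> B" using A' by blast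
qed (use assms in \<open>auto simp: irreducible_from_def\<close>)

text \<open>A set that is closed in \<open>X - C\<close> can accumulate outside itself only at
  points of \<open>C\<close>.\<close>

lemma clopen_in_diff_closed_Un:
  assumes X: "closed X" and C: "closed C" "C \<subseteq> X" and T: "closedin (top_of_set (X - C)) T"
  shows "closed (C \<union> T)"
proof -
  obtain F where F: "closed F" "T = (X - C) \<inter> F"
    using T by (auto simp: closedin_closed)
  then have "C \<union> T = C \<union> (X \<inter> F)" by auto
  then show ?thesis using X C F by auto
qed

lemma connected_subset_clopen:
  assumes "connected A" "openin (top_of_set Y) S" "closedin (top_of_set Y) S" "A \<subseteq> Y" "A \<inter> S \<noteq> {}"
  shows "A \<subseteq> S"
proof -
  have "openin (top_of_set A) (A \<inter> S)" 
    using assms(2,4) by (metis Int_commute inf.absorb_iff2 openin_subtopology_Int subtopology_subtopology)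
  moreover have "closedin (top_of_set A) (A \<inter> S)"
    using assms(3,4) by (metis Int_commute closedin_subtopology_Int_closed inf.absorb_iff2 subtopology_subtopology)
  ultimately show ?thesis
    using assms(1,5) by (metis connected_clopen inf.absorb_iff1)
qed

text \<open>A connected subset of a connected space stays connected after adding a clopen part of
  its complement. Applied first to one end, this shows that \<open>X - A\<close> and
  \<open>X - B\<close> are connected. Applied inside these two sets, it attaches a clopen part
  \<open>T\<close> of the gap to both \<open>A\<close> and \<open>B\<close>, and the resulting
  continuum joins the ends while missing part of the gap.\<close>

lemma irreducible_from_connected_gap:
  assumes X: "continuum X" and irr: "irreducible_from X A B"
  shows "connected (X - A - B)"
proof (rule ccontr)
  assume nc: "\<not> connected (X - A - B)"
  have A: "connected A" "closed A" "A \<subseteq> X" "continuum A" and B: "connected B" "closed B" "B \<subseteq> X" "continuum B"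
    and AB: "A \<inter> B = {}"
    using irr by (auto simp: irreducible_from_def dest: continuumD)
  have cX: "connected X" "closed X" "compact X" using X by (auto dest: continuumD)
  \<comment> \<open>A clopen part of \<open>X - B\<close> containing \<open>A\<close> together with \<open>B\<close> is all of \<open>X\<close>, by irreducibility.\<close>
  have conn: "connected (X - B')" if "irreducible_from X A' B'" "A' \<inter> B' = {}" for A' B'
  proof (rule ccontr)
    assume "\<not> connected (X - B')"
    then obtain T where T: "openin (top_of_set (X - B')) T" "closedin (top_of_set (X - B')) T" "T \<noteq> {}" "T \<noteq> X - B'"
      by (metis connected_clopen)
    have B': "continuum B'" "B' \<subseteq> X" and A': "continuum A'" "A' \<subseteq> X" using that by (auto simp: irreducible_from_def)
    have key: False if S: "openin (top_of_set (X - B')) S" "closedin (top_of_set (X - B')) S" "S \<noteq> X - B'" "A' \<inter> S \<noteq> {}" for S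
    proof -
      have "connected (B' \<union> S)"
        using connected_Un_clopen_in_complement[OF continuumD(4)[OF B'(1)] cX(1) B'(2) S(1,2)] .
      moreover have "closed (B' \<union> S)"
        using clopen_in_diff_closed_Un[OF cX(2) continuumD(3)[OF B'(1)] B'(2) S(2)] .
      moreover have "B' \<union> S \<subseteq> X"
        using S(1) B' openin_imp_subset by blast
      ultimately have "continuum (B' \<union> S)"
        using continuum_closed_subset[OF X] continuumD(1)[OF B'(1)] by blast
      then have "X \<subseteq> A' \<union> (B' \<union> S) \<union> B'"
        using \<open>irreducible_from X A' B'\<close> S(4) B' \<open>B' \<union> S \<subseteq> X\<close> continuumD(1)[OF B'(1)]
        unfolding irreducible_from_def by blast
      moreover have "A' \<subseteq> S"
        using connected_subset_clopen[OF continuumD(4)[OF A'(1)] S(1,2) _ S(4)] A'(2) \<open>A' \<inter> B' = {}\<close> by blast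
      ultimately show False using S openin_imp_subset[OF S(1)] by blast
    qed
    have "T \<subseteq> X - B'" using T openin_imp_subset by blast
    have "A' \<inter> T = {}" using key[of T] T by blast
    moreover have "A' \<inter> (X - B' - T) = {}"
    proof (rule ccontr)
      have "openin (top_of_set (X - B')) (X - B' - T)" "closedin (top_of_set (X - B')) (X - B' - T)"
        using T(1,2) by (auto intro: openin_diff closedin_diff)
      moreover have "X - B' - T \<noteq> X - B'" using T(3) \<open>T \<subseteq> X - B'\<close> by blast
      moreover assume "A' \<inter> (X - B' - T) \<noteq> {}"
      ultimately show False by (rule key)
    qed
    moreover have "A' \<noteq> {}" using A' continuumD by blast
    ultimately show False using A' \<open>A' \<inter> B' = {}\<close> by blast
  qed
  have cA: "connected (X - A)" and cB: "connected (X - B)"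
    using conn irr irreducible_from_sym AB by (metis Int_commute)+
  obtain T where T: "openin (top_of_set (X - A - B)) T" "closedin (top_of_set (X - A - B)) T" "T \<noteq> {}" "T \<noteq> X - A - B"
    using nc by (metis connected_clopen)
  have "connected (B \<union> T)"
    using connected_Un_clopen_in_complement[OF B(1) cA _ T(1,2)] B AB by blast
  moreover have "connected (A \<union> T)"
  proof -
    have eq: "X - A - B = X - B - A" and "A \<subseteq> X - B" using A(3) AB by blast+
    then show ?thesis
      using connected_Un_clopen_in_complement[OF A(1) cB, of T] T(1,2) unfolding eq by blast
  qed
  ultimately have "connected ((B \<union> T) \<union> (A \<union> T))"
    using T(3) connected_Un[of "B \<union> T" "A \<union> T"] by blast
  then have c: "connected ((A \<union> B) \<union> T)" by (simp add: Un_ac)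
  have "closed ((A \<union> B) \<union> T)"
  proof (rule clopen_in_diff_closed_Un)
    have eq: "X - A - B = X - (A \<union> B)" by blast
    show "closedin (top_of_set (X - (A \<union> B))) T" using T(2) unfolding eq .
  qed (use cX A B in auto)
  moreover have "(A \<union> B) \<union> T \<subseteq> X" using T(1) A B openin_imp_subset by blast
  ultimately have "continuum ((A \<union> B) \<union> T)"
    using c continuum_closed_subset[OF X] continuumD(1)[OF A(4)] by blast
  then have "X \<subseteq> A \<union> ((A \<union> B) \<union> T) \<union> B"
    using irr \<open>(A \<union> B) \<union> T \<subseteq> X\<close> continuumD(1)[OF A(4)] continuumD(1)[OF B(4)]
    unfolding irreducible_from_def by blast
  then show False using T openin_imp_subset[OF T(1)] by blast
qed

text \<open>Otherwise \<open>A\<close> and the union of \<open>B\<close> with the closed gap would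
  split the connected set \<open>X\<close>.\<close>

lemma irreducible_from_closure_gap_meets:
  assumes X: "continuum X" and irr: "irreducible_from X A B"
  shows "closure (X - A - B) \<inter> A \<noteq> {}"
proof
  assume *: "closure (X - A - B) \<inter> A = {}"
  have A: "closed A" "A \<subseteq> X" "A \<noteq> {}" and B: "closed B" "B \<subseteq> X" "B \<noteq> {}" and AB: "A \<inter> B = {}"
    using irr by (auto simp: irreducible_from_def dest: continuumD)
  have "closure (X - A - B) \<subseteq> X"
    using continuumD(3)[OF X] by (meson Diff_subset closure_minimal order_trans)
  then have "X = A \<union> (closure (X - A - B) \<union> B)"
    using A B closure_subset[of "X - A - B"] by blast
  moreover have "A \<inter> (closure (X - A - B) \<union> B) = {}" using AB * by blast
  moreover have "closed (closure (X - A - B) \<union> B)" "closure (X - A - B) \<union> B \<noteq> {}" using B by auto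
  moreover have "connected X" using X by (rule continuumD)
  ultimately show False
    using A(1,3) unfolding connected_closed_set[OF continuumD(3)[OF X]] by metis
qed

lemma dyadic_between:
  fixes s t :: real
  assumes "0 \<le> s" "s < t" "t \<le> 1"
  obtains r where "r \<in> dyadics" "s < r" "r < t"
proof -
  obtain n where n: "1 / 2 ^ n < t - s"
    using real_arch_pow_inv[of "t - s" "1/2"] assms by (auto simp: power_one_over)
  define k where "k = nat \<lfloor>s * 2 ^ n\<rfloor> + 1"
  have k: "real k = real_of_int \<lfloor>s * 2 ^ n\<rfloor> + 1" using assms by (simp add: k_def)
  show thesis
  proof
    show "real k / 2 ^ n \<in> dyadics" unfolding dyadics_def by blast
    have "s * 2 ^ n < real k" unfolding k by linarith
    then show "s < real k / 2 ^ n" by (simp add: field_simps)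
    have "real k \<le> s * 2 ^ n + 1" unfolding k by linarith
    also have "\<dots> < t * 2 ^ n" using n by (simp add: field_simps)
    finally show "real k / 2 ^ n < t" by (simp add: field_simps)
  qed
qed

text \<open>The second assumption is the negation of alternative (1); it is used to decompose
  subcontinua with interior.\<close>

locale nowhere_dense_indecomposables =
  fixes X :: "'a::euclidean_space set"
  assumes X: "continuum X"
    and indecomposable_thin: "K \<subseteq> X \<Longrightarrow> indecomposable K \<Longrightarrow> nowhere_dense_in X K"
begin

lemma closed_X: "closed X" and connected_X: "connected X" and compact_X: "compact X" and X_nonempty: "X \<noteq> {}"
  using X by (auto dest: continuumD)

text \<open>The closure \<open>M\<close> of the gap meets both ends, but a proper subcontinuum of
  \<open>M\<close> cannot meet both, since it would then contain the gap. So if \<open>M\<close>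
  decomposes into \<open>C\<close> and \<open>D\<close>, one part touches only \<open>A\<close> and
  the other only \<open>B\<close>, and each is added to its own end.\<close>

lemma irreducible_from_split:
  assumes irr: "irreducible_from X A B"
  obtains A' B' where "continuum A'" "continuum B'" "A \<subseteq> A'" "B \<subseteq> B'" "A' \<union> B' = X"
    "A \<inter> B' = {}" "A' \<inter> B = {}"
proof -
  have A: "continuum A" "closed A" "A \<subseteq> X" "A \<noteq> {}" and B: "continuum B" "closed B" "B \<subseteq> X" "B \<noteq> {}"
    and AB: "A \<inter> B = {}"
    using irreducible_fromD[OF irr] by simp_all
  define M where "M = closure (X - A - B)"
  have MA: "M \<inter> A \<noteq> {}" and MB: "M \<inter> B \<noteq> {}"
  proof -
    show "M \<inter> A \<noteq> {}" unfolding M_def by (rule irreducible_from_closure_gap_meets[OF X irr])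
    have "X - A - B = X - B - A" by blast
    then show "M \<inter> B \<noteq> {}"
      using irreducible_from_closure_gap_meets[OF X irreducible_from_sym[OF irr]] unfolding M_def by simp
  qed
  have MX: "M \<subseteq> X"
    unfolding M_def using closed_X by (meson Diff_subset closure_minimal order_trans)
  have "connected M" "closed M"
    unfolding M_def using irreducible_from_connected_gap[OF X irr] by (auto intro: connected_imp_connected_closure)
  then have M: "continuum M"
    using continuum_closed_subset[OF X] MX MA by blast
  have "X - A - B \<noteq> {}" using MA unfolding M_def by (metis Int_empty_left closure_empty)
  moreover have "open (- (A \<union> B))" "(- (A \<union> B)) \<inter> X \<subseteq> M"
    using A B closure_subset[of "X - A - B"] unfolding M_def by (auto simp: open_Compl)
  ultimately have "\<not> nowhere_dense_in X M"
    unfolding nowhere_dense_in_iff_open by blast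
  then have "\<not> indecomposable M" using indecomposable_thin MX by blast
  then obtain C D where CD: "continuum C" "continuum D" "C \<subset> M" "D \<subset> M" "M = C \<union> D"
    using M unfolding indecomposable_def by blast
  have not_both: "K \<inter> A = {} \<or> K \<inter> B = {}" if "continuum K" "K \<subset> M" for K
  proof (rule ccontr)
    assume "\<not> ?thesis"
    then have "X \<subseteq> A \<union> K \<union> B"
      using irr that MX unfolding irreducible_from_def by blast
    then have "M \<subseteq> K"
      unfolding M_def using continuumD(3)[OF that(1)] by (intro closure_minimal) blast+
    then show False using that by blast
  qed
  note wit = that
  have cover: "X = A \<union> M \<union> B"
    using A B MX closure_subset[of "X - A - B"] unfolding M_def by blast
  have goal: thesis if C: "continuum C" "C \<subset> M" and D: "continuum D" "D \<subset> M" and "M = C \<union> D" "C \<inter> A \<noteq> {}" for C D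
  proof (rule wit)
    have CB: "C \<inter> B = {}" using not_both C \<open>C \<inter> A \<noteq> {}\<close> by blast
    then have "D \<inter> B \<noteq> {}" using MB \<open>M = C \<union> D\<close> by blast
    then have DA: "D \<inter> A = {}" using not_both D by blast
    show "continuum (A \<union> C)" "continuum (B \<union> D)"
      using A B C D \<open>C \<inter> A \<noteq> {}\<close> \<open>D \<inter> B \<noteq> {}\<close> by (auto intro!: continuum_Un)
    show "A \<union> C \<union> (B \<union> D) = X" using cover \<open>M = C \<union> D\<close> by blast
    show "A \<inter> (B \<union> D) = {}" "(A \<union> C) \<inter> B = {}" using AB DA CB by blast+
  qed auto
  show thesis
  proof (cases "C \<inter> A = {}")
    case True
    then show ?thesis using goal[of D C] CD MA by blast
  next
    case False
    then show ?thesis using goal[of C D] CD by blast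
  qed
qed

lemma level_map_exists:
  assumes irr: "irreducible_from X A B"
  obtains m where "level_map X A B m"
proof -
  have A: "continuum A" "closed A" "A \<subseteq> X" "A \<noteq> {}" and B: "continuum B" "closed B" "B \<subseteq> X" "B \<noteq> {}"
    and AB: "A \<inter> B = {}"
    using irr by (auto simp: irreducible_from_def dest: continuumD)
  define good where "good P \<longleftrightarrow> continuum (fst P) \<and> continuum (snd P) \<and> A \<subseteq> fst P \<and> B \<subseteq> snd P \<and> fst P \<union> snd P = X"
    for P :: "'a set \<times> 'a set"
  \<comment> \<open>The first components grow from \<open>A\<close>, the second ones shrink to
    \<open>B\<close>, and each pair covers \<open>X\<close>. Disjointness of the lower part of
    \<open>P\<close> from the upper part of \<open>Q\<close> replaces the closure-inside-interior
    relation of Urysohn's lemma.\<close>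
  define R where "R P Q \<longleftrightarrow> good P \<and> good Q \<and> fst P \<inter> snd Q = {}" for P Q
  have "\<exists>c :: real \<Rightarrow> 'a set \<times> 'a set. c 0 = (A, X) \<and> c 1 = (X, B) \<and>
          (\<forall>x \<in> dyadics \<inter> {0..1}. \<forall>y \<in> dyadics \<inter> {0..1}. x < y \<longrightarrow> R (c x) (c y))"
  proof (rule recursion_on_dyadic_fractions)
    show "R (A, X) (X, B)" using A(1,3) B(1,3) AB X unfolding R_def good_def by simp blast
    show "R P S" if "R P Q" "R Q S" for P Q S
    proof -
      have "fst P \<inter> snd Q = {}" "fst P \<union> snd P = X" "fst Q \<union> snd Q = X" "fst Q \<inter> snd S = {}"
        using that unfolding R_def good_def by simp_all
      then have "fst P \<inter> snd S = {}" by blast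
      then show ?thesis using that unfolding R_def by simp
    qed
    show "\<exists>S. R P S \<and> R S Q" if "R P Q" for P Q
    proof -
      have P: "continuum (fst P)" "A \<subseteq> fst P" "fst P \<union> snd P = X" and Q: "continuum (snd Q)" "B \<subseteq> snd Q" "fst Q \<union> snd Q = X"
        and PQ: "fst P \<inter> snd Q = {}" using that unfolding R_def good_def by simp_all
      then have "fst P \<inter> B = {}" "fst P \<subseteq> X" "snd Q \<subseteq> X" by blast+
      then have "irreducible_from X (fst P) B"
        using irreducible_from_mono[OF irr, of "fst P"] P by simp
      from irreducible_from_sym[OF irreducible_from_mono[OF irreducible_from_sym[OF this], of "snd Q"]]
      have "irreducible_from X (fst P) (snd Q)"
        using Q PQ \<open>snd Q \<subseteq> X\<close> by (simp add: Int_commute)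
      then obtain A' B' where "continuum A'" "continuum B'" "fst P \<subseteq> A'" "snd Q \<subseteq> B'" "A' \<union> B' = X"
        "fst P \<inter> B' = {}" "A' \<inter> snd Q = {}"
        using irreducible_from_split by blast
      then have "R P (A', B') \<and> R (A', B') Q"
        using that subset_trans[OF P(2), of A'] subset_trans[OF Q(2), of B'] unfolding R_def good_def by simp
      then show ?thesis by blast
    qed
  qed
  then obtain c :: "real \<Rightarrow> 'a set \<times> 'a set" where c0: "c 0 = (A, X)" and c1: "c 1 = (X, B)" and
    cR: "\<And>x y. x \<in> dyadics \<inter> {0..1} \<Longrightarrow> y \<in> dyadics \<inter> {0..1} \<Longrightarrow> x < y \<Longrightarrow> R (c x) (c y)" by blast
  define D where "D = dyadics \<inter> {0..1::real}"
  have D01: "0 \<in> D" "1 \<in> D" using real_in_dyadics[of 0] real_in_dyadics[of 1] by (auto simp: D_def)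
  define L where "L r = fst (c r)" for r
  define U where "U r = snd (c r)" for r
  have good: "good (c r)" if "r \<in> D" for r
  proof (cases "r = 1")
    case True
    then show ?thesis using c1 A B X by (auto simp: good_def)
  next
    case False
    then show ?thesis using that cR[of r 1] D01 by (auto simp: D_def R_def)
  qed
  have LU: "L r \<inter> U s = {}" if "r \<in> D" "s \<in> D" "r < s" for r s
    using cR that by (auto simp: D_def R_def L_def U_def)
  have cov: "L r \<union> U r = X" and L: "continuum (L r)" "A \<subseteq> L r" and U: "continuum (U r)" "B \<subseteq> U r" if "r \<in> D" for r
    using good[OF that] by (auto simp: good_def L_def U_def)
  have Lmono: "L r \<subseteq> L s" and Umono: "U s \<subseteq> U r" if "r \<in> D" "s \<in> D" "r \<le> s" for r s
    using that LU[of r s] cov[of r] cov[of s] by (cases "r = s"; auto)+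
  have L1: "L 1 = X" and L0: "L 0 = A" and U1: "U 1 = B" and U0: "U 0 = X" by (auto simp: L_def U_def c0 c1)
  define m where "m x = Inf {r \<in> D. x \<in> L r}" for x
  have bdd: "bdd_below {r \<in> D. x \<in> L r}" for x
    by (rule bdd_belowI[of _ 0]) (auto simp: D_def)
  have ne: "{r \<in> D. x \<in> L r} \<noteq> {}" if "x \<in> X" for x
    using that D01 L1 by blast
  have m_le: "m x \<le> r" if "r \<in> D" "x \<in> L r" for r x
    unfolding m_def using that bdd by (auto intro: cInf_lower)
  have m_less: "\<exists>r\<in>D. r < t \<and> x \<in> L r" if "x \<in> X" "m x < t" for x t
    using that cInf_lessD[OF ne[OF that(1)]] unfolding m_def by blast
  have m0: "0 \<le> m x" if "x \<in> X" for x
    unfolding m_def using ne[OF that] by (intro cInf_greatest) (auto simp: D_def)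
  have m1: "m x \<le> 1" if "x \<in> X" for x using m_le[of 1 x] D01 L1 that by auto
  have dense: "\<exists>r\<in>D. s < r \<and> r < t" if "0 \<le> s" "s < t" "t \<le> 1" for s t
    using dyadic_between[OF that] that by (metis D_def IntI atLeastAtMost_iff less_eq_real_def order.strict_trans1 order.strict_trans2)
  \<comment> \<open>Here and for the superlevel sets, strict dyadic approximation writes the level
    set as the intersection of a chain of continua, which is why it is connected.\<close>
  have sub: "{x\<in>X. m x \<le> t} = \<Inter> (L ` {r\<in>D. t < r})" if t: "0 \<le> t" "t < 1" for t
  proof (intro equalityI subsetI INT_I)
    fix x r assume "x \<in> {x\<in>X. m x \<le> t}" "r \<in> {r\<in>D. t < r}"
    then show "x \<in> L r" using m_less[of x r] Lmono[of _ r] by fastforce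
  next
    fix x assume x: "x \<in> \<Inter> (L ` {r\<in>D. t < r})"
    then have "x \<in> X" using D01 L1 that by auto
    moreover have "m x \<le> t"
    proof (rule ccontr)
      assume "\<not> m x \<le> t"
      then obtain r where "r \<in> D" "t < r" "r < m x" using dense[of t "m x"] t m1[OF \<open>x \<in> X\<close>] by auto
      then show False using x m_le[of r x] by auto
    qed
    ultimately show "x \<in> {x\<in>X. m x \<le> t}" by blast
  qed
  have sup: "{x\<in>X. t \<le> m x} = \<Inter> (U ` {r\<in>D. r < t})" if t: "0 < t" "t \<le> 1" for t
  proof (intro equalityI subsetI INT_I)
    fix x r assume "x \<in> {x\<in>X. t \<le> m x}" "r \<in> {r\<in>D. r < t}"
    then show "x \<in> U r" using m_le[of r x] cov[of r] by fastforce
  next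
    fix x assume x: "x \<in> \<Inter> (U ` {r\<in>D. r < t})"
    then have "x \<in> X" using D01 U0 that by auto
    moreover have "t \<le> m x"
    proof (rule ccontr)
      assume "\<not> t \<le> m x"
      then obtain s where s: "s \<in> D" "s < t" "x \<in> L s" using m_less[of x t] \<open>x \<in> X\<close> by auto
      then obtain r where "r \<in> D" "s < r" "r < t" using dense[of s t] t by (auto simp: D_def)
      then show False using x LU[of s r] s by auto
    qed
    ultimately show "x \<in> {x\<in>X. t \<le> m x}" by blast
  qed
  have "closed {x\<in>X. m x \<le> t} \<and> connected {x\<in>X. m x \<le> t}" for t
  proof -
    consider "t < 0" | "0 \<le> t" "t < 1" | "1 \<le> t" by linarith
    then show ?thesis
    proof cases
      case 1
      then have "{x\<in>X. m x \<le> t} = {}" using m0 by force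
      then show ?thesis by (metis closed_empty connected_empty)
    next
      case 2
      show ?thesis unfolding sub[OF 2]
      proof
        show "closed (\<Inter> (L ` {r\<in>D. t < r}))"
          using L(1) continuumD(3) by blast
        show "connected (\<Inter> (L ` {r\<in>D. t < r}))"
        proof (rule connected_chain)
          show "compact S \<and> connected S" if "S \<in> L ` {r\<in>D. t < r}" for S
            using L(1) continuumD that by blast
          show "S \<subseteq> T \<or> T \<subseteq> S" if ST: "S \<in> L ` {r\<in>D. t < r} \<and> T \<in> L ` {r\<in>D. t < r}" for S T
          proof -
            obtain r s where "S = L r" "T = L s" "r \<in> D" "s \<in> D" using ST by blast
            then show ?thesis using Lmono[of r s] Lmono[of s r] by (cases "r \<le> s") auto
          qed
        qed
      qed
    next
      case 3
      then have "{x\<in>X. m x \<le> t} = X" using m1 by force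
      then show ?thesis using closed_X connected_X by metis
    qed
  qed
  moreover have "closed {x\<in>X. t \<le> m x} \<and> connected {x\<in>X. t \<le> m x}" for t
  proof -
    consider "t \<le> 0" | "0 < t" "t \<le> 1" | "1 < t" by linarith
    then show ?thesis
    proof cases
      case 1
      then have "{x\<in>X. t \<le> m x} = X" using m0 by force
      then show ?thesis using closed_X connected_X by metis
    next
      case 2
      show ?thesis unfolding sup[OF 2]
      proof
        show "closed (\<Inter> (U ` {r\<in>D. r < t}))"
          using U(1) continuumD(3) by blast
        show "connected (\<Inter> (U ` {r\<in>D. r < t}))"
        proof (rule connected_chain)
          show "compact S \<and> connected S" if "S \<in> U ` {r\<in>D. r < t}" for S
            using U(1) continuumD that by blast
          show "S \<subseteq> T \<or> T \<subseteq> S" if ST: "S \<in> U ` {r\<in>D. r < t} \<and> T \<in> U ` {r\<in>D. r < t}" for S T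
          proof -
            obtain r s where "S = U r" "T = U s" "r \<in> D" "s \<in> D" using ST by blast
            then show ?thesis using Umono[of r s] Umono[of s r] by (cases "r \<le> s") auto
          qed
        qed
      qed
    next
      case 3
      then have "{x\<in>X. t \<le> m x} = {}" using m1 by force
      then show ?thesis by (metis closed_empty connected_empty)
    qed
  qed
  moreover have "m x = 0" if "x \<in> A" for x
    using m_le[of 0 x] m0[of x] that D01 L0 A by auto
  moreover have "m x = 1" if "x \<in> B" for x
  proof (rule ccontr)
    assume "m x \<noteq> 1"
    then have "m x < 1" "x \<in> X" using m1[of x] that B by auto
    then show False using m_less[of x 1] LU[of _ 1] D01 U1 that by blast
  qed
  ultimately have "level_map X A B m"
    using m0 m1 unfolding level_map_def by blast
  then show thesis by (rule that)
qed

end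

section \<open>Continuity, slabs and fibres of level maps\<close>

lemma level_mapD:
  assumes "level_map X A B m"
  shows "x \<in> A \<Longrightarrow> m x = 0" "x \<in> B \<Longrightarrow> m x = 1" "x \<in> X \<Longrightarrow> 0 \<le> m x" "x \<in> X \<Longrightarrow> m x \<le> 1"
    "closed {x\<in>X. m x \<le> t}" "connected {x\<in>X. m x \<le> t}"
    "closed {x\<in>X. t \<le> m x}" "connected {x\<in>X. t \<le> m x}"
  using assms unfolding level_map_def by blast+

lemma level_map_continuous:
  assumes lm: "level_map X A B m"
  shows "continuous_on X m"
  unfolding continuous_on_iff
proof (intro ballI allI impI)
  fix x and e :: real assume x: "x \<in> X" and e: "0 < e"
  let ?O = "- ({y\<in>X. m y \<le> m x - e} \<union> {y\<in>X. m x + e \<le> m y})"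
  have "closed ({y\<in>X. m y \<le> m x - e} \<union> {y\<in>X. m x + e \<le> m y})"
    by (intro closed_Un level_mapD[OF lm])
  then have "open ?O" by (rule open_Compl)
  moreover have "x \<in> ?O" using e by auto
  ultimately obtain d where d: "d > 0" "ball x d \<subseteq> ?O"
    using open_contains_ball by blast
  have "dist (m y) (m x) < e" if "y \<in> X" "dist y x < d" for y
  proof -
    have "y \<in> ?O" using d that by (auto simp: dist_commute)
    then show ?thesis using that by (auto simp: dist_real_def abs_less_iff)
  qed
  then show "\<exists>d>0. \<forall>y\<in>X. dist y x < d \<longrightarrow> dist (m y) (m x) < e"
    using d(1) by blast
qed

context nowhere_dense_indecomposables
begin

lemma sublevel_continuum:
  assumes irr: "irreducible_from X A B" and lm: "level_map X A B m" and "0 \<le> t"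
  shows "continuum {x\<in>X. m x \<le> t}" "A \<subseteq> {x\<in>X. m x \<le> t}"
proof -
  show A: "A \<subseteq> {x\<in>X. m x \<le> t}"
    using irr level_mapD(1)[OF lm] \<open>0 \<le> t\<close> unfolding irreducible_from_def by auto
  have "A \<noteq> {}" using irr unfolding irreducible_from_def by (auto dest: continuumD)
  then show "continuum {x\<in>X. m x \<le> t}"
    using A level_mapD(5,6)[OF lm] by (intro continuum_closed_subset[OF X]) blast+
qed

lemma superlevel_continuum:
  assumes irr: "irreducible_from X A B" and lm: "level_map X A B m" and "t \<le> 1"
  shows "continuum {x\<in>X. t \<le> m x}" "B \<subseteq> {x\<in>X. t \<le> m x}"
proof -
  show B: "B \<subseteq> {x\<in>X. t \<le> m x}"
    using irr level_mapD(2)[OF lm] \<open>t \<le> 1\<close> unfolding irreducible_from_def by auto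
  have "B \<noteq> {}" using irr unfolding irreducible_from_def by (auto dest: continuumD)
  then show "continuum {x\<in>X. t \<le> m x}"
    using B level_mapD(7,8)[OF lm] by (intro continuum_closed_subset[OF X]) blast+
qed

lemma irreducible_from_levels:
  assumes irr: "irreducible_from X A B" and lm: "level_map X A B m"
    and "0 \<le> s" "s < t" "t \<le> 1"
  shows "irreducible_from X {x\<in>X. m x \<le> s} {x\<in>X. t \<le> m x}"
proof -
  have "{x\<in>X. m x \<le> s} \<inter> B = {}"
    using level_mapD(2)[OF lm] assms(3-5) by auto
  then have "irreducible_from X {x\<in>X. m x \<le> s} B"
    by (intro irreducible_from_mono[OF irr] sublevel_continuum[OF irr lm] assms) auto
  from irreducible_from_mono[OF irreducible_from_sym[OF this] superlevel_continuum[OF irr lm \<open>t \<le> 1\<close>]]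
  have "irreducible_from X {x\<in>X. t \<le> m x} {x\<in>X. m x \<le> s}"
    using \<open>s < t\<close> by fastforce
  then show ?thesis by (rule irreducible_from_sym)
qed

lemma connected_open_slab:
  assumes irr: "irreducible_from X A B" and lm: "level_map X A B m"
    and "0 \<le> s" "s < t" "t \<le> 1"
  shows "connected {x\<in>X. s < m x \<and> m x < t}"
proof -
  have "{x\<in>X. s < m x \<and> m x < t} = X - {x\<in>X. m x \<le> s} - {x\<in>X. t \<le> m x}" by auto
  then show ?thesis
    using irreducible_from_connected_gap[OF X irreducible_from_levels[OF assms]] by simp
qed

lemma level_map_image:
  assumes irr: "irreducible_from X A B" and lm: "level_map X A B m"
  shows "m ` X = {0..1}"
proof
  show "m ` X \<subseteq> {0..1}" using level_mapD(3,4)[OF lm] by auto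
  obtain a b where "a \<in> A" "b \<in> B" "a \<in> X" "b \<in> X"
    using irreducible_fromD(3,4,7,8)[OF irr] by blast
  then have "0 \<in> m ` X" "1 \<in> m ` X"
    using level_mapD(1,2)[OF lm] by (metis imageI)+
  moreover have "connected (m ` X)"
    using connected_continuous_image[OF level_map_continuous[OF lm] connected_X] .
  ultimately show "{0..1} \<subseteq> m ` X"
    using connected_contains_Icc by blast
qed

text \<open>Open slabs are gaps between two enlarged ends, hence connected. Writing an interior
  fibre as a nested intersection of their closures transfers connectedness to the fibre; the bounds
  on \<open>e\<close> keep the slabs within the range where they are such gaps.\<close>

lemma fibre_eq_Inter_slabs:
  assumes lm: "level_map X A B m" and "0 < t" "t < 1"
  shows "{x\<in>X. m x = t} = (\<Inter>e\<in>{e. 0 < e \<and> e \<le> t \<and> e \<le> 1 - t}. closure {x\<in>X. t - e < m x \<and> m x < t + e})"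
    (is "?F = (\<Inter>e\<in>?E. closure (?S e))")
proof (intro equalityI subsetI INT_I)
  fix x e assume "x \<in> ?F" "e \<in> ?E"
  then have "x \<in> ?S e" by auto
  then show "x \<in> closure (?S e)" by (rule subsetD[OF closure_subset])
next
  fix x assume x: "x \<in> (\<Inter>e\<in>?E. closure (?S e))"
  have sub: "closure (?S e) \<subseteq> {x\<in>X. m x \<le> t + e} \<inter> {x\<in>X. t - e \<le> m x}" for e
  proof (rule closure_minimal)
    show "closed ({x\<in>X. m x \<le> t + e} \<inter> {x\<in>X. t - e \<le> m x})"
      by (intro closed_Int level_mapD(5,7)[OF lm])
  qed auto
  have E: "min t (1 - t) \<in> ?E" using assms by auto
  then have "x \<in> closure (?S (min t (1 - t)))" using x by blast
  then have "x \<in> X" using sub[of "min t (1 - t)"] by blast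
  moreover have "m x = t"
  proof (rule ccontr)
    assume "m x \<noteq> t"
    define e where "e = min (min t (1 - t)) (\<bar>m x - t\<bar> / 2)"
    have "e \<in> ?E" using E \<open>m x \<noteq> t\<close> by (auto simp: e_def)
    then have "x \<in> closure (?S e)" using x by blast
    then have "m x \<le> t + e" "t - e \<le> m x" using sub[of e] by blast+
    moreover have "e \<le> \<bar>m x - t\<bar> / 2" unfolding e_def by (rule min.cobounded2)
    then have "e < \<bar>m x - t\<bar>" using \<open>m x \<noteq> t\<close> by auto
    ultimately show False by auto
  qed
  ultimately show "x \<in> ?F" by blast
qed

lemma fibre_continuum:
  assumes irr: "irreducible_from X A B" and lm: "level_map X A B m" and "0 \<le> t" "t \<le> 1"
  shows "continuum {x\<in>X. m x = t}"
proof -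
  have "t \<in> m ` X" using level_map_image[OF irr lm] assms by auto
  then have ne: "{x\<in>X. m x = t} \<noteq> {}" by blast
  have eq: "{x\<in>X. m x = t} = {x\<in>X. m x \<le> t} \<inter> {x\<in>X. t \<le> m x}" by auto
  have cl: "closed {x\<in>X. m x = t}"
    unfolding eq by (intro closed_Int level_mapD(5,7)[OF lm])
  consider "t = 0" | "t = 1" | "0 < t" "t < 1" using assms by linarith
  then have "connected {x\<in>X. m x = t}"
  proof cases
    case 1
    then have "{x\<in>X. m x = t} = {x\<in>X. m x \<le> 0}"
      using level_mapD(3)[OF lm] by force
    then show ?thesis using level_mapD(6)[OF lm, of 0] by simp
  next
    case 2
    then have "{x\<in>X. m x = t} = {x\<in>X. 1 \<le> m x}"
      using level_mapD(4)[OF lm] by force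
    then show ?thesis using level_mapD(8)[OF lm, of 1] by simp
  next
    case 3
    let ?E = "{e. 0 < e \<and> e \<le> t \<and> e \<le> 1 - t}"
    let ?S = "\<lambda>e. {x\<in>X. t - e < m x \<and> m x < t + e}"
    have "connected (\<Inter>e\<in>?E. closure (?S e))"
    proof (rule connected_chain)
      fix S assume "S \<in> (\<lambda>e. closure (?S e)) ` ?E"
      then obtain e where e: "e \<in> ?E" "S = closure (?S e)" by blast
      have "closure (?S e) \<subseteq> X" by (intro closure_minimal closed_X) auto
      then have "compact S" using compact_Int_closed[OF compact_X closed_closure, of "?S e"] e(2) by (simp add: Int_absorb1)
      moreover have "connected (?S e)"
        using e by (intro connected_open_slab[OF irr lm]) auto
      ultimately show "compact S \<and> connected S" using e connected_imp_connected_closure by blast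
    next
      fix S T assume "S \<in> (\<lambda>e. closure (?S e)) ` ?E \<and> T \<in> (\<lambda>e. closure (?S e)) ` ?E"
      then obtain e e' where e: "S = closure (?S e)" "T = closure (?S e')" by blast
      have "?S e \<subseteq> ?S e' \<or> ?S e' \<subseteq> ?S e" by (cases "e \<le> e'") force+
      then show "S \<subseteq> T \<or> T \<subseteq> S" unfolding e by (meson closure_mono)
    qed
    then show ?thesis unfolding fibre_eq_Inter_slabs[OF lm 3] .
  qed
  then show ?thesis
    using continuum_closed_subset[OF X cl _ _ ne] by blast
qed

text \<open>If the order were reversed, the sublevel set of \<open>m\<close> at \<open>x\<close> and
  the superlevel set of \<open>m'\<close> at \<open>x\<close> would form a continuum through
  \<open>x\<close> joining \<open>A\<close> to \<open>B\<close>, hence all of \<open>X\<close>,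
  although \<open>y\<close> lies in neither.\<close>

lemma level_maps_comonotone:
  assumes irr: "irreducible_from X A B"
    and lm: "level_map X A B m" and lm': "level_map X A B m'"
    and x: "x \<in> X" and y: "y \<in> X" and less: "m x < m y"
  shows "m' x \<le> m' y"
proof (rule ccontr)
  assume "\<not> m' x \<le> m' y"
  let ?C = "{z\<in>X. m z \<le> m x}" and ?D = "{z\<in>X. m' x \<le> m' z}"
  have C: "continuum ?C" "A \<subseteq> ?C"
    using sublevel_continuum[OF irr lm] level_mapD(3)[OF lm x] by blast+
  have D: "continuum ?D" "B \<subseteq> ?D"
    using superlevel_continuum[OF irr lm'] level_mapD(4)[OF lm' x] by blast+
  have "continuum (?C \<union> ?D)" using C D x by (intro continuum_Un) auto
  moreover have "?C \<union> ?D \<subseteq> X" by blast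
  moreover have "A \<noteq> {}" "B \<noteq> {}" using irr unfolding irreducible_from_def by (auto dest: continuumD)
  then have "(?C \<union> ?D) \<inter> A \<noteq> {}" "(?C \<union> ?D) \<inter> B \<noteq> {}"
    using C(2) D(2) by blast+
  ultimately have "X \<subseteq> A \<union> (?C \<union> ?D) \<union> B"
    using irr unfolding irreducible_from_def by blast
  then have "y \<in> ?C \<union> ?D" using C(2) D(2) y by blast
  then show False using less \<open>\<not> m' x \<le> m' y\<close> by auto
qed

text \<open>\<open>F\<close> is \<open>X\<close> with the part of \<open>V\<close> outside the ends
  removed, and \<open>A0\<close>, \<open>B0\<close> are the components of \<open>F\<close>
  containing the ends. Splitting twice gives disjoint continua \<open>A2\<close> and
  \<open>B1\<close> that properly enlarge \<open>A0\<close> and \<open>B0\<close>. By maximality of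
  components both must leave \<open>F\<close>, that is, enter \<open>V\<close>. A level map from
  \<open>A2\<close> to \<open>B1\<close> is then 0 at one point of \<open>V\<close> and 1 at
  another.\<close>

lemma level_map_separating:
  assumes irr: "irreducible_from X A B" and V: "open V" "V \<inter> (X - A - B) \<noteq> {}"
  obtains m v w where "level_map X A B m" "v \<in> V \<inter> X" "w \<in> V \<inter> X" "m v \<noteq> m w"
proof -
  have A: "continuum A" "closed A" "A \<subseteq> X" "A \<noteq> {}" and B: "continuum B" "closed B" "B \<subseteq> X" "B \<noteq> {}"
    and AB: "A \<inter> B = {}"
    using irr by (auto simp: irreducible_from_def dest: continuumD)
  define F where "F = X - (V - (A \<union> B))"
  have "F = X \<inter> - (V - (A \<union> B))" unfolding F_def by blast
  moreover have "closed (- (V - (A \<union> B)))" using V(1) A B by (intro closed_Compl open_Diff closed_Un)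
  ultimately have F: "closed F" using closed_X by auto
  have AF: "A \<subseteq> F" and BF: "B \<subseteq> F" and FX: "F \<subseteq> X" and FneX: "\<not> X \<subseteq> F" using A B V by (auto simp: F_def)
  obtain a b where a: "a \<in> A" and b: "b \<in> B" using A B by blast
  define A0 where "A0 = connected_component_set F a"
  define B0 where "B0 = connected_component_set F b"
  have A0F: "A0 \<subseteq> F" and B0F: "B0 \<subseteq> F" unfolding A0_def B0_def by (rule connected_component_subset)+
  have A0max: "K \<subseteq> A0" if "connected K" "a \<in> K" "K \<subseteq> F" for K
    unfolding A0_def using that by (metis connected_component_maximal)
  have B0max: "K \<subseteq> B0" if "connected K" "b \<in> K" "K \<subseteq> F" for K
    unfolding B0_def using that by (metis connected_component_maximal)
  have AA0: "A \<subseteq> A0" and BB0: "B \<subseteq> B0"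
    using A0max[OF continuumD(4)[OF A(1)] a AF] B0max[OF continuumD(4)[OF B(1)] b BF] .
  have A0: "continuum A0" and B0: "continuum B0"
  proof -
    have "closed A0" "closed B0" "connected A0" "connected B0"
      unfolding A0_def B0_def using F by (simp_all add: closed_connected_component)
    moreover have "A0 \<subseteq> X" "B0 \<subseteq> X" "A0 \<noteq> {}" "B0 \<noteq> {}" using A0F B0F FX AA0 BB0 a b by blast+
    ultimately show "continuum A0" "continuum B0"
      using continuum_closed_subset[OF X, of A0] continuum_closed_subset[OF X, of B0] by simp_all
  qed
  have "A0 \<inter> B0 = {}"
  proof (rule ccontr)
    assume "A0 \<inter> B0 \<noteq> {}"
    then have eq: "A0 = B0" unfolding A0_def B0_def by (simp add: connected_component_nonoverlap)
    have "A0 \<subseteq> X" "A0 \<inter> A \<noteq> {}" "A0 \<inter> B \<noteq> {}" using A0F FX AA0 BB0 a b eq by blast+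
    then have "X \<subseteq> A \<union> A0 \<union> B"
      using irr A0 unfolding irreducible_from_def by blast
    then show False using A0F AF BF FneX by blast
  qed
  have irr0: "irreducible_from X A0 B0"
  proof -
    have sub: "A0 \<subseteq> X" "B0 \<subseteq> X" "A0 \<inter> B = {}" "B0 \<inter> A0 = {}" using A0F B0F FX BB0 \<open>A0 \<inter> B0 = {}\<close> by blast+
    have "irreducible_from X A0 B"
      by (rule irreducible_from_mono[OF irr A0 AA0 sub(1,3)])
    from irreducible_from_mono[OF irreducible_from_sym[OF this] B0 BB0 sub(2,4)]
    show ?thesis by (rule irreducible_from_sym)
  qed
  obtain A1 B1 where 1: "continuum A1" "continuum B1" "A0 \<subseteq> A1" "B0 \<subseteq> B1" "A1 \<union> B1 = X"
    "A0 \<inter> B1 = {}" "A1 \<inter> B0 = {}"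
    using irreducible_from_split[OF irr0] by blast
  have irr1: "irreducible_from X A0 B1"
  proof -
    have "B1 \<subseteq> X" "B1 \<inter> A0 = {}" using 1 by blast+
    then show ?thesis
      using irreducible_from_sym[OF irreducible_from_mono[OF irreducible_from_sym[OF irr0] 1(2,4)]] by simp
  qed
  obtain A2 B2 where 2: "continuum A2" "continuum B2" "A0 \<subseteq> A2" "B1 \<subseteq> B2" "A2 \<union> B2 = X"
    "A0 \<inter> B2 = {}" "A2 \<inter> B1 = {}"
    using irreducible_from_split[OF irr1] by blast
  have meet: "P \<inter> Q \<noteq> {}" if "continuum P" "continuum Q" "P \<union> Q = X" for P Q
    using connected_X that continuumD(1,3)[OF that(1)] continuumD(1,3)[OF that(2)]
    unfolding connected_closed_set[OF closed_X] by blast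
  obtain v where v: "v \<in> A2" "v \<in> X - F"
  proof -
    have "\<not> A2 \<subseteq> F"
    proof
      assume "A2 \<subseteq> F"
      then have "A2 \<subseteq> A0" using A0max[of A2] continuumD(4)[OF 2(1)] 2(3) AA0 a by blast
      then show False using meet[OF 2(1,2,5)] 2(6) by blast
    qed
    then show thesis using that 2(5) by blast
  qed
  obtain w where w: "w \<in> B1" "w \<in> X - F"
  proof -
    have "\<not> B1 \<subseteq> F"
    proof
      assume "B1 \<subseteq> F"
      then have "B1 \<subseteq> B0" using B0max[of B1] continuumD(4)[OF 1(2)] 1(4) BB0 b by blast
      then show False using meet[OF 1(1,2,5)] 1(7) by blast
    qed
    then show thesis using that 1(5) by blast
  qed
  have "A2 \<subseteq> X" using 2(5) by blast
  then have "irreducible_from X A2 B1"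
    using irreducible_from_mono[OF irr1 2(1,3)] 2(7) by simp
  then obtain m where m: "level_map X A2 B1 m" using level_map_exists by blast
  have "level_map X A B m"
  proof -
    have "\<forall>x\<in>A. m x = 0" "\<forall>x\<in>B. m x = 1"
      using level_mapD(1,2)[OF m] AA0 BB0 2(3) 1(4) by blast+
    then show ?thesis using m unfolding level_map_def by blast
  qed
  moreover have "m v \<noteq> m w" using level_mapD(1,2)[OF m] v w by simp
  moreover have "v \<in> V \<inter> X" "w \<in> V \<inter> X" using v w unfolding F_def by blast+
  ultimately show thesis using that by blast
qed

text \<open>For each basic open set that meets the gap a level map is chosen that is not constant
  there; a weighted sum of all of them is non-constant on every open set meeting the gap. The point
  to check is that the sum still has connected sublevel and superlevel sets.\<close>

lemma fine_level_map_exists: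
  assumes irr: "irreducible_from X A B"
  obtains m where "level_map X A B m"
    "\<And>V. open V \<Longrightarrow> V \<inter> (X - A - B) \<noteq> {} \<Longrightarrow> \<exists>v\<in>V \<inter> X. \<exists>w\<in>V \<inter> X. m v \<noteq> m w"
proof -
  have A: "A \<subseteq> X" "A \<noteq> {}" and B: "B \<subseteq> X" "B \<noteq> {}"
    using irreducible_fromD[OF irr] by simp_all
  obtain \<C> :: "'a set set" where \<C>: "countable \<C>" "topological_basis \<C>"
    using ex_countable_basis by blast
  then have "\<C> \<noteq> {}" using topological_basisE[OF \<C>(2) open_UNIV UNIV_I] by blast
  define \<B> where "\<B> = from_nat_into \<C>"
  have range_\<B>: "range \<B> = \<C>" unfolding \<B>_def using \<open>\<C> \<noteq> {}\<close> \<C>(1) by (rule range_from_nat_into)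
  have \<B>: "open (\<B> n)" for n
    using topological_basis_open[OF \<C>(2)] range_\<B> by blast
  have "\<exists>\<mu>. level_map X A B \<mu> \<and>
      (\<B> n \<inter> (X - A - B) \<noteq> {} \<longrightarrow> (\<exists>v\<in>\<B> n \<inter> X. \<exists>w\<in>\<B> n \<inter> X. \<mu> v \<noteq> \<mu> w))" for n
  proof (cases "\<B> n \<inter> (X - A - B) = {}")
    case True
    then show ?thesis using level_map_exists[OF irr] by blast
  next
    case False
    obtain \<mu> v w where "level_map X A B \<mu>" "v \<in> \<B> n \<inter> X" "w \<in> \<B> n \<inter> X" "\<mu> v \<noteq> \<mu> w"
      using level_map_separating[OF irr \<B>[of n] False] .
    then show ?thesis by blast
  qed
  then have "\<exists>\<mu>. \<forall>n. level_map X A B (\<mu> n) \<and>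
      (\<B> n \<inter> (X - A - B) \<noteq> {} \<longrightarrow> (\<exists>v\<in>\<B> n \<inter> X. \<exists>w\<in>\<B> n \<inter> X. \<mu> n v \<noteq> \<mu> n w))"
    by (intro choice allI)
  then obtain \<mu> where lm: "\<And>n. level_map X A B (\<mu> n)"
    and sep: "\<And>n. \<B> n \<inter> (X - A - B) \<noteq> {} \<Longrightarrow> \<exists>v\<in>\<B> n \<inter> X. \<exists>w\<in>\<B> n \<inter> X. \<mu> n v \<noteq> \<mu> n w"
    by blast
  \<comment> \<open>The exponent \<open>Suc n\<close> makes the weights sum to 1, so the sum takes
    the value 1 on \<open>B\<close>.\<close>
  define c where "c n = (1/2::real) ^ Suc n" for n
  have csum: "c sums 1" unfolding c_def by (rule power_half_series)
  have cpos: "0 < c n" for n by (simp add: c_def)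
  define m where "m x = (\<Sum>n. c n * \<mu> n x)" for x
  have bnd: "0 \<le> \<mu> n x" "\<mu> n x \<le> 1" if "x \<in> X" for n x
    using level_mapD(3,4)[OF lm that] by blast+
  have le_c: "c n * \<mu> n x \<le> c n" "0 \<le> c n * \<mu> n x" if "x \<in> X" for n x
    using bnd[OF that, of n] cpos[of n] by (simp_all add: mult_left_le)
  have summ: "summable (\<lambda>n. c n * \<mu> n x)" if "x \<in> X" for x
    by (rule summable_comparison_test'[OF sums_summable[OF csum], of 0]) (use le_c[OF that] in auto)
  have cont: "continuous_on X m"
  proof -
    have u: "uniform_limit X (\<lambda>n x. \<Sum>i<n. c i * \<mu> i x) (\<lambda>x. \<Sum>i. c i * \<mu> i x) sequentially"
      by (rule Weierstrass_m_test[OF _ sums_summable[OF csum]]) (use le_c in auto)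
    have "\<forall>n. continuous_on X (\<lambda>x. \<Sum>i<n. c i * \<mu> i x)"
      by (intro allI continuous_intros level_map_continuous[OF lm])
    then show ?thesis
      unfolding m_def by (intro uniform_limit_theorem[OF always_eventually u]) simp_all
  qed
  \<comment> \<open>The summands never disagree strictly about the order of two points, so no
    cancellation occurs and comparing sums is the same as comparing all coordinates.\<close>
  have m_le_iff: "m y \<le> m x \<longleftrightarrow> (\<forall>n. \<mu> n y \<le> \<mu> n x)" if x: "x \<in> X" and y: "y \<in> X" for x y
  proof
    assume "\<forall>n. \<mu> n y \<le> \<mu> n x"
    then show "m y \<le> m x"
      unfolding m_def using cpos by (intro suminf_le summ x y) (simp add: less_imp_le)
  next
    assume le: "m y \<le> m x"
    show "\<forall>n. \<mu> n y \<le> \<mu> n x"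
    proof (rule ccontr)
      assume "\<not> (\<forall>n. \<mu> n y \<le> \<mu> n x)"
      then obtain i where i: "\<mu> i x < \<mu> i y" by (auto simp: not_le)
      have "\<mu> j x \<le> \<mu> j y" for j
        by (rule level_maps_comonotone[OF irr lm lm x y i])
      then have "0 \<le> c j * \<mu> j y - c j * \<mu> j x" for j
        using cpos[of j] by simp
      moreover have "0 < c i * \<mu> i y - c i * \<mu> i x"
        using cpos[of i] i by simp
      ultimately have "0 < (\<Sum>j. c j * \<mu> j y - c j * \<mu> j x)"
        using suminf_pos2[OF summable_diff[OF summ[OF y] summ[OF x]]] by blast
      also have "\<dots> = m y - m x" unfolding m_def by (rule suminf_diff[OF summ[OF y] summ[OF x], symmetric])
      finally show False using le by simp
    qed
  qed
  have mA: "m x = 0" if "x \<in> A" for x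
    using level_mapD(1)[OF lm that] by (simp add: m_def)
  have mB: "m x = 1" if "x \<in> B" for x
    using level_mapD(2)[OF lm that] sums_unique[OF csum] by (simp add: m_def)
  obtain a b where ab: "a \<in> A" "b \<in> B" using A B by blast
  have m01: "0 \<le> m x" "m x \<le> 1" if "x \<in> X" for x
    using m_le_iff[of x a] m_le_iff[of b x] that ab A B mA mB bnd[OF that]
      level_mapD(1)[OF lm] level_mapD(2)[OF lm] by auto
  have attain: "t \<in> m ` X" if "0 \<le> t" "t \<le> 1" for t
  proof -
    have "0 \<in> m ` X" "1 \<in> m ` X" using ab A B mA mB by (metis imageI subsetD)+
    then have "{0..1} \<subseteq> m ` X"
      using connected_contains_Icc connected_continuous_image[OF cont connected_X] by blast
    then show ?thesis using that by auto
  qed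
  \<comment> \<open>By comonotonicity the level sets of different summands through the same point
    are nested. Hence a level set of the sum is the intersection of a chain of continua.\<close>
  have chainL: "{y\<in>X. \<mu> i y \<le> \<mu> i x} \<subseteq> {y\<in>X. \<mu> j y \<le> \<mu> j x} \<or> {y\<in>X. \<mu> j y \<le> \<mu> j x} \<subseteq> {y\<in>X. \<mu> i y \<le> \<mu> i x}"
    and chainU: "{y\<in>X. \<mu> i x \<le> \<mu> i y} \<subseteq> {y\<in>X. \<mu> j x \<le> \<mu> j y} \<or> {y\<in>X. \<mu> j x \<le> \<mu> j y} \<subseteq> {y\<in>X. \<mu> i x \<le> \<mu> i y}"
    for i j x
  proof -
    have co: "\<mu> j u \<le> \<mu> j v" if "u \<in> X" "v \<in> X" "\<mu> i u < \<mu> i v" for u v i j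
      using level_maps_comonotone[OF irr lm lm that] .
    show "{y\<in>X. \<mu> i y \<le> \<mu> i x} \<subseteq> {y\<in>X. \<mu> j y \<le> \<mu> j x} \<or> {y\<in>X. \<mu> j y \<le> \<mu> j x} \<subseteq> {y\<in>X. \<mu> i y \<le> \<mu> i x}"
    proof (rule ccontr)
      assume "\<not> ?thesis"
      then obtain u v where "u \<in> X" "v \<in> X" "\<mu> i u \<le> \<mu> i x" "\<not> \<mu> j u \<le> \<mu> j x" "\<mu> j v \<le> \<mu> j x" "\<not> \<mu> i v \<le> \<mu> i x" by blast
      then show False using co[of u v i j] by linarith
    qed
    show "{y\<in>X. \<mu> i x \<le> \<mu> i y} \<subseteq> {y\<in>X. \<mu> j x \<le> \<mu> j y} \<or> {y\<in>X. \<mu> j x \<le> \<mu> j y} \<subseteq> {y\<in>X. \<mu> i x \<le> \<mu> i y}"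
    proof (rule ccontr)
      assume "\<not> ?thesis"
      then obtain u v where "u \<in> X" "v \<in> X" "\<mu> i x \<le> \<mu> i u" "\<not> \<mu> j x \<le> \<mu> j u" "\<mu> j x \<le> \<mu> j v" "\<not> \<mu> i x \<le> \<mu> i v" by blast
      then show False using co[of v u i j] by linarith
    qed
  qed
  have sub: "connected {y\<in>X. m y \<le> t}" for t
  proof -
    consider "t < 0" | "0 \<le> t" "t \<le> 1" | "1 < t" by linarith
    then show ?thesis
    proof cases
      case 1
      then have "{y\<in>X. m y \<le> t} = {}" using m01 by force
      then show ?thesis by (metis connected_empty)
    next
      case 2
      then obtain x where x: "x \<in> X" "t = m x" using attain by blast
      then have "{y\<in>X. m y \<le> t} = (\<Inter>i. {y\<in>X. \<mu> i y \<le> \<mu> i x})" using m_le_iff by auto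
      moreover have "connected (\<Inter>i. {y\<in>X. \<mu> i y \<le> \<mu> i x})"
      proof (rule connected_chain)
        fix S assume "S \<in> range (\<lambda>i. {y\<in>X. \<mu> i y \<le> \<mu> i x})"
        then obtain i where "S = {y\<in>X. \<mu> i y \<le> \<mu> i x}" by blast
        moreover have "continuum {y\<in>X. \<mu> i y \<le> \<mu> i x}"
          using sublevel_continuum(1)[OF irr lm] bnd(1)[OF x(1)] by blast
        ultimately show "compact S \<and> connected S" by (metis continuumD(2,4))
      qed (use chainL in blast)
      ultimately show ?thesis by metis
    next
      case 3
      then have "{y\<in>X. m y \<le> t} = X" using m01 by force
      then show ?thesis using connected_X by metis
    qed
  qed
  have super: "connected {y\<in>X. t \<le> m y}" for t
  proof -
    consider "t < 0" | "0 \<le> t" "t \<le> 1" | "1 < t" by linarith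
    then show ?thesis
    proof cases
      case 1
      then have "{y\<in>X. t \<le> m y} = X" using m01 by force
      then show ?thesis using connected_X by metis
    next
      case 2
      then obtain x where x: "x \<in> X" "t = m x" using attain by blast
      then have "{y\<in>X. t \<le> m y} = (\<Inter>i. {y\<in>X. \<mu> i x \<le> \<mu> i y})" using m_le_iff by auto
      moreover have "connected (\<Inter>i. {y\<in>X. \<mu> i x \<le> \<mu> i y})"
      proof (rule connected_chain)
        fix S assume "S \<in> range (\<lambda>i. {y\<in>X. \<mu> i x \<le> \<mu> i y})"
        then obtain i where "S = {y\<in>X. \<mu> i x \<le> \<mu> i y}" by blast
        moreover have "continuum {y\<in>X. \<mu> i x \<le> \<mu> i y}"
          using superlevel_continuum(1)[OF irr lm] bnd(2)[OF x(1)] by blast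
        ultimately show "compact S \<and> connected S" by (metis continuumD(2,4))
      qed (use chainU in blast)
      ultimately show ?thesis by metis
    next
      case 3
      then have "{y\<in>X. t \<le> m y} = {}" using m01 by force
      then show ?thesis by (metis connected_empty)
    qed
  qed
  have "closed {y\<in>X. m y \<le> t}" "closed {y\<in>X. t \<le> m y}" for t
  proof -
    have "{y\<in>X. m y \<le> t} = X \<inter> m -` {..t}" "{y\<in>X. t \<le> m y} = X \<inter> m -` {t..}" by auto
    then show "closed {y\<in>X. m y \<le> t}" "closed {y\<in>X. t \<le> m y}"
      using continuous_closed_preimage[OF cont closed_X] by (metis closed_atMost, metis closed_atLeast)
  qed
  then have "level_map X A B m"
    unfolding level_map_def using mA mB m01 sub super by blast
  moreover have "\<exists>v\<in>V \<inter> X. \<exists>w\<in>V \<inter> X. m v \<noteq> m w" if V: "open V" "V \<inter> (X - A - B) \<noteq> {}" for V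
  proof -
    obtain z where z: "z \<in> V" "z \<in> X - A - B" using V(2) by blast
    obtain n where n: "\<B> n \<subseteq> V" "z \<in> \<B> n"
      using topological_basisE[OF \<C>(2) V(1) z(1)] range_\<B> by blast
    then have "\<B> n \<inter> (X - A - B) \<noteq> {}" using z by blast
    then obtain v w where vw: "v \<in> \<B> n \<inter> X" "w \<in> \<B> n \<inter> X" "\<mu> n v \<noteq> \<mu> n w" using sep by blast
    then have "m v \<noteq> m w" using m_le_iff[of v w] m_le_iff[of w v] by (metis IntD2 order_antisym order_refl)
    then show ?thesis using vw n by blast
  qed
  ultimately show thesis using that by blast
qed

text \<open>An open set inside one fibre must miss the gap, hence lies in
  \<open>A \<union> B\<close>; below level 1 the part in \<open>B\<close> is excluded. The
  alternative on \<open>t\<close> permits an end \<open>B\<close> with interior, as happens in the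
  reduction to two points.\<close>

lemma fine_fibre_nowhere_dense:
  assumes lm: "level_map X A B m"
    and fine: "\<And>V. open V \<Longrightarrow> V \<inter> (X - A - B) \<noteq> {} \<Longrightarrow> \<exists>v\<in>V \<inter> X. \<exists>w\<in>V \<inter> X. m v \<noteq> m w"
    and A: "nowhere_dense_in X A" "closed A" and t: "t < 1 \<or> nowhere_dense_in X B"
  shows "nowhere_dense_in X {x\<in>X. m x = t}"
  unfolding nowhere_dense_in_iff_open
proof (intro allI impI)
  fix V assume V: "open V \<and> V \<inter> X \<subseteq> {x\<in>X. m x = t}"
  then have "V \<inter> (X - A - B) = {}" using fine[of V] by blast
  then have sub: "V \<inter> X \<subseteq> A \<union> B" by blast
  from t show "V \<inter> X = {}"
  proof
    assume "t < 1"
    then have "V \<inter> X \<subseteq> A" using sub V level_mapD(2)[OF lm] by fastforce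
    then show ?thesis using A V unfolding nowhere_dense_in_iff_open by blast
  next
    assume "nowhere_dense_in X B"
    then have "nowhere_dense_in X (A \<union> B)" using A nowhere_dense_in_Un by blast
    then show ?thesis using sub V unfolding nowhere_dense_in_iff_open by blast
  qed
qed

text \<open>A continuum meeting two levels joins a sublevel set to a disjoint superlevel set, so it
  contains the open slab between them. That slab is non-empty, because the intermediate value
  \<open>(s + t) / 2\<close> is attained.\<close>

lemma nowhere_dense_continuum_in_fibre:
  assumes irr: "irreducible_from X A B" and lm: "level_map X A B m"
    and N: "continuum N" "N \<subseteq> X" "nowhere_dense_in X N" and x: "x \<in> N" and y: "y \<in> N"
  shows "m x = m y"
proof -
  have "\<not> m x < m y" if x: "x \<in> N" and y: "y \<in> N" for x y
  proof
    assume "m x < m y"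
    then obtain s t where st: "m x < s" "s < t" "t < m y" by (meson dense)
    have s0: "0 \<le> s" and t1: "t \<le> 1"
      using level_mapD(3,4)[OF lm] x y N(2) st by (meson less_eq_real_def order_trans subsetD)+
    let ?L = "{z\<in>X. m z \<le> s}" and ?U = "{z\<in>X. t \<le> m z}"
    have "N \<inter> ?L \<noteq> {}" "N \<inter> ?U \<noteq> {}" using x y N(2) st by auto
    then have "X \<subseteq> ?L \<union> N \<union> ?U"
      using irreducible_from_levels[OF irr lm s0 st(2) t1] N unfolding irreducible_from_def by blast
    then have "- (?L \<union> ?U) \<inter> X \<subseteq> N" by blast
    moreover have "open (- (?L \<union> ?U))"
      using level_mapD(5,7)[OF lm] by (intro open_Compl closed_Un)
    ultimately have "- (?L \<union> ?U) \<inter> X = {}"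
      using N(3) unfolding nowhere_dense_in_iff_open by blast
    moreover have "(s + t) / 2 \<in> m ` X" using level_map_image[OF irr lm] s0 t1 st by auto
    then obtain z where z: "z \<in> X" "m z = (s + t) / 2" by auto
    moreover have "z \<in> - (?L \<union> ?U)" using z st by auto
    ultimately show False by blast
  qed
  then show ?thesis using x y by (meson linorder_less_linear)
qed

end

section \<open>Open finite-to-one maps\<close>

definition finite_open_self_map :: "'a::metric_space set \<Rightarrow> nat \<Rightarrow> ('a \<Rightarrow> 'a) \<Rightarrow> bool" where
  "finite_open_self_map X d h \<longleftrightarrow> continuous_on X h \<and> h ` X = X \<and>
     (\<forall>U. openin (top_of_set X) U \<longrightarrow> openin (top_of_set X) (h ` U)) \<and>
     (\<forall>y\<in>X. finite {x\<in>X. h x = y} \<and> card {x\<in>X. h x = y} \<le> d)"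

lemma finite_open_self_mapD:
  assumes "finite_open_self_map X d h"
  shows "continuous_on X h" "h ` X = X" "openin (top_of_set X) U \<Longrightarrow> openin (top_of_set X) (h ` U)"
    "y \<in> X \<Longrightarrow> finite {x\<in>X. h x = y}" "y \<in> X \<Longrightarrow> card {x\<in>X. h x = y} \<le> d" "x \<in> X \<Longrightarrow> h x \<in> X"
  using assms unfolding finite_open_self_map_def by auto

text \<open>A given point is reached from a given open set only by some iterate, so the results on
  images of fibres must hold for iterates.\<close>

lemma finite_open_self_map_funpow:
  assumes f: "finite_open_self_map X d f"
  shows "finite_open_self_map X (d ^ k) (f ^^ k)"
proof (induction k)
  case 0
  have "{x\<in>X. x = y} = {y}" if "y \<in> X" for y using that by auto
  then show ?case by (simp add: finite_open_self_map_def)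
next
  case (Suc k)
  note g = Suc.IH
  have im: "(f ^^ Suc k) ` U = f ` ((f ^^ k) ` U)" for U by (simp add: image_image)
  show ?case
    unfolding finite_open_self_map_def
  proof (intro conjI ballI allI impI)
    show "continuous_on X (f ^^ Suc k)"
      using continuous_on_compose[OF finite_open_self_mapD(1)[OF g]] finite_open_self_mapD(1,2)[OF f]
        finite_open_self_mapD(2)[OF g] by simp
    show "(f ^^ Suc k) ` X = X"
      unfolding im finite_open_self_mapD(2)[OF g] by (rule finite_open_self_mapD(2)[OF f])
    show "openin (top_of_set X) ((f ^^ Suc k) ` U)" if "openin (top_of_set X) U" for U
      unfolding im by (intro finite_open_self_mapD(3)[OF f] finite_open_self_mapD(3)[OF g] that)
    fix y assume y: "y \<in> X"
    have eq: "{x\<in>X. (f ^^ Suc k) x = y} = (\<Union>z\<in>{z\<in>X. f z = y}. {x\<in>X. (f ^^ k) x = z})"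
      using finite_open_self_mapD(6)[OF g] by auto
    show "finite {x\<in>X. (f ^^ Suc k) x = y}"
      unfolding eq by (rule finite_UN_I[OF finite_open_self_mapD(4)[OF f y]]) (use finite_open_self_mapD(4)[OF g] in auto)
    have "card {x\<in>X. (f ^^ Suc k) x = y} \<le> (\<Sum>z\<in>{z\<in>X. f z = y}. card {x\<in>X. (f ^^ k) x = z})"
      unfolding eq by (rule card_UN_le[OF finite_open_self_mapD(4)[OF f y]])
    also have "\<dots> \<le> of_nat (card {z\<in>X. f z = y}) * d ^ k"
      by (rule sum_bounded_above) (use finite_open_self_mapD(5)[OF g] in auto)
    also have "\<dots> \<le> d * d ^ k" using finite_open_self_mapD(5)[OF f y] by simp
    finally show "card {x\<in>X. (f ^^ Suc k) x = y} \<le> d ^ Suc k" by simp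
  qed
qed

lemma finite_set_separated:
  fixes T :: "'a::metric_space set"
  assumes "finite T"
  obtains e where "0 < e" "\<And>p q. p \<in> T \<Longrightarrow> q \<in> T \<Longrightarrow> p \<noteq> q \<Longrightarrow> 2 * e \<le> dist p q"
proof -
  define D where "D = insert 1 ((\<lambda>(p, q). dist p q) ` (T \<times> T - Id))"
  have D: "finite D" "D \<noteq> {}" using assms by (auto simp: D_def)
  moreover have "0 < v" if "v \<in> D" for v using that by (auto simp: D_def)
  ultimately have pos: "0 < Min D" by simp
  show thesis
  proof
    show "0 < Min D / 2" using pos by simp
    fix p q assume "p \<in> T" "q \<in> T" "p \<noteq> q"
    then have "dist p q \<in> D" by (force simp: D_def)
    then show "2 * (Min D / 2) \<le> dist p q" using D by simp
  qed
qed

text \<open>A point of the image over which the number of preimages outside \<open>N\<close> is maximal would acquire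
  one more such preimage after a small perturbation, because \<open>N\<close> has no interior.\<close>

lemma image_nowhere_dense:
  assumes h: "finite_open_self_map X d h" and N: "closed N" "N \<subseteq> X" "nowhere_dense_in X N"
  shows "nowhere_dense_in X (h ` N)"
  unfolding nowhere_dense_in_iff_open
proof (intro allI impI, rule ccontr)
  fix V assume V: "open V \<and> V \<inter> X \<subseteq> h ` N" and ne: "V \<inter> X \<noteq> {}"
  define c where "c y = card ({x\<in>X. h x = y} - N)" for y
  obtain y0 where y0: "y0 \<in> V \<inter> X" using ne by blast
  have "\<forall>y. y \<in> V \<inter> X \<longrightarrow> c y \<le> d"
    unfolding c_def using finite_open_self_mapD(4,5)[OF h] by (meson Diff_subset IntD2 card_mono order_trans)
  then have "\<exists>y. y \<in> V \<inter> X \<and> (\<forall>z. z \<in> V \<inter> X \<longrightarrow> c z \<le> c y)"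
    using ex_has_greatest_nat[of "\<lambda>y. y \<in> V \<inter> X" y0 c "Suc d"] y0 by (simp add: less_Suc_eq_le)
  then obtain y where y: "y \<in> V" "y \<in> X" and max: "\<And>z. z \<in> V \<inter> X \<Longrightarrow> c z \<le> c y" by blast
  define S where "S = {x\<in>X. h x = y} - N"
  have S: "finite S" using finite_open_self_mapD(4)[OF h y(2)] by (simp add: S_def)
  obtain x0 where x0: "x0 \<in> N" "h x0 = y" using V y by blast
  then have "x0 \<in> X" using N(2) by blast
  have x0S: "x0 \<notin> S" using x0 by (simp add: S_def)
  obtain e where e: "0 < e" "\<And>p q. p \<in> insert x0 S \<Longrightarrow> q \<in> insert x0 S \<Longrightarrow> p \<noteq> q \<Longrightarrow> 2 * e \<le> dist p q"
    using finite_set_separated[of "insert x0 S"] S by blast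
  have disj: "ball p e \<inter> ball q e = {}" if "p \<in> insert x0 S" "q \<in> insert x0 S" "p \<noteq> q" for p q
    using e(2)[OF that] by (intro disjoint_ballI) simp
  \<comment> \<open>\<open>V'\<close> consists of the values in \<open>V\<close> that still have,
    near every point of \<open>S\<close>, a preimage outside \<open>N\<close>. The disjoint balls
    keep these preimages distinct from each other and from the new one found near
    \<open>x0\<close>.\<close>
  define V' where "V' = (X \<inter> V) \<inter> (\<Inter>p\<in>S. h ` (X \<inter> (ball p e - N)))"
  have "openin (top_of_set X) V'"
  proof (cases "S = {}")
    case True
    then show ?thesis using V by (simp add: V'_def openin_open_Int)
  next
    case False
    have "openin (top_of_set X) (\<Inter>p\<in>S. h ` (X \<inter> (ball p e - N)))"
      using S False N(1) by (intro openin_INT2 finite_open_self_mapD(3)[OF h] openin_open_Int open_Diff) auto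
    then show ?thesis unfolding V'_def using V by (intro openin_Int openin_open_Int) auto
  qed
  then obtain G where G: "open G" "V' = X \<inter> G" by (auto simp: openin_open)
  have yV': "y \<in> V'"
  proof -
    have "y \<in> h ` (X \<inter> (ball p e - N))" if "p \<in> S" for p
      using that e(1) by (intro image_eqI[of _ _ p]) (auto simp: S_def)
    then show ?thesis using y by (auto simp: V'_def)
  qed
  have "openin (top_of_set X) (X \<inter> h -` G)"
    using finite_open_self_mapD(1)[OF h] G(1) by (simp add: continuous_openin_preimage_gen)
  then obtain G' where G': "open G'" "X \<inter> h -` G = X \<inter> G'" by (auto simp: openin_open)
  have "x0 \<in> X \<inter> h -` G" using x0 \<open>x0 \<in> X\<close> yV' G(2) by auto
  then have "x0 \<in> (G' \<inter> ball x0 e) \<inter> X" using G'(2) e(1) by auto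
  moreover have "open (G' \<inter> ball x0 e)" using G' by auto
  ultimately have "\<not> (G' \<inter> ball x0 e) \<inter> X \<subseteq> N"
    using N(3) unfolding nowhere_dense_in_iff_open by blast
  then obtain x' where x': "x' \<in> G'" "x' \<in> ball x0 e" "x' \<in> X" "x' \<notin> N" by blast
  then have "x' \<in> X \<inter> h -` G" unfolding G'(2) by blast
  then have hx': "h x' \<in> V'" using G(2) finite_open_self_mapD(6)[OF h] x' by auto
  have "\<exists>q. \<forall>p\<in>S. q p \<in> X \<inter> (ball p e - N) \<and> h (q p) = h x'"
  proof (intro bchoice ballI)
    fix p assume "p \<in> S"
    then have "h x' \<in> h ` (X \<inter> (ball p e - N))" using hx' by (auto simp: V'_def)
    then obtain q where "q \<in> X \<inter> (ball p e - N)" "h x' = h q" by blast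
    then show "\<exists>q. q \<in> X \<inter> (ball p e - N) \<and> h q = h x'" by (intro exI[of _ q]) simp
  qed
  then obtain q where q: "\<And>p. p \<in> S \<Longrightarrow> q p \<in> X \<inter> (ball p e - N) \<and> h (q p) = h x'" by blast
  have "inj_on q S"
  proof (rule inj_onI)
    fix p p' assume p: "p \<in> S" "p' \<in> S" "q p = q p'"
    then have "q p \<in> ball p e \<inter> ball p' e" using q[OF p(1)] q[OF p(2)] by auto
    then show "p = p'" using disj[of p p'] p by blast
  qed
  moreover have "x' \<notin> q ` S"
  proof
    assume "x' \<in> q ` S"
    then obtain p where p: "p \<in> S" "x' = q p" by blast
    then have "x' \<in> ball p e \<inter> ball x0 e" using q[OF p(1)] x' by auto
    then show False using disj[of p x0] p x0S by blast
  qed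
  ultimately have "card (insert x' (q ` S)) = Suc (card S)"
    using S by (simp add: card_image)
  moreover have "insert x' (q ` S) \<subseteq> {x\<in>X. h x = h x'} - N"
    using q x' by auto
  moreover have hX: "h x' \<in> X" using finite_open_self_mapD(6)[OF h x'(3)] .
  then have "finite ({x\<in>X. h x = h x'} - N)" using finite_open_self_mapD(4)[OF h] by blast
  ultimately have "Suc (card S) \<le> c (h x')"
    unfolding c_def using card_mono[of "{x\<in>X. h x = h x'} - N" "insert x' (q ` S)"] by simp
  moreover have "c (h x') \<le> c y" using hx' by (intro max) (auto simp: V'_def)
  ultimately show False by (simp add: c_def S_def)
qed

text \<open>An open set inside the preimage would have an open image inside
  \<open>N\<close>.\<close>

lemma preimage_nowhere_dense:
  assumes h: "finite_open_self_map X d h" and N: "nowhere_dense_in X N"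
  shows "nowhere_dense_in X {x\<in>X. h x \<in> N}"
  unfolding nowhere_dense_in_iff_open
proof (intro allI impI)
  fix V assume V: "open V \<and> V \<inter> X \<subseteq> {x\<in>X. h x \<in> N}"
  then have "openin (top_of_set X) (h ` (X \<inter> V))"
    by (intro finite_open_self_mapD(3)[OF h] openin_open_Int) auto
  then obtain G where "open G" "h ` (X \<inter> V) = X \<inter> G" by (auto simp: openin_open)
  moreover have "h ` (X \<inter> V) \<subseteq> N" using V by auto
  ultimately have "G \<inter> X \<subseteq> N" by blast
  then have "G \<inter> X = {}" using N \<open>open G\<close> unfolding nowhere_dense_in_iff_open by blast
  then show "V \<inter> X = {}" using \<open>h ` (X \<inter> V) = X \<inter> G\<close> by auto
qed

text \<open>Open maps of compacta are confluent. If the component \<open>C\<close> missed the fibre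
  over \<open>y\<close>, a clopen part \<open>T\<close> of the preimage of \<open>K\<close> would
  contain \<open>C\<close> and still miss that fibre (Sura-Bura). The image of \<open>T\<close> is
  open in \<open>K\<close> because \<open>h\<close> is open, and compact, so it is all of the
  connected set \<open>K\<close>, including \<open>y\<close>.\<close>

lemma component_of_preimage_onto:
  fixes X :: "'a::euclidean_space set"
  assumes X: "compact X" and h: "finite_open_self_map X d h"
    and K: "continuum K" "K \<subseteq> X" and x: "x \<in> X" "h x \<in> K"
  shows "h ` connected_component_set {z\<in>X. h z \<in> K} x = K"
    and "continuum (connected_component_set {z\<in>X. h z \<in> K} x)"
proof -
  define Z where "Z = {z\<in>X. h z \<in> K}"
  define C where "C = connected_component_set Z x"
  have "Z = X \<inter> h -` K" by (auto simp: Z_def)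
  then have "closed Z"
    using continuous_closed_preimage[OF finite_open_self_mapD(1)[OF h] compact_imp_closed[OF X] continuumD(3)[OF K(1)]] by simp
  then have Z: "compact Z" using compact_Int_closed[OF X, of Z] by (simp add: Z_def Int_absorb1)
  have xZ: "x \<in> Z" using x by (simp add: Z_def)
  have CZ: "C \<subseteq> Z" unfolding C_def by (rule connected_component_subset)
  have comp: "C \<in> components Z" unfolding C_def using xZ by (rule componentsI)
  have xC: "x \<in> C" unfolding C_def using xZ by simp
  have C: "compact C" "connected C" using comp Z by (auto intro: compact_components in_components_connected)
  then show "continuum (connected_component_set {z\<in>X. h z \<in> K} x)"
    using xC unfolding C_def Z_def continuum_def by blast
  have "y \<in> h ` C" if y: "y \<in> K" for y
  proof (rule ccontr)
    assume ny: "y \<notin> h ` C"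
    define F where "F = {z\<in>X. h z = y}"
    have "finite F" unfolding F_def using finite_open_self_mapD(4)[OF h] y K(2) by blast
    then have "open (- F)" by (simp add: finite_imp_closed open_Compl)
    moreover have "C \<subseteq> - F" using ny by (auto simp: F_def)
    ultimately obtain T where T: "openin (top_of_set Z) T" "compact T" "C \<subseteq> T" "T \<subseteq> - F"
      using Sura_Bura_clopen_subset[OF closed_imp_locally_compact[OF \<open>closed Z\<close>] comp C(1), of "- F"] by blast
    obtain G where G: "open G" "T = Z \<inter> G" using T(1) by (auto simp: openin_open)
    have TX: "T \<subseteq> X" using G by (auto simp: Z_def)
    have "openin (top_of_set X) (h ` (X \<inter> G))"
      by (intro finite_open_self_mapD(3)[OF h] openin_open_Int G)
    then obtain G' where G': "open G'" "h ` (X \<inter> G) = X \<inter> G'" by (auto simp: openin_open)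
    have "h ` T = K \<inter> h ` (X \<inter> G)" unfolding G(2) Z_def by auto
    then have "h ` T = K \<inter> G'" using G'(2) K(2) by auto
    then have "openin (top_of_set K) (h ` T)" using G'(1) by (simp add: openin_open_Int)
    moreover have "compact (h ` T)"
      using compact_continuous_image[OF continuous_on_subset[OF finite_open_self_mapD(1)[OF h] TX] T(2)] .
    then have "closedin (top_of_set K) (h ` T)"
      using \<open>h ` T = K \<inter> G'\<close> by (simp add: closed_subset compact_imp_closed)
    moreover have "h ` T \<noteq> {}" using xC T(3) by blast
    ultimately have "h ` T = K" using continuumD(4)[OF K(1)] unfolding connected_clopen by metis
    then obtain z where z: "z \<in> T" "h z = y" using y by (metis imageE)
    then have "z \<in> F" using TX by (auto simp: F_def)
    then show False using z T(4) by auto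
  qed
  moreover have "h ` C \<subseteq> K" using CZ by (auto simp: Z_def)
  ultimately show "h ` connected_component_set {z\<in>X. h z \<in> K} x = K" unfolding C_def Z_def by blast
qed

context nowhere_dense_indecomposables
begin

lemma image_fibre_continuum:
  assumes irr: "irreducible_from X A B" and lm: "level_map X A B m" and h: "finite_open_self_map X d h"
    and t: "0 \<le> t" "t \<le> 1"
  shows "continuum (h ` {x\<in>X. m x = t})" "h ` {x\<in>X. m x = t} \<subseteq> X"
proof -
  let ?F = "{x\<in>X. m x = t}"
  have F: "continuum ?F" by (rule fibre_continuum[OF irr lm t])
  have cont: "continuous_on ?F h" by (rule continuous_on_subset[OF finite_open_self_mapD(1)[OF h]]) auto
  show "continuum (h ` ?F)"
    using compact_continuous_image[OF cont continuumD(2)[OF F]] connected_continuous_image[OF cont continuumD(4)[OF F]]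
      continuumD(1)[OF F] by (simp only: continuum_def image_is_empty) simp
  show "h ` ?F \<subseteq> X" using finite_open_self_mapD(6)[OF h] by blast
qed

text \<open>The union of \<open>N\<close> with the image of the fibre is a nowhere dense continuum.
  The component of its preimage that contains the fibre is again nowhere dense, so it lies in one
  fibre and equals it; by confluence it maps onto the whole union.\<close>

lemma image_fibre_maximal:
  assumes irr: "irreducible_from X A B" and lm: "level_map X A B m" and h: "finite_open_self_map X d h"
    and t: "0 \<le> t" "t \<le> 1" and thin: "nowhere_dense_in X {x\<in>X. m x = t}"
    and N: "continuum N" "N \<subseteq> X" "nowhere_dense_in X N" "N \<inter> h ` {x\<in>X. m x = t} \<noteq> {}"
  shows "N \<subseteq> h ` {x\<in>X. m x = t}"
proof -
  let ?F = "{x\<in>X. m x = t}"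
  have F: "continuum ?F" by (rule fibre_continuum[OF irr lm t])
  have hF: "continuum (h ` ?F)" "h ` ?F \<subseteq> X" by (rule image_fibre_continuum[OF irr lm h t])+
  have "nowhere_dense_in X (h ` ?F)"
    by (rule image_nowhere_dense[OF h continuumD(3)[OF F] _ thin]) auto
  then have M: "nowhere_dense_in X (N \<union> h ` ?F)"
    by (rule nowhere_dense_in_Un[OF N(3) _ continuumD(3)[OF N(1)]])
  have cM: "continuum (N \<union> h ` ?F)" "N \<union> h ` ?F \<subseteq> X"
    using continuum_Un[OF N(1) hF(1) N(4)] N(2) hF(2) by blast+
  obtain x where x: "x \<in> ?F" using continuumD(1)[OF F] by blast
  let ?Z = "{z\<in>X. h z \<in> N \<union> h ` ?F}"
  have x': "x \<in> X" "h x \<in> N \<union> h ` ?F" using x by blast+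
  define C where "C = connected_component_set ?Z x"
  have C: "h ` C = N \<union> h ` ?F" "continuum C"
    unfolding C_def by (rule component_of_preimage_onto[OF compact_X h cM x'])+
  have CZ: "C \<subseteq> ?Z" unfolding C_def by (rule connected_component_subset)
  have "?F \<subseteq> ?Z" by blast
  then have FC: "?F \<subseteq> C"
    unfolding C_def by (rule connected_component_maximal[OF x continuumD(4)[OF F]])
  have thinC: "nowhere_dense_in X C"
    by (rule nowhere_dense_in_subset[OF preimage_nowhere_dense[OF h M] CZ])
  have CX: "C \<subseteq> X" using CZ by blast
  have "C \<subseteq> ?F"
  proof
    fix z assume z: "z \<in> C"
    have "m z = m x"
      by (rule nowhere_dense_continuum_in_fibre[OF irr lm C(2) CX thinC z subsetD[OF FC x]])
    then show "z \<in> ?F" using x z CX by auto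
  qed
  then have "h ` C \<subseteq> h ` ?F" by (rule image_mono)
  then show ?thesis unfolding C(1) by simp
qed

end

section \<open>Reduction to irreducibility between two points\<close>

text \<open>Being connected and containing \<open>S\<close> passes to intersections of decreasing
  sequences of compact sets, so Brouwer's reduction theorem provides a minimal set.\<close>

lemma irreducible_subcontinuum_exists:
  fixes D0 :: "'a::euclidean_space set"
  assumes D0: "continuum D0" "S \<subseteq> D0" "S \<noteq> {}"
  obtains D where "continuum D" "S \<subseteq> D" "D \<subseteq> D0" "\<And>K. continuum K \<Longrightarrow> S \<subseteq> K \<Longrightarrow> K \<subseteq> D \<Longrightarrow> K = D"
proof -
  let ?\<phi> = "\<lambda>T. connected T \<and> S \<subseteq> T"
  obtain T where T: "T \<subseteq> D0" "compact T" "T \<noteq> {}" "?\<phi> T"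
    and min: "\<And>U. \<lbrakk>U \<subseteq> D0; closed U; U \<noteq> {}; ?\<phi> U\<rbrakk> \<Longrightarrow> \<not> (U \<subset> T)"
  proof (rule Brouwer_reduction_theorem[of D0 ?\<phi>])
    show "compact D0" "?\<phi> D0" "D0 \<noteq> {}" using D0 continuumD[OF D0(1)] by auto
    fix F :: "nat \<Rightarrow> 'a set"
    assume F: "\<And>n. compact (F n)" "\<And>n. F n \<noteq> {}" "\<And>n. ?\<phi> (F n)" "\<And>n. F (Suc n) \<subseteq> F n"
    have "F n \<subseteq> F k" if "k \<le> n" for k n
      using lift_Suc_antimono_le[of F] F(4) that by blast
    then have "connected (\<Inter>(range F))" using F by (intro connected_nest) auto
    then show "?\<phi> (\<Inter>(range F))" using F(3) by blast
  qed auto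
  show thesis
  proof (rule that)
    show "continuum T" "S \<subseteq> T" "T \<subseteq> D0" using T by (auto simp: continuum_def)
    show "K = T" if "continuum K" "S \<subseteq> K" "K \<subseteq> T" for K
      using min[of K] continuumD[OF that(1)] that T(1) by auto
  qed
qed

lemma singleton_continuum: "continuum {x}"
  by (simp add: continuum_def)

context nowhere_dense_indecomposables
begin

text \<open>A single point counts as indecomposable and has interior in itself.\<close>

lemma X_not_singleton: "X \<noteq> {x}"
proof
  assume eq: "X = {x}"
  have "indecomposable X"
    unfolding indecomposable_def using X eq continuumD(1) by (metis subset_singletonD psubset_eq)
  then have "nowhere_dense_in X X" using indecomposable_thin by blast
  then show False using eq by (simp add: nowhere_dense_in_def)
qed

lemma singleton_nowhere_dense: "nowhere_dense_in X {x}"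
  using connected_imp_singleton_nowhere_dense[OF connected_X] X_not_singleton by blast

end

text \<open>Everything that the topological argument uses about the dynamics. The covering is by the
  union of all forward images; no single iterate is claimed to be onto.\<close>

locale exhausting_map = nowhere_dense_indecomposables X for X :: "'a::euclidean_space set" +
  fixes f :: "'a \<Rightarrow> 'a" and d :: nat
  assumes f: "finite_open_self_map X d f"
    and exhausting: "openin (top_of_set X) U \<Longrightarrow> U \<noteq> {} \<Longrightarrow> X \<subseteq> (\<Union>n. (f ^^ n) ` U)"
begin

text \<open>For \<open>S\<close> that cannot be replaced by a smaller set, one point
  \<open>a\<close> is split off and \<open>D\<close> is chosen irreducible about the others. The
  closure \<open>E\<close> of the part \<open>Q\<close> below level 1 meets \<open>D\<close> in some
  \<open>y\<close>, and the image \<open>N\<close> of a thin interior fibre \<open>F\<close> passes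
  through \<open>y\<close>. Each of the two open slabs beside \<open>F\<close> is mapped into
  \<open>Q\<close> or into \<open>Q2\<close>, the rest of the last fibre. All combinations fail:
  with both in \<open>Q2\<close> the closure of \<open>Q\<close> could not reach \<open>y\<close>;
  with both in \<open>Q\<close> the set \<open>S'\<close> would be cut off from \<open>a\<close>;
  with one in each, a continuum in \<open>D\<close> that misses \<open>N\<close> would contain
  \<open>S'\<close>.\<close>

lemma not_irreducible_about_many:
  assumes fin: "finite S" and card: "3 \<le> card S" and irr_S: "irreducible_about X S"
  shows "\<exists>T. finite T \<and> card T < card S \<and> irreducible_about X T"
proof (rule ccontr)
  assume no: "\<not> ?thesis"
  have SX: "S \<subseteq> X" and S_irr: "\<And>K. continuum K \<Longrightarrow> K \<subseteq> X \<Longrightarrow> S \<subseteq> K \<Longrightarrow> K = X"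
    using irr_S unfolding irreducible_about_def by blast+
  have min: "\<exists>K. continuum K \<and> K \<subset> X \<and> S - {s} \<subseteq> K" if "s \<in> S" for s
  proof -
    have "card (S - {s}) < card S" using that fin by (meson card_Diff1_less)
    then have "\<not> irreducible_about X (S - {s})" using no fin by blast
    then show ?thesis using SX unfolding irreducible_about_def by blast
  qed
  obtain a where a: "a \<in> S" using card by fastforce
  define S' where "S' = S - {a}"
  have S'card: "2 \<le> card S'" using card a fin by (simp add: S'_def)
  then have S'ne: "S' \<noteq> {}" by auto
  obtain D0 where D0: "continuum D0" "D0 \<subset> X" "S' \<subseteq> D0" using min[OF a] unfolding S'_def by blast
  obtain D where D: "continuum D" "S' \<subseteq> D" "D \<subseteq> D0"
    and D_min: "\<And>K. continuum K \<Longrightarrow> S' \<subseteq> K \<Longrightarrow> K \<subseteq> D \<Longrightarrow> K = D"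
    using irreducible_subcontinuum_exists[OF D0(1,3) S'ne] by blast
  have DX: "D \<subseteq> X" and aX: "a \<in> X" using D D0 a SX by blast+
  \<comment> \<open>A continuum from \<open>a\<close> to \<open>D\<close> together with
    \<open>D\<close> contains all of \<open>S\<close>.\<close>
  have cover: "K \<union> D = X" if "continuum K" "K \<subseteq> X" "a \<in> K" "K \<inter> D \<noteq> {}" for K
  proof (rule S_irr)
    show "continuum (K \<union> D)" by (rule continuum_Un[OF that(1) D(1) that(4)])
    show "K \<union> D \<subseteq> X" using that DX by blast
    show "S \<subseteq> K \<union> D" using D(2) that(3) unfolding S'_def by blast
  qed
  have aD: "a \<notin> D" using cover[OF singleton_continuum, of a] aX D(3) D0(2) by blast
  have irr: "irreducible_from X {a} D"
    unfolding irreducible_from_def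
  proof (intro conjI allI impI)
    fix K assume K: "continuum K \<and> K \<subseteq> X \<and> K \<inter> {a} \<noteq> {} \<and> K \<inter> D \<noteq> {}"
    then have "K \<union> D = X" by (intro cover) blast+
    then show "X \<subseteq> {a} \<union> K \<union> D" by blast
  qed (use D DX aX aD singleton_continuum in auto)
  obtain m where lm: "level_map X {a} D m"
    and fine: "\<And>V. open V \<Longrightarrow> V \<inter> (X - {a} - D) \<noteq> {} \<Longrightarrow> \<exists>v\<in>V \<inter> X. \<exists>w\<in>V \<inter> X. m v \<noteq> m w"
    using fine_level_map_exists[OF irr] by blast
  have m_img: "m ` X = {0..1}" by (rule level_map_image[OF irr lm])
  have mcont: "continuous_on X m" by (rule level_map_continuous[OF lm])
  have ma: "m a = 0" by (rule level_mapD(1)[OF lm]) simp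
  have mD: "m z = 1" if "z \<in> D" for z by (rule level_mapD(2)[OF lm that])
  have m1: "m z \<le> 1" if "z \<in> X" for z by (rule level_mapD(4)[OF lm that])
  have fthin: "nowhere_dense_in X {x\<in>X. m x = t}" if "t < 1" for t
    by (rule fine_fibre_nowhere_dense[OF lm fine singleton_nowhere_dense]) (use that in auto)
  define Q where "Q = {x\<in>X. m x < 1}"
  define F1 where "F1 = {x\<in>X. m x = 1}"
  define E where "E = closure Q"
  define L where "L = E \<inter> F1"
  have Q_open: "openin (top_of_set X) Q"
  proof -
    have "Q = X \<inter> m -` {..<1}" by (auto simp: Q_def)
    then show ?thesis using continuous_openin_preimage_gen[OF mcont open_lessThan[of 1]] by simp
  qed
  then obtain GQ where GQ: "open GQ" "Q = X \<inter> GQ" by (auto simp: openin_open)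
  have QX: "Q \<subseteq> X" and QF1: "X = Q \<union> F1" "Q \<inter> F1 = {}" using m1 by (auto simp: Q_def F1_def less_le)
  have EX: "E \<subseteq> X" unfolding E_def by (rule closure_minimal[OF QX closed_X])
  have QE: "Q \<subseteq> E" unfolding E_def by (rule closure_subset)
  have E_closed: "closed E" by (simp add: E_def)
  have aQ: "a \<in> Q" using ma aX by (simp add: Q_def)
  have F1: "continuum F1" unfolding F1_def by (rule fibre_continuum[OF irr lm]) auto
  have DF1: "D \<subseteq> F1" using mD DX by (auto simp: F1_def)
  \<comment> \<open>A point outside \<open>E \<union> D\<close> would have a neighbourhood on which
    \<open>m\<close> is constantly 1, against fineness.\<close>
  have ED: "E \<union> D = X"
  proof -
    have "X \<subseteq> E \<union> D"
    proof (rule ccontr)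
      assume "\<not> X \<subseteq> E \<union> D"
      then have "- (E \<union> D) \<inter> (X - {a} - D) \<noteq> {}" using aQ QE by blast
      moreover have "open (- (E \<union> D))" using E_closed continuumD(3)[OF D(1)] by (intro open_Compl closed_Un)
      ultimately obtain v w where vw: "v \<in> - (E \<union> D) \<inter> X" "w \<in> - (E \<union> D) \<inter> X" "m v \<noteq> m w"
        using fine[of "- (E \<union> D)"] by blast
      then have "v \<in> F1" "w \<in> F1" using QE QF1 by blast+
      then show False using vw(3) by (simp add: F1_def)
    qed
    then show ?thesis using EX DX by blast
  qed
  have ED_meet: "E \<inter> D \<noteq> {}"
  proof
    assume "E \<inter> D = {}"
    then show False
      using connected_X ED E_closed continuumD(1,3)[OF D(1)] aQ QE
      unfolding connected_closed_set[OF closed_X] by blast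
  qed
  \<comment> \<open>The limit of \<open>Q\<close> in the last fibre is a nested intersection of
    closures of the slabs between \<open>1 - e\<close> and 1, by the same argument as for interior
    fibres.\<close>
  have Lcont: "continuum L"
  proof -
    let ?R = "{e::real. 0 < e \<and> e < 1}" and ?S = "\<lambda>e. {x\<in>X. 1 - e < m x \<and> m x < 1}"
    have Leq: "L = (\<Inter>e\<in>?R. closure (?S e))"
    proof (intro equalityI subsetI INT_I)
      fix x e assume x: "x \<in> L" and e: "e \<in> ?R"
      have "Q \<subseteq> {x\<in>X. m x \<le> 1 - e} \<union> ?S e" by (auto simp: Q_def)
      then have "E \<subseteq> closure ({x\<in>X. m x \<le> 1 - e} \<union> ?S e)" unfolding E_def by (rule closure_mono)
      then have "x \<in> {x\<in>X. m x \<le> 1 - e} \<union> closure (?S e)"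
        using x level_mapD(5)[OF lm, of "1 - e"] by (auto simp: L_def)
      then show "x \<in> closure (?S e)" using x e by (auto simp: L_def F1_def)
    next
      fix x assume x: "x \<in> (\<Inter>e\<in>?R. closure (?S e))"
      have sub: "closure (?S e) \<subseteq> {x\<in>X. 1 - e \<le> m x}" for e
        by (rule closure_minimal[OF _ level_mapD(7)[OF lm]]) auto
      have half: "(1/2::real) \<in> ?R" by simp
      have "x \<in> closure (?S (1/2))" using x half by blast
      moreover have "closure (?S (1/2)) \<subseteq> E" unfolding E_def by (rule closure_mono) (auto simp: Q_def)
      ultimately have xE: "x \<in> E" by blast
      then have xX: "x \<in> X" using EX by blast
      have "m x = 1"
      proof (rule ccontr)
        assume "m x \<noteq> 1"
        define e where "e = min (1/2) ((1 - m x) / 2)"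
        have "m x < 1" using \<open>m x \<noteq> 1\<close> m1[OF xX] by simp
        then have "e \<in> ?R" by (auto simp: e_def)
        then have "x \<in> closure (?S e)" using x by blast
        then have "1 - e \<le> m x" using sub[of e] by blast
        moreover have "e \<le> (1 - m x) / 2" unfolding e_def by (rule min.cobounded2)
        ultimately show False using \<open>m x < 1\<close> by (simp add: field_simps)
      qed
      then show "x \<in> L" using xE xX by (simp add: L_def F1_def)
    qed
    have "connected L"
      unfolding Leq
    proof (rule connected_chain)
      fix C assume "C \<in> (\<lambda>e. closure (?S e)) ` ?R"
      then obtain e where e: "e \<in> ?R" "C = closure (?S e)" by blast
      have "closure (?S e) \<subseteq> X" by (rule closure_minimal[OF _ closed_X]) auto
      then have "compact C" using compact_Int_closed[OF compact_X closed_closure, of "?S e"] e(2) by (simp add: Int_absorb1)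
      moreover have "connected (?S e)" using e by (intro connected_open_slab[OF irr lm]) auto
      ultimately show "compact C \<and> connected C" using e(2) connected_imp_connected_closure by blast
    next
      fix C C' assume "C \<in> (\<lambda>e. closure (?S e)) ` ?R \<and> C' \<in> (\<lambda>e. closure (?S e)) ` ?R"
      then obtain e e' where e: "C = closure (?S e)" "C' = closure (?S e')" by blast
      have "?S e \<subseteq> ?S e' \<or> ?S e' \<subseteq> ?S e" by (cases "e \<le> e'") force+
      then show "C \<subseteq> C' \<or> C' \<subseteq> C" unfolding e by (meson closure_mono)
    qed
    moreover have "closed L" unfolding L_def using E_closed continuumD(3)[OF F1] by (rule closed_Int)
    moreover have "L \<noteq> {}" using ED_meet unfolding L_def using DF1 by blast
    moreover have "L \<subseteq> X" unfolding L_def using EX by blast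
    ultimately show ?thesis by (intro continuum_closed_subset[OF X])
  qed
  from ED_meet obtain y where y: "y \<in> E" "y \<in> D" by blast
  have yL: "y \<in> L" using y DF1 by (auto simp: L_def)
  have LX: "L \<subseteq> X" unfolding L_def using EX by blast
  have yX: "y \<in> X" using yL LX by blast
  have Lthin: "nowhere_dense_in X L"
    unfolding nowhere_dense_in_iff_open
  proof (intro allI impI, rule ccontr)
    fix V assume V: "open V \<and> V \<inter> X \<subseteq> L" and "V \<inter> X \<noteq> {}"
    then obtain z where "z \<in> V" "z \<in> L" by blast
    then have "V \<inter> closure Q \<noteq> {}" by (auto simp: L_def E_def)
    then have "V \<inter> Q \<noteq> {}" using V open_Int_closure_eq_empty[of V Q] by blast
    then show False using V QX QF1(2) unfolding L_def by blast
  qed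
  have "{x\<in>X. 0 < m x \<and> m x < 1} = X \<inter> m -` {0<..<1}" by auto
  then have "openin (top_of_set X) {x\<in>X. 0 < m x \<and> m x < 1}"
    using continuous_openin_preimage_gen[OF mcont open_greaterThanLessThan[of 0 1]] by simp
  moreover have "{x\<in>X. 0 < m x \<and> m x < 1} \<noteq> {}"
  proof -
    have "1/2 \<in> m ` X" unfolding m_img by simp
    then show ?thesis by (force simp: image_iff)
  qed
  ultimately obtain k x where x: "x \<in> X" "0 < m x" "m x < 1" "y = (f ^^ k) x"
    using exhausting[of "{x\<in>X. 0 < m x \<and> m x < 1}"] yX by blast
  define t where "t = m x"
  define h where "h = f ^^ k"
  have t: "0 < t" "t < 1" using x by (simp_all add: t_def)
  have h: "finite_open_self_map X (d ^ k) h" unfolding h_def by (rule finite_open_self_map_funpow[OF f])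
  define F where "F = {x\<in>X. m x = t}"
  define N where "N = h ` F"
  have Fthin: "nowhere_dense_in X F" unfolding F_def by (rule fthin[OF t(2)])
  have F: "continuum F" unfolding F_def by (rule fibre_continuum[OF irr lm]) (use t in auto)
  have N: "continuum N" "N \<subseteq> X"
    unfolding N_def F_def by (rule image_fibre_continuum[OF irr lm h]; use t in simp)+
  have Nthin: "nowhere_dense_in X N"
    unfolding N_def by (rule image_nowhere_dense[OF h continuumD(3)[OF F] _ Fthin]) (simp add: F_def)
  have yN: "y \<in> N" using x unfolding N_def F_def h_def t_def by blast
  \<comment> \<open>\<open>L\<close> is a nowhere dense continuum through \<open>y\<close>, so
    maximality of \<open>N\<close> swallows it. Consequently \<open>N\<close> separates
    \<open>Q\<close> from \<open>Q2\<close>: the set \<open>Q2\<close> is the complement of the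
    closed set \<open>E \<union> N\<close>, hence open in \<open>X\<close>.\<close>
  have LN: "L \<subseteq> N"
  proof -
    have "L \<inter> h ` {x\<in>X. m x = t} \<noteq> {}" using yL yN unfolding N_def F_def by blast
    then show ?thesis
      using image_fibre_maximal[OF irr lm h _ _ _ Lcont LX Lthin, of t] t Fthin unfolding N_def F_def by simp
  qed
  have NF1: "N \<subseteq> F1"
  proof
    fix z assume z: "z \<in> N"
    have "m z = m y" by (rule nowhere_dense_continuum_in_fibre[OF irr lm N Nthin z yN])
    then show "z \<in> F1" using yL z N(2) by (auto simp: L_def F1_def)
  qed
  \<comment> \<open>If \<open>b\<close> were in \<open>N\<close>, a proper subcontinuum
    \<open>K\<close> containing the other points of \<open>S\<close> would still join
    \<open>a\<close> to \<open>D\<close>, because \<open>S'\<close> has a second point. So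
    \<open>K\<close> contains \<open>E\<close> and meets \<open>N\<close>, and
    \<open>K \<union> N\<close> contains \<open>S\<close> and is all of \<open>X\<close>; then
    \<open>N\<close> contains the non-empty open set \<open>X - K\<close>.\<close>
  have S'N: "S' \<inter> N = {}"
  proof (rule ccontr)
    assume "S' \<inter> N \<noteq> {}"
    then obtain b where b: "b \<in> S'" "b \<in> N" by blast
    have "b \<in> S" using b unfolding S'_def by blast
    then obtain K where K: "continuum K" "K \<subset> X" "S - {b} \<subseteq> K" using min by blast
    have "S' \<noteq> {b}" using S'card by auto
    then obtain c where c: "c \<in> S'" "c \<noteq> b" using b by blast
    have "c \<in> K" "c \<in> D" "a \<in> K" using c K(3) D(2) a b unfolding S'_def by blast+
    then have "K \<union> D = X" using K by (intro cover) blast+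
    then have "Q \<subseteq> K" using QX QF1(2) DF1 by blast
    then have "E \<subseteq> K" unfolding E_def by (rule closure_minimal[OF _ continuumD(3)[OF K(1)]])
    then have "K \<inter> N \<noteq> {}" using yN y by blast
    then have "continuum (K \<union> N)" by (rule continuum_Un[OF K(1) N(1)])
    moreover have "S \<subseteq> K \<union> N" "K \<union> N \<subseteq> X" using K b N by blast+
    ultimately have "K \<union> N = X" by (intro S_irr)
    then have "- K \<inter> X \<subseteq> N" by blast
    moreover have "open (- K)" using continuumD(3)[OF K(1)] by (rule open_Compl)
    ultimately have "- K \<inter> X = {}" using Nthin unfolding nowhere_dense_in_iff_open by blast
    then show False using K(2) by blast
  qed
  \<comment> \<open>The levels of the finitely many preimages of \<open>y\<close> and of
    \<open>S'\<close>. The width \<open>e\<close> is chosen so that such preimages within distance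
    \<open>e\<close> of level \<open>t\<close> lie on level \<open>t\<close> exactly.\<close>
  define vals where "vals = m ` (\<Union>z\<in>insert y S'. {x\<in>X. h x = z})"
  have "finite vals"
    unfolding vals_def
  proof (intro finite_imageI finite_UN_I)
    show "finite (insert y S')" using fin by (simp add: S'_def)
    show "finite {x\<in>X. h x = z}" if "z \<in> insert y S'" for z
      using finite_open_self_mapD(4)[OF h] that yX SX unfolding S'_def by blast
  qed
  then obtain e0 where e0: "0 < e0" "\<And>v. v \<in> vals \<Longrightarrow> v \<noteq> t \<Longrightarrow> e0 \<le> dist t v"
    using finite_set_avoid[of vals t] by blast
  define e where "e = min (e0 / 2) (min t (1 - t))"
  have e: "0 < e" "e \<le> t" "e \<le> 1 - t" "e < e0" using e0(1) t by (auto simp: e_def min_def)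
  have val_t: "m z = t" if "z \<in> X" "\<bar>m z - t\<bar> \<le> e" "h z \<in> insert y S'" for z
  proof (rule ccontr)
    assume "m z \<noteq> t"
    moreover have "m z \<in> vals" using that unfolding vals_def by blast
    ultimately have "e0 \<le> dist t (m z)" by (intro e0)
    then show False using that(2) e(4) by (simp add: dist_real_def abs_minus_commute)
  qed
  \<comment> \<open>The component of the preimage of \<open>N\<close> through \<open>z\<close> lies
    in one fibre and, being mapped onto \<open>N\<close>, contains a preimage of \<open>y\<close>.
    So the level of \<open>z\<close> is one of the finitely many values avoided by
    \<open>e\<close>.\<close>
  have preN: "m z = t" if z: "z \<in> X" "\<bar>m z - t\<bar> \<le> e" "h z \<in> N" for z
  proof -
    define C where "C = connected_component_set {u\<in>X. h u \<in> N} z"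
    have C: "h ` C = N" "continuum C"
      unfolding C_def by (rule component_of_preimage_onto[OF compact_X h N z(1,3)])+
    have CZ: "C \<subseteq> {u\<in>X. h u \<in> N}" unfolding C_def by (rule connected_component_subset)
    have CX: "C \<subseteq> X" using CZ by blast
    have thinC: "nowhere_dense_in X C"
      by (rule nowhere_dense_in_subset[OF preimage_nowhere_dense[OF h Nthin] CZ])
    have zC: "z \<in> C" unfolding C_def using z by simp
    obtain u where u: "u \<in> C" "h u = y" using C(1) yN by blast
    have eq: "m z = m u" by (rule nowhere_dense_continuum_in_fibre[OF irr lm C(2) CX thinC zC u(1)])
    then show ?thesis using val_t[of u] u CX z(2) by auto
  qed
  \<comment> \<open>\<open>W\<close> uses half the width, so that its boundary lies in the images
    \<open>B \<sigma>\<close> of the fibres at distance \<open>e / 2\<close>, which are continua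
    inside the images of the open slabs \<open>T \<sigma>\<close>.\<close>
  define W where "W = h ` {z\<in>X. \<bar>m z - t\<bar> < e / 2}"
  define T where "T = (\<lambda>\<sigma>. if \<sigma> then {z\<in>X. t < m z \<and> m z < t + e} else {z\<in>X. t - e < m z \<and> m z < t})"
  define B where "B = (\<lambda>\<sigma>. h ` {z\<in>X. m z = (if \<sigma> then t + e / 2 else t - e / 2)})"
  have W_open: "openin (top_of_set X) W"
  proof -
    have "{z\<in>X. \<bar>m z - t\<bar> < e / 2} = X \<inter> m -` ball t (e / 2)" by (auto simp: dist_real_def abs_minus_commute)
    then have "openin (top_of_set X) {z\<in>X. \<bar>m z - t\<bar> < e / 2}"
      using continuous_openin_preimage_gen[OF mcont open_ball] by simp
    then show ?thesis unfolding W_def by (rule finite_open_self_mapD(3)[OF h])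
  qed
  then obtain GW where GW: "open GW" "W = X \<inter> GW" by (auto simp: openin_open)
  have NW: "N \<subseteq> W" using e unfolding N_def W_def F_def by auto
  have WX: "W \<subseteq> X" using GW by blast
  have clW: "closure W \<subseteq> W \<union> B True \<union> B False"
  proof -
    have "{z\<in>X. \<bar>m z - t\<bar> \<le> e / 2} = X \<inter> m -` cball t (e / 2)" by (auto simp: dist_real_def abs_minus_commute)
    then have "closed {z\<in>X. \<bar>m z - t\<bar> \<le> e / 2}"
      using continuous_closed_preimage[OF mcont closed_X closed_cball] by simp
    then have "compact {z\<in>X. \<bar>m z - t\<bar> \<le> e / 2}"
      using compact_Int_closed[OF compact_X, of "{z\<in>X. \<bar>m z - t\<bar> \<le> e / 2}"] by (simp add: Int_absorb1)
    moreover have "continuous_on {z\<in>X. \<bar>m z - t\<bar> \<le> e / 2} h"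
      by (rule continuous_on_subset[OF finite_open_self_mapD(1)[OF h]]) auto
    ultimately have "closed (h ` {z\<in>X. \<bar>m z - t\<bar> \<le> e / 2})"
      using compact_continuous_image compact_imp_closed by blast
    moreover have "W \<subseteq> h ` {z\<in>X. \<bar>m z - t\<bar> \<le> e / 2}" unfolding W_def by (rule image_mono) auto
    ultimately have "closure W \<subseteq> h ` {z\<in>X. \<bar>m z - t\<bar> \<le> e / 2}" by (intro closure_minimal)
    also have "{z\<in>X. \<bar>m z - t\<bar> \<le> e / 2} \<subseteq> {z\<in>X. \<bar>m z - t\<bar> < e / 2} \<union> {z\<in>X. m z = t + e / 2} \<union> {z\<in>X. m z = t - e / 2}"
      by (auto simp: abs_real_def field_simps split: if_splits)
    then have "h ` {z\<in>X. \<bar>m z - t\<bar> \<le> e / 2} \<subseteq> W \<union> B True \<union> B False"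
      unfolding W_def B_def by (auto 0 3)
    finally show ?thesis .
  qed
  have WN: "W - N \<subseteq> h ` T True \<union> h ` T False"
  proof
    fix z assume z: "z \<in> W - N"
    then obtain u where u: "u \<in> X" "\<bar>m u - t\<bar> < e / 2" "z = h u" unfolding W_def by blast
    then have "m u \<noteq> t" using z unfolding N_def F_def by blast
    then have "u \<in> T True \<union> T False" using u e(1) unfolding T_def by auto
    then show "z \<in> h ` T True \<union> h ` T False" using u by blast
  qed
  have BT: "B \<sigma> \<subseteq> h ` T \<sigma>" for \<sigma>
    unfolding B_def T_def using e(1) by (cases \<sigma>) auto
  have B: "continuum (B \<sigma>)" for \<sigma>
    unfolding B_def by (rule image_fibre_continuum[OF irr lm h]) (use e t in \<open>auto split: if_splits\<close>)
  define Q2 where "Q2 = F1 - N"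
  have Q2_eq: "Q2 = X \<inter> - (E \<union> N)"
    using QF1 QE LN unfolding Q2_def L_def by blast
  have XN: "X - N = Q \<union> Q2" "Q \<inter> Q2 = {}" using QF1 NF1 unfolding Q2_def by blast+
  have open2: "open (- (E \<union> N))" using E_closed continuumD(3)[OF N(1)] by (intro open_Compl closed_Un)
  \<comment> \<open>The image of a slab is connected, misses \<open>N\<close>, and is covered by the
    disjoint relatively open sets \<open>Q\<close> and \<open>Q2\<close>.\<close>
  have side: "h ` T \<sigma> \<subseteq> Q \<or> h ` T \<sigma> \<subseteq> Q2" for \<sigma>
  proof (rule ccontr)
    assume neither: "\<not> ?thesis"
    have "T \<sigma> \<subseteq> X" by (auto simp: T_def)
    have "connected (T \<sigma>)" unfolding T_def using e t by (auto intro!: connected_open_slab[OF irr lm])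
    then have conn: "connected (h ` T \<sigma>)"
      using connected_continuous_image continuous_on_subset[OF finite_open_self_mapD(1)[OF h] \<open>T \<sigma> \<subseteq> X\<close>] by blast
    have sub: "h ` T \<sigma> \<subseteq> X" using finite_open_self_mapD(6)[OF h] \<open>T \<sigma> \<subseteq> X\<close> by blast
    have "h ` T \<sigma> \<inter> N = {}"
    proof (rule ccontr)
      assume "h ` T \<sigma> \<inter> N \<noteq> {}"
      then obtain z where z: "z \<in> T \<sigma>" "h z \<in> N" by blast
      then have "\<bar>m z - t\<bar> \<le> e" "m z \<noteq> t" by (auto simp: T_def split: if_splits)
      then show False using preN[of z] z \<open>T \<sigma> \<subseteq> X\<close> by blast
    qed
    then have sub2: "h ` T \<sigma> \<subseteq> Q \<union> Q2" using sub XN by blast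
    have "\<not> connected (h ` T \<sigma>)"
      unfolding connected_def not_not
    proof (intro exI conjI)
      show "h ` T \<sigma> \<subseteq> GQ \<union> - (E \<union> N)" using sub2 GQ Q2_eq by blast
      show "GQ \<inter> - (E \<union> N) \<inter> h ` T \<sigma> = {}" using sub GQ(2) QE by blast
      show "GQ \<inter> h ` T \<sigma> \<noteq> {}" using neither sub2 GQ(2) by blast
      show "- (E \<union> N) \<inter> h ` T \<sigma> \<noteq> {}" using neither sub2 Q2_eq by blast
    qed (use GQ open2 in auto)
    then show False using conn by blast
  qed
  define Z where "Z = F1 - W"
  have "Z = F1 \<inter> - GW" using QF1 GW(2) unfolding Z_def by blast
  then have Z_closed: "closed Z" using continuumD(3)[OF F1] GW(1) by auto
  have XZ: "X - Z = Q \<union> W" using QF1 WX unfolding Z_def by blast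
  have clXZ: "closure (X - Z) \<inter> Z \<subseteq> B True \<union> B False"
  proof -
    have "E \<inter> Z = {}" using LN NW unfolding L_def Z_def by blast
    moreover have "closure (X - Z) = E \<union> closure W" unfolding XZ E_def by (rule closure_Un)
    ultimately show ?thesis using clW unfolding Z_def by blast
  qed
  have S'Z: "S' \<subseteq> Z"
  proof
    fix b assume b: "b \<in> S'"
    have "b \<notin> W"
    proof
      assume "b \<in> W"
      then obtain u where u: "u \<in> X" "\<bar>m u - t\<bar> < e / 2" "b = h u" unfolding W_def by blast
      then have "m u = t" using val_t[of u] b e(1) by auto
      then have "b \<in> N" using u unfolding N_def F_def by blast
      then show False using S'N b by blast
    qed
    then show "b \<in> Z" using b D(2) DF1 unfolding Z_def by blast
  qed
  have not_split: False if "closed C" "closed C'" "C \<union> C' = X" "C \<inter> C' = {}" "C \<noteq> {}" "C' \<noteq> {}" for C C'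
    using connected_X that unfolding connected_closed_set[OF closed_X] by blast
  \<comment> \<open>\<open>Z\<close> touches the closure of its complement only inside
    \<open>B \<sigma>\<close>. If \<open>Z \<union> B \<sigma>\<close> fell apart, the piece away
    from \<open>B \<sigma>\<close> would be clopen in \<open>X\<close>. So it is a continuum in
    \<open>D\<close> containing \<open>S'\<close>, hence equal to \<open>D\<close>, although it
    misses \<open>y\<close>.\<close>
  have mixed: False if \<sigma>: "h ` T \<sigma> \<subseteq> Q2" "h ` T (\<not> \<sigma>) \<subseteq> Q" for \<sigma>
  proof -
    have "B True \<union> B False = B \<sigma> \<union> B (\<not> \<sigma>)" by (cases \<sigma>) auto
    moreover have "B (\<not> \<sigma>) \<inter> Z = {}" using BT[of "\<not> \<sigma>"] \<sigma>(2) QF1(2) unfolding Z_def by blast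
    ultimately have cl: "closure (X - Z) \<inter> Z \<subseteq> B \<sigma>" using clXZ by blast
    define K where "K = Z \<union> B \<sigma>"
    have KQ2: "K \<subseteq> Q2" using BT[of \<sigma>] \<sigma>(1) NW unfolding K_def Z_def Q2_def by blast
    have K_closed: "closed K" unfolding K_def using Z_closed continuumD(3)[OF B] by (rule closed_Un)
    have "connected K"
    proof (rule ccontr)
      assume "\<not> connected K"
      then obtain C C' where C: "closed C" "closed C'" "C \<noteq> {}" "C' \<noteq> {}" "C \<union> C' = K" "C \<inter> C' = {}"
        unfolding connected_closed_set[OF K_closed] by blast
      have "B \<sigma> \<subseteq> C \<or> B \<sigma> \<subseteq> C'"
      proof (rule ccontr)
        assume "\<not> ?thesis"
        then have "C \<inter> B \<sigma> \<noteq> {}" "C' \<inter> B \<sigma> \<noteq> {}" "B \<sigma> \<subseteq> C \<union> C'" using C(5) unfolding K_def by blast+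
        then show False
          using continuumD(4)[OF B[of \<sigma>]] C connected_closedD[of "B \<sigma>" C C'] by blast
      qed
      then obtain P P' where P: "closed P" "closed P'" "P \<noteq> {}" "P' \<noteq> {}" "P \<union> P' = K" "P \<inter> P' = {}" "B \<sigma> \<subseteq> P"
        using C by (metis Int_commute Un_commute)
      have P'Z: "P' \<subseteq> Z" "P' \<inter> B \<sigma> = {}" using P unfolding K_def by blast+
      have "closed (closure (X - Z) \<union> P)" using P by auto
      moreover have "(closure (X - Z) \<union> P) \<union> P' = X"
      proof
        have "closure (X - Z) \<subseteq> X" by (rule closure_minimal[OF _ closed_X]) auto
        moreover have "K \<subseteq> X" using KQ2 XN by blast
        ultimately show "(closure (X - Z) \<union> P) \<union> P' \<subseteq> X" using P(5) by blast
        show "X \<subseteq> (closure (X - Z) \<union> P) \<union> P'"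
          using P(5) closure_subset[of "X - Z"] unfolding K_def by blast
      qed
      moreover have "(closure (X - Z) \<union> P) \<inter> P' = {}" using P'Z P cl by blast
      ultimately show False using not_split[of "closure (X - Z) \<union> P" P'] P by blast
    qed
    moreover have "K \<subseteq> D"
    proof -
      have "Q2 \<subseteq> D" using Q2_eq ED by blast
      then show ?thesis using KQ2 by blast
    qed
    moreover have "S' \<subseteq> K" using S'Z unfolding K_def by blast
    moreover have "continuum K"
      using continuum_closed_subset[OF D(1) K_closed] calculation S'ne by blast
    ultimately have "K = D" by (intro D_min)
    then have "y \<in> Q2" using y KQ2 by blast
    then show False using yN unfolding Q2_def by blast
  qed
  \<comment> \<open>Neither boundary piece meets \<open>Z\<close>, which makes \<open>Z\<close>
    clopen; it contains \<open>S'\<close> but not \<open>a\<close>.\<close>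
  have both_Q: False if "h ` T True \<subseteq> Q" "h ` T False \<subseteq> Q"
  proof -
    have "closure (X - Z) \<inter> Z = {}"
      using clXZ BT[of True] BT[of False] that QF1(2) unfolding Z_def by blast
    moreover have "closure (X - Z) \<union> Z = X"
    proof -
      have "closure (X - Z) \<subseteq> X" by (rule closure_minimal[OF _ closed_X]) auto
      moreover have "Z \<subseteq> X" using QF1 unfolding Z_def by blast
      ultimately show ?thesis using closure_subset[of "X - Z"] by blast
    qed
    moreover have "a \<in> closure (X - Z)" using aQ XZ closure_subset[of "X - Z"] by blast
    ultimately show False using not_split[of "closure (X - Z)" Z] Z_closed S'Z S'ne by auto
  qed
  \<comment> \<open>The relatively open set \<open>W\<close> around \<open>y\<close> would miss
    \<open>Q\<close>, although \<open>y\<close> lies in the closure of \<open>Q\<close>.\<close>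
  have both_Q2: False if "h ` T True \<subseteq> Q2" "h ` T False \<subseteq> Q2"
  proof -
    have "W \<inter> Q = {}" using WN that XN NF1 QF1 by blast
    then have "GW \<inter> Q = {}" using GW(2) QX by blast
    then have "GW \<inter> E = {}" unfolding E_def using GW(1) open_Int_closure_eq_empty[of GW Q] by blast
    then show False using y(1) yN NW GW(2) by blast
  qed
  from side[of True] side[of False] show False
    using mixed[of True] mixed[of False] both_Q both_Q2 by auto
qed

text \<open>In a set of least size, three or more points are excluded by the preceding lemma, and at
  most one point is excluded because \<open>X\<close> is not a singleton.\<close>

lemma irreducible_about_pair:
  assumes "finitely_irreducible X"
  obtains a b where "a \<noteq> b" "irreducible_about X {a, b}"
proof -
  obtain S0 where "finite S0" "irreducible_about X S0" using assms unfolding finitely_irreducible_def by blast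
  then obtain S where S: "finite S" "irreducible_about X S"
    and min: "\<And>T. finite T \<Longrightarrow> irreducible_about X T \<Longrightarrow> card S \<le> card T"
    using ex_has_least_nat[of "\<lambda>S. finite S \<and> irreducible_about X S" S0 card] by blast
  have "\<not> 3 \<le> card S"
    using not_irreducible_about_many[OF S(1) _ S(2)] min by (metis leD)
  moreover have "\<not> card S \<le> 1"
  proof
    assume "card S \<le> 1"
    then obtain s where s: "S \<subseteq> {s}" "s \<in> X"
    proof (cases "S = {}")
      case True
      then show thesis using that X_nonempty by blast
    next
      case False
      then have "card S = 1" using \<open>card S \<le> 1\<close> S(1) by (metis One_nat_def card_gt_0_iff le_antisym Suc_leI)
      then obtain s where "S = {s}" by (metis card_1_singletonE)
      then show thesis using that S(2) unfolding irreducible_about_def by blast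
    qed
    then have "{s} \<subset> X" using X_not_singleton by blast
    then show False using S(2) s singleton_continuum[of s] unfolding irreducible_about_def by blast
  qed
  ultimately have "card S = 2" by linarith
  then obtain a b where "S = {a, b}" "a \<noteq> b" by (metis card_2_iff)
  then show thesis using that S(2) by blast
qed

end

section \<open>The semiconjugacy to an interval map\<close>

lemma increasing_open_cover:
  fixes V :: "nat \<Rightarrow> 'a::metric_space set"
  assumes S: "compact S" and op: "\<And>k. openin (top_of_set S) (V k)"
    and inc: "\<And>k. V k \<subseteq> V (Suc k)" and cover: "S \<subseteq> (\<Union>k. V k)"
  obtains k where "V k = S"
proof -
  have "\<forall>k. \<exists>G. open G \<and> V k = S \<inter> G" using op by (simp add: openin_open)
  then obtain G where G: "\<And>k. open (G k)" "\<And>k. V k = S \<inter> G k" by metis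
  have "S \<subseteq> (\<Union>k\<in>UNIV. G k)" using cover G(2) by blast
  then obtain C where C: "finite C" "S \<subseteq> (\<Union>k\<in>C. G k)"
    using compactE_image[OF S, of UNIV G] G(1) by (metis subset_UNIV)
  have mono: "V i \<subseteq> V j" if "i \<le> j" for i j
    using lift_Suc_mono_le[of V, OF inc that] .
  obtain M where M: "\<And>k. k \<in> C \<Longrightarrow> k \<le> M" using C(1) by (meson finite_nat_set_iff_bounded_le)
  have "S \<subseteq> V M"
  proof
    fix x assume x: "x \<in> S"
    then obtain k where k: "k \<in> C" "x \<in> G k" using C(2) by blast
    then have "x \<in> V k" using x G(2) by blast
    then show "x \<in> V M" using mono[OF M[OF k(1)]] by blast
  qed
  moreover have "V M \<subseteq> S" using G(2) by blast
  ultimately show thesis using that by blast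
qed

lemma connected_nested_at_endpoint:
  fixes S T :: "real set"
  assumes "connected S" "connected T" "S \<subseteq> {0..1}" "T \<subseteq> {0..1}" "p \<in> S" "p \<in> T" "p = 0 \<or> p = 1"
  shows "S \<subseteq> T \<or> T \<subseteq> S"
proof (rule ccontr)
  assume "\<not> ?thesis"
  then obtain s t where st: "s \<in> S" "s \<notin> T" "t \<in> T" "t \<notin> S" by blast
  then have 01: "0 \<le> s" "s \<le> 1" "0 \<le> t" "t \<le> 1" using assms(3,4) by auto
  have S: "{u..v} \<subseteq> S" if "u \<in> S" "v \<in> S" for u v using connected_contains_Icc[OF assms(1) that] .
  have T: "{u..v} \<subseteq> T" if "u \<in> T" "v \<in> T" for u v using connected_contains_Icc[OF assms(2) that] .
  from assms(7) show False
  proof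
    assume "p = 0"
    then have "s \<in> {p..t} \<or> t \<in> {p..s}" using 01 by auto
    then show False using S[OF assms(5) st(1)] T[OF assms(6) st(3)] st by blast
  next
    assume "p = 1"
    then have "s \<in> {t..p} \<or> t \<in> {s..p}" using 01 by auto
    then show False using S[OF st(1) assms(5)] T[OF st(3) assms(6)] st by blast
  qed
qed

text \<open>Near an end point the punctured neighbourhood is still connected, and for a small radius
  it contains no further preimage of \<open>g p\<close>, so its image stays on one side of
  \<open>g p\<close>. If \<open>g p\<close> were interior, openness would require values on both
  sides.\<close>

lemma open_map_endpoint:
  fixes g :: "real \<Rightarrow> real"
  assumes cont: "continuous_on {0..1} g" and im: "g ` {0..1} = {0..1}"
    and op: "\<And>U. openin (top_of_set {0..1}) U \<Longrightarrow> openin (top_of_set {0..1}) (g ` U)"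
    and fin: "\<And>t. t \<in> {0..1} \<Longrightarrow> finite {s\<in>{0..1}. g s = t}"
    and p: "p = 0 \<or> p = 1"
  shows "g p = 0 \<or> g p = 1"
proof (rule ccontr)
  assume no: "\<not> ?thesis"
  have pI: "p \<in> {0..1}" using p by auto
  then have "g p \<in> {0..1}" using im by blast
  then have t: "0 < g p" "g p < 1" using no by auto
  obtain \<delta> where \<delta>: "0 < \<delta>" "\<And>s. s \<in> {s\<in>{0..1}. g s = g p} \<Longrightarrow> s \<noteq> p \<Longrightarrow> \<delta> \<le> dist p s"
    using finite_set_avoid[OF fin, of "g p" p] t by auto
  define U where "U = {0..1} \<inter> ball p \<delta>"
  have "convex (U - {p})"
  proof -
    have "U - {p} = {0..1} \<inter> ball p \<delta> \<inter> (if p = 0 then {0<..} else {..<1})"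
      using p by (auto simp: U_def)
    moreover have "convex \<dots>" by (intro convex_Int) auto
    ultimately show ?thesis by simp
  qed
  then have conn: "connected (U - {p})" by (rule convex_connected)
  have "connected (g ` (U - {p}))"
    by (rule connected_continuous_image[OF continuous_on_subset[OF cont] conn]) (auto simp: U_def)
  moreover have "g p \<notin> g ` (U - {p})"
  proof
    assume "g p \<in> g ` (U - {p})"
    then obtain s where "s \<in> U - {p}" "g p = g s" by (rule imageE)
    then have "s \<in> U" "s \<noteq> p" "g s = g p" by simp_all
    then show False using \<delta>(2)[of s] by (auto simp: U_def)
  qed
  ultimately have one_side: "\<not> (u < g p \<and> g p < v)" if "u \<in> g ` (U - {p})" "v \<in> g ` (U - {p})" for u v
    using connected_contains_Icc[of "g ` (U - {p})" u v] that by (meson atLeastAtMost_iff less_imp_le subsetD)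
  have "openin (top_of_set {0..1}) (g ` U)"
    by (rule op) (simp add: U_def openin_open_Int)
  then obtain G where G: "open G" "g ` U = {0..1} \<inter> G" by (auto simp: openin_open)
  have "g p \<in> g ` U" using pI \<delta>(1) by (auto simp: U_def)
  then have "g p \<in> G \<inter> {0<..<1}" using G(2) t by auto
  moreover have "open (G \<inter> {0<..<1})" using G(1) by auto
  ultimately obtain r where r: "0 < r" "ball (g p) r \<subseteq> G \<inter> {0<..<1}" using open_contains_ball by blast
  have mem: "v \<in> g ` (U - {p})" if "v \<in> ball (g p) r" "v \<noteq> g p" for v
  proof -
    have "v \<in> {0..1} \<inter> G" using r(2) that(1) by auto
    then have "v \<in> g ` U" using G(2) by simp
    then show ?thesis using that(2) by auto
  qed
  have "g p - r/2 \<in> g ` (U - {p})" "g p + r/2 \<in> g ` (U - {p})"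
    using r(1) by (auto intro!: mem simp: dist_real_def)
  then show False using one_side[of "g p - r/2" "g p + r/2"] r(1) by auto
qed

text \<open>Every open set eventually reaches an end point, so it suffices to treat connected
  neighbourhoods of one suitable end point. End points go to end points: either one of them is fixed
  or they are swapped. A neighbourhood of a fixed end point is nested with its image. If the image
  is smaller, invariance and covering make the set full; if it is larger, the images increase and
  compactness selects one exponent.\<close>

lemma exhausting_open_interval_map_exact:
  fixes g :: "real \<Rightarrow> real"
  assumes cont: "continuous_on {0..1} g" and im: "g ` {0..1} = {0..1}"
    and op: "\<And>U. openin (top_of_set {0..1}) U \<Longrightarrow> openin (top_of_set {0..1}) (g ` U)"
    and fin: "\<And>t. t \<in> {0..1} \<Longrightarrow> finite {s\<in>{0..1}. g s = t}"
    and exhausting: "\<And>U. openin (top_of_set {0..1}) U \<Longrightarrow> U \<noteq> {} \<Longrightarrow> {0..1} \<subseteq> (\<Union>n. (g ^^ n) ` U)"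
  shows "topologically_exact_on {0..1} g"
proof -
  have add: "(g ^^ (a + b)) ` U = (g ^^ a) ` ((g ^^ b) ` U)" for a b U
    by (simp add: funpow_add image_comp)
  have opn: "openin (top_of_set {0..1}) ((g ^^ n) ` U)" if "openin (top_of_set {0..1}) U" for n U
  proof (induction n)
    case (Suc n)
    then show ?case using op[OF Suc] by (simp add: image_comp o_def)
  qed (use that in simp)
  have sub: "U \<subseteq> {0..1}" if "openin (top_of_set {0..1}) U" for U :: "real set"
    using openin_imp_subset[OF that] .
  have subn: "(g ^^ n) ` U \<subseteq> {0..1}" if "openin (top_of_set {0..1}) U" for n U
    by (rule sub[OF opn[OF that]])
  have con: "connected (g ` U)" if "connected U" "U \<subseteq> {0..1}" for U
    by (rule connected_continuous_image[OF continuous_on_subset[OF cont that(2)] that(1)])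
  have conn: "connected ((g ^^ n) ` U)" if "connected U" "openin (top_of_set {0..1}) U" for n U
  proof (induction n)
    case (Suc n)
    then show ?case using con[OF Suc subn[OF that(2)]] by (simp add: image_comp o_def)
  qed (use that in simp)
  have invariant_full: "V = {0..1}" if "openin (top_of_set {0..1}) V" "V \<noteq> {}" "g ` V \<subseteq> V" for V
  proof -
    have "(g ^^ n) ` V \<subseteq> V" for n
    proof (induction n)
      case (Suc n)
      have "(g ^^ Suc n) ` V = g ` ((g ^^ n) ` V)" by (simp add: image_comp o_def)
      then show ?case using Suc that(3) by blast
    qed simp
    then show ?thesis using exhausting[OF that(1,2)] sub[OF that(1)] by blast
  qed
  have inc_pow: "((g ^^ j) ^^ k) ` V \<subseteq> ((g ^^ j) ^^ Suc k) ` V" if "V \<subseteq> (g ^^ j) ` V" for V j k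
  proof -
    have "((g ^^ j) ^^ Suc k) ` V = ((g ^^ j) ^^ k) ` ((g ^^ j) ` V)"
      by (simp add: funpow_swap1 image_comp o_def)
    then show ?thesis using that by (metis image_mono)
  qed
  have end0: "g 0 = 0 \<or> g 0 = 1" and end1: "g 1 = 0 \<or> g 1 = 1"
    by (rule open_map_endpoint[OF cont im op fin]; simp)+
  have fixed_endpoint: "\<exists>k. (g ^^ k) ` V = {0..1}"
    if V: "openin (top_of_set {0..1}) V" "connected V" "p \<in> V" and p: "p = 0 \<or> p = 1" "g p = p" for V p
  proof -
    have gp: "p \<in> g ` V" using V(3) p(2) by (metis imageI)
    have "V \<subseteq> g ` V \<or> g ` V \<subseteq> V"
      using connected_nested_at_endpoint[OF V(2) con[OF V(2) sub[OF V(1)]] sub[OF V(1)] sub[OF op[OF V(1)]] V(3) gp p(1)] .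
    then show ?thesis
    proof
      assume "g ` V \<subseteq> V"
      then have "(g ^^ 0) ` V = {0..1}" using invariant_full[OF V(1)] V(3) by auto
      then show ?thesis by blast
    next
      assume inc: "V \<subseteq> g ` V"
      have incs: "(g ^^ k) ` V \<subseteq> (g ^^ Suc k) ` V" for k
        using inc_pow[of V 1 k] inc by simp
      obtain k where "(g ^^ k) ` V = {0..1}"
      proof (rule increasing_open_cover[OF compact_Icc])
        show "openin (top_of_set {0..1}) ((g ^^ k) ` V)" for k by (rule opn[OF V(1)])
        show "{0..1} \<subseteq> (\<Union>k. (g ^^ k) ` V)" using exhausting[OF V(1)] V(3) by blast
      qed (use incs in blast)+
      then show ?thesis by blast
    qed
  qed
  have swapped_endpoint: "\<exists>k. (g ^^ k) ` V = {0..1}"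
    if V: "openin (top_of_set {0..1}) V" "0 \<in> V" and swap: "g 0 = 1" "g 1 = 0" for V
  proof -
    obtain G where G: "open G" "V = {0..1} \<inter> G" using V(1) by (auto simp: openin_open)
    have "\<exists>\<delta>>0. \<forall>s\<in>{0..1}. dist s 0 < \<delta> \<longrightarrow> dist (g s) (g 0) < 1/2"
      using cont unfolding continuous_on_iff by (metis atLeastAtMost_iff half_gt_zero_iff order_refl zero_le_one zero_less_one)
    then obtain \<delta> where \<delta>: "0 < \<delta>" "\<And>s. s \<in> {0..1} \<Longrightarrow> dist s 0 < \<delta> \<Longrightarrow> dist (g s) 1 < 1/2"
      using swap by auto
    obtain r where r: "0 < r" "ball 0 r \<subseteq> G" using G V(2) open_contains_ball by blast
    \<comment> \<open>The radius keeps \<open>1/2\<close> outside both \<open>V'\<close> and its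
      image. This excludes the decreasing case, in which \<open>V'\<close> and its image would
      together be invariant and hence full.\<close>
    define V' where "V' = {0..1} \<inter> ball (0::real) (min r (min \<delta> (1/2)))"
    have V': "openin (top_of_set {0..1}) V'" "connected V'" "0 \<in> V'"
      unfolding V'_def using r(1) \<delta>(1) by (auto simp: openin_open_Int intro!: convex_connected convex_Int)
    have V'V: "V' \<subseteq> V" unfolding V'_def G(2) using r(2) by auto
    have half: "1/2 \<notin> V'" "1/2 \<notin> g ` V'"
      unfolding V'_def using \<delta>(2) by (auto simp: dist_real_def) fastforce
    let ?h = "g ^^ 2"
    have h_im: "?h ` A = g ` (g ` A)" for A by (simp add: numeral_2_eq_2 image_comp o_def)
    have "0 \<in> ?h ` V'" using V'(3) swap by (auto simp: numeral_2_eq_2 intro!: image_eqI[of _ _ 0])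
    then have "V' \<subseteq> ?h ` V' \<or> ?h ` V' \<subseteq> V'"
      using connected_nested_at_endpoint[OF V'(2) conn[OF V'(2,1)] sub[OF V'(1)] subn[OF V'(1)] V'(3)] by blast
    moreover have "\<not> ?h ` V' \<subseteq> V'"
    proof
      assume "?h ` V' \<subseteq> V'"
      then have "g ` (V' \<union> g ` V') \<subseteq> V' \<union> g ` V'" unfolding h_im by blast
      then have "V' \<union> g ` V' = {0..1}"
        using invariant_full[of "V' \<union> g ` V'"] V' op[OF V'(1)] by (simp add: openin_Un) blast
      moreover have "(1/2::real) \<in> {0..1}" by simp
      ultimately show False using half by blast
    qed
    ultimately have inc: "V' \<subseteq> ?h ` V'" by blast
    define A where "A k = (?h ^^ k) ` V'" for k
    have A_eq: "A k = (g ^^ (2 * k)) ` V'" for k unfolding A_def by (simp add: funpow_mult)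
    have A_inc: "A k \<subseteq> A (Suc k)" for k unfolding A_def by (rule inc_pow[OF inc])
    have A_Suc: "A (Suc k) = g ` (g ` A k)" for k
      unfolding A_def by (simp add: numeral_2_eq_2 image_comp o_def)
    have A_op: "openin (top_of_set {0..1}) (A k)" for k unfolding A_eq by (rule opn[OF V'(1)])
    define Q where "Q = (\<Union>k. A k)"
    have Q_op: "openin (top_of_set {0..1}) Q" unfolding Q_def using A_op by blast
    have hQ: "g ` (g ` Q) \<subseteq> Q"
      unfolding Q_def using A_Suc by (auto simp: image_UN) blast
    have "0 \<in> A 0" using V'(3) by (simp add: A_def)
    then have Q0: "0 \<in> Q" unfolding Q_def by blast
    have full: "Q \<union> g ` Q = {0..1}"
    proof (rule invariant_full)
      show "openin (top_of_set {0..1}) (Q \<union> g ` Q)" by (intro openin_Un Q_op op)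
      show "Q \<union> g ` Q \<noteq> {}" using Q0 by blast
      show "g ` (Q \<union> g ` Q) \<subseteq> Q \<union> g ` Q" using hQ by blast
    qed
    \<comment> \<open>Two open sets covering the connected interval must overlap; the overlap is
      open and forward invariant, hence full, so \<open>Q\<close> alone already covers the
      interval.\<close>
    have "Q \<inter> g ` Q \<noteq> {}"
    proof
      assume "Q \<inter> g ` Q = {}"
      moreover have "connected {0..1::real}" by simp
      ultimately show False
        unfolding connected_openin using Q_op op[OF Q_op] full Q0 by blast
    qed
    moreover have "g ` (Q \<inter> g ` Q) \<subseteq> Q \<inter> g ` Q" using hQ by blast
    ultimately have "Q \<inter> g ` Q = {0..1}"
      by (intro invariant_full openin_Int Q_op op)
    then have "{0..1} \<subseteq> (\<Union>k. A k)" unfolding Q_def by blast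
    then obtain k where "A k = {0..1}"
      using increasing_open_cover[where V = A and S = "{0..1::real}", OF compact_Icc A_op A_inc] by blast
    then have "{0..1} \<subseteq> (g ^^ (2 * k)) ` V" using V'V unfolding A_eq by blast
    then show ?thesis using subn[OF V(1)] by blast
  qed
  have endpoint: "\<exists>p. (p = 0 \<or> p = 1) \<and> (\<forall>V. openin (top_of_set {0..1}) V \<longrightarrow> connected V \<longrightarrow> p \<in> V \<longrightarrow> (\<exists>k. (g ^^ k) ` V = {0..1}))"
  proof -
    consider "g 0 = 0" | "g 1 = 1" | "g 0 = 1" "g 1 = 0" using end0 end1 by blast
    then show ?thesis
    proof cases
      case 1
      then show ?thesis using fixed_endpoint[of _ 0] by (intro exI[of _ 0]) blast
    next
      case 2
      then show ?thesis using fixed_endpoint[of _ 1] by (intro exI[of _ 1]) blast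
    next
      case 3
      then show ?thesis using swapped_endpoint by (intro exI[of _ 0]) blast
    qed
  qed
  then obtain p where p: "p = 0 \<or> p = 1"
    and p_exact: "\<And>V. openin (top_of_set {0..1}) V \<Longrightarrow> connected V \<Longrightarrow> p \<in> V \<Longrightarrow> \<exists>k. (g ^^ k) ` V = {0..1}"
    by blast
  show ?thesis
    unfolding topologically_exact_on_def
  proof (intro allI impI)
    fix U :: "real set" assume U: "openin (top_of_set {0..1}) U \<and> U \<noteq> {}"
    then obtain G where G: "open G" "U = {0..1} \<inter> G" by (auto simp: openin_open)
    obtain u where u: "u \<in> U" using U by blast
    then obtain r where r: "0 < r" "ball u r \<subseteq> G" using G open_contains_ball by blast
    define U' where "U' = {0..1} \<inter> ball u r"
    have U': "openin (top_of_set {0..1}) U'" "connected U'" "u \<in> U'"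
      unfolding U'_def using r(1) u G(2) by (auto simp: openin_open_Int intro!: convex_connected convex_Int)
    have "p \<in> {0..1}" using p by auto
    then obtain n where n: "p \<in> (g ^^ n) ` U'" using exhausting[OF U'(1)] U'(3) by blast
    obtain k where k: "(g ^^ k) ` ((g ^^ n) ` U') = {0..1}"
      using p_exact[OF opn[OF U'(1)] conn[OF U'(2,1)] n] by blast
    have "U' \<subseteq> U" unfolding U'_def G(2) using r(2) by blast
    then have "{0..1} \<subseteq> (g ^^ (k + n)) ` U" using k unfolding add by blast
    then have "(g ^^ (k + n)) ` U = {0..1}" using subn[of U] U by blast
    then show "\<exists>k. (g ^^ k) ` U = {0..1}" by blast
  qed
qed

section \<open>The induced interval map\<close>

context exhausting_map
begin

theorem semiconjugate_to_interval_map: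
  assumes "finitely_irreducible X"
  shows "\<exists>a b. irreducible_between X a b"
    and "\<exists>m :: 'a \<Rightarrow> real. continuous_on X m \<and> m ` X = {0..1} \<and>
      (\<forall>t\<in>{0..1}. connected {y\<in>X. m y = t}) \<and> (\<forall>t\<in>{0..1}. nowhere_dense_in X {y\<in>X. m y = t}) \<and>
      (\<exists>g :: real \<Rightarrow> real. continuous_on {0..1} g \<and> g ` {0..1} \<subseteq> {0..1} \<and> (\<forall>y\<in>X. m (f y) = g (m y)) \<and>
        (\<forall>U. openin (top_of_set {0..1}) U \<longrightarrow> openin (top_of_set {0..1}) (g ` U)) \<and>
        topologically_exact_on {0..1} g \<and>
        (\<forall>t\<in>{0..1}. finite {s\<in>{0..1}. g s = t} \<and> card {s\<in>{0..1}. g s = t} \<le> d))"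
proof -
  obtain a b where ab: "a \<noteq> b" "irreducible_about X {a, b}" using irreducible_about_pair[OF assms] by blast
  then show "\<exists>a b. irreducible_between X a b" unfolding irreducible_between_def by blast
  have abX: "a \<in> X" "b \<in> X" using ab(2) unfolding irreducible_about_def by auto
  have irr: "irreducible_from X {a} {b}"
    unfolding irreducible_from_def
  proof (intro conjI allI impI)
    fix K assume K: "continuum K \<and> K \<subseteq> X \<and> K \<inter> {a} \<noteq> {} \<and> K \<inter> {b} \<noteq> {}"
    then have "{a, b} \<subseteq> K" by blast
    then have "K = X" using ab(2) K unfolding irreducible_about_def by blast
    then show "X \<subseteq> {a} \<union> K \<union> {b}" by blast
  qed (use ab(1) abX singleton_continuum in auto)
  obtain m where lm: "level_map X {a} {b} m"
    and fine: "\<And>V. open V \<Longrightarrow> V \<inter> (X - {a} - {b}) \<noteq> {} \<Longrightarrow> \<exists>v\<in>V \<inter> X. \<exists>w\<in>V \<inter> X. m v \<noteq> m w"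
    using fine_level_map_exists[OF irr] by blast
  have m_img: "m ` X = {0..1}" by (rule level_map_image[OF irr lm])
  have mcont: "continuous_on X m" by (rule level_map_continuous[OF lm])
  have thin: "nowhere_dense_in X {y\<in>X. m y = t}" for t
    by (rule fine_fibre_nowhere_dense[OF lm fine singleton_nowhere_dense]) (use singleton_nowhere_dense in auto)
  define F where "F t = {y\<in>X. m y = t}" for t
  have F: "continuum (F t)" if "t \<in> {0..1}" for t
    unfolding F_def by (rule fibre_continuum[OF irr lm]) (use that in auto)
  have m01: "m y \<in> {0..1}" if "y \<in> X" for y using m_img that by blast
  have fX: "f y \<in> X" if "y \<in> X" for y by (rule finite_open_self_mapD(6)[OF f that])
  \<comment> \<open>The image of a fibre is a nowhere dense continuum, so it lies in one fibre; that
    fibre is itself a nowhere dense continuum, so maximality of the image gives equality.\<close>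
  have image_fibre: "f ` F (m y) = F (m (f y))" if y: "y \<in> X" for y
  proof
    have fF: "continuum (f ` F (m y))" "f ` F (m y) \<subseteq> X"
      unfolding F_def by (rule image_fibre_continuum[OF irr lm f]; use m01[OF y] in simp)+
    have fthin: "nowhere_dense_in X (f ` F (m y))"
      by (rule image_nowhere_dense[OF f continuumD(3)[OF F[OF m01[OF y]]]]) (auto simp: F_def thin)
    have yF: "f y \<in> f ` F (m y)" using y by (auto simp: F_def)
    show "f ` F (m y) \<subseteq> F (m (f y))"
    proof
      fix z assume z: "z \<in> f ` F (m y)"
      have "m z = m (f y)" by (rule nowhere_dense_continuum_in_fibre[OF irr lm fF fthin z yF])
      then show "z \<in> F (m (f y))" using z fF(2) by (auto simp: F_def)
    qed
    have "f y \<in> F (m (f y))" using fX[OF y] by (simp add: F_def)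
    then show "F (m (f y)) \<subseteq> f ` F (m y)"
      unfolding F_def
      using image_fibre_maximal[OF irr lm f _ _ thin, of "m y" "F (m (f y))"] m01[OF y] F[OF m01[OF fX[OF y]]] thin yF
      by (auto simp: F_def)
  qed
  define \<sigma> where "\<sigma> t = (SOME y. y \<in> X \<and> m y = t)" for t
  have \<sigma>: "\<sigma> t \<in> X" "m (\<sigma> t) = t" if "t \<in> {0..1}" for t
  proof -
    have "\<exists>y. y \<in> X \<and> m y = t" using m_img that by (metis imageE)
    then have "\<sigma> t \<in> X \<and> m (\<sigma> t) = t" unfolding \<sigma>_def by (rule someI_ex)
    then show "\<sigma> t \<in> X" "m (\<sigma> t) = t" by auto
  qed
  define g where "g t = m (f (\<sigma> t))" for t
  have semi: "m (f y) = g (m y)" if y: "y \<in> X" for y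
  proof -
    have "\<sigma> (m y) \<in> F (m y)" using \<sigma>[OF m01[OF y]] by (simp add: F_def)
    then have "f (\<sigma> (m y)) \<in> F (m (f y))" using image_fibre[OF y] by blast
    then show ?thesis by (simp add: F_def g_def)
  qed
  have semi_pow: "m ((f ^^ n) y) = (g ^^ n) (m y) \<and> (f ^^ n) y \<in> X" if "y \<in> X" for n y
    using that by (induction n) (auto simp: semi fX)
  have gI: "g t \<in> {0..1}" if "t \<in> {0..1}" for t
    unfolding g_def by (rule m01[OF fX[OF \<sigma>(1)[OF that]]])
  have g_img: "g ` {0..1} = {0..1}"
  proof
    show "g ` {0..1} \<subseteq> {0..1}" using gI by blast
    show "{0..1} \<subseteq> g ` {0..1}"
    proof
      fix t :: real assume t: "t \<in> {0..1}"
      obtain y where y: "y \<in> X" "f y = \<sigma> t" using finite_open_self_mapD(2)[OF f] \<sigma>(1)[OF t] by (metis imageE)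
      then have "t = g (m y)" using semi[OF y(1)] \<sigma>(2)[OF t] by simp
      then show "t \<in> g ` {0..1}" using m01[OF y(1)] by blast
    qed
  qed
  have g_fibre: "f ` F t = F (g t)" if "t \<in> {0..1}" for t
    using image_fibre[OF \<sigma>(1)[OF that]] \<sigma>(2)[OF that] by (simp add: g_def)
  have closed_image: "closed (m ` C)" if "closed C" "C \<subseteq> X" for C
  proof -
    have "compact C" using compact_Int_closed[OF compact_X that(1)] that(2) by (simp add: Int_absorb1)
    then show ?thesis using compact_continuous_image[OF continuous_on_subset[OF mcont that(2)]] compact_imp_closed by blast
  qed
  \<comment> \<open>\<open>m\<close> is a closed surjection, so closed sets can be pushed forward
    after being pulled back along \<open>m\<close> and \<open>f\<close>.\<close>
  have g_cont: "continuous_on {0..1} g"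
    unfolding continuous_on_closed_vimage[OF closed_atLeastAtMost]
  proof (intro allI impI)
    fix B :: "real set" assume B: "closed B"
    have "continuous_on X (\<lambda>y. m (f y))"
      using continuous_on_compose[OF finite_open_self_mapD(1)[OF f]] mcont finite_open_self_mapD(2)[OF f] by (simp add: o_def)
    then have "closed (X \<inter> (\<lambda>y. m (f y)) -` B)"
      by (rule continuous_closed_preimage[OF _ closed_X B])
    then have "closed (m ` (X \<inter> (\<lambda>y. m (f y)) -` B))" by (rule closed_image) auto
    moreover have "m ` (X \<inter> (\<lambda>y. m (f y)) -` B) = g -` B \<inter> {0..1}"
    proof (intro equalityI subsetI)
      fix t assume "t \<in> m ` (X \<inter> (\<lambda>y. m (f y)) -` B)"
      then show "t \<in> g -` B \<inter> {0..1}" using semi m01 by auto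
    next
      fix t assume t: "t \<in> g -` B \<inter> {0..1}"
      then have "\<sigma> t \<in> X \<inter> (\<lambda>y. m (f y)) -` B" using \<sigma>[of t] by (auto simp: g_def)
      moreover have "t = m (\<sigma> t)" using \<sigma>(2)[of t] t by auto
      ultimately show "t \<in> m ` (X \<inter> (\<lambda>y. m (f y)) -` B)" by blast
    qed
    ultimately show "closed (g -` B \<inter> {0..1})" by simp
  qed
  have g_open: "openin (top_of_set {0..1}) (g ` U)" if U: "openin (top_of_set {0..1}) U" for U
  proof -
    obtain G where G: "open G" "U = {0..1} \<inter> G" using U by (auto simp: openin_open)
    have "openin (top_of_set X) (X \<inter> m -` G)" using continuous_openin_preimage_gen[OF mcont G(1)] .
    then have "openin (top_of_set X) (f ` (X \<inter> m -` G))" by (rule finite_open_self_mapD(3)[OF f])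
    then obtain H where H: "open H" "f ` (X \<inter> m -` G) = X \<inter> H" by (auto simp: openin_open)
    have "closed (X - H)" using closed_X H(1) by (rule closed_Diff)
    then have cl: "closed (m ` (X - H))" by (rule closed_image) auto
    have "g ` U = {0..1} - m ` (X - H)"
    proof (intro equalityI subsetI)
      fix s assume "s \<in> g ` U"
      then obtain t where t: "t \<in> {0..1}" "t \<in> G" "s = g t" using G(2) by auto
      have "z \<in> H" if "z \<in> X" "m z = s" for z
      proof -
        have "z \<in> F (g t)" using that t by (simp add: F_def)
        then have "z \<in> f ` F t" using g_fibre[OF t(1)] by simp
        then have "z \<in> f ` (X \<inter> m -` G)" using t(2) by (auto simp: F_def)
        then show ?thesis using H(2) by blast
      qed
      then show "s \<in> {0..1} - m ` (X - H)" using gI t by auto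
    next
      fix s assume s: "s \<in> {0..1} - m ` (X - H)"
      then have "\<sigma> s \<in> X" "m (\<sigma> s) = s" using \<sigma>[of s] by auto
      then have "\<sigma> s \<in> X \<inter> H" using s imageI[of "\<sigma> s" "X - H" m] by auto
      then have "\<sigma> s \<in> f ` (X \<inter> m -` G)" using H(2) by simp
      then obtain z where "z \<in> X \<inter> m -` G" "\<sigma> s = f z" by (rule imageE)
      then have z: "z \<in> X" "m z \<in> G" "f z = \<sigma> s" by simp_all
      then have "s = g (m z)" using semi[OF z(1)] \<open>m (\<sigma> s) = s\<close> by simp
      then show "s \<in> g ` U" using G(2) m01[OF z(1)] z(2) by blast
    qed
    also have "\<dots> = {0..1} \<inter> - (m ` (X - H))" by blast
    finally show ?thesis using cl by (simp add: openin_open_Int open_Compl)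
  qed
  \<comment> \<open>Every fibre over a \<open>g\<close>-preimage of \<open>t\<close> is mapped onto
    the fibre over \<open>t\<close>, so it contains a preimage of the single point
    \<open>\<sigma> t\<close>; there are at most \<open>d\<close> of these.\<close>
  have g_card: "finite {s\<in>{0..1}. g s = t} \<and> card {s\<in>{0..1}. g s = t} \<le> d" if t: "t \<in> {0..1}" for t
  proof -
    define P where "P = {x\<in>X. f x = \<sigma> t}"
    have P: "finite P" "card P \<le> d"
      unfolding P_def using finite_open_self_mapD(4,5)[OF f \<sigma>(1)[OF t]] by auto
    have "{s\<in>{0..1}. g s = t} \<subseteq> m ` P"
    proof
      fix s assume s: "s \<in> {s\<in>{0..1}. g s = t}"
      have "\<sigma> t \<in> F (g s)" using s \<sigma>[OF t] by (simp add: F_def)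
      then have "\<sigma> t \<in> f ` F s" using g_fibre[of s] s by simp
      then obtain x where "x \<in> F s" "f x = \<sigma> t" by (metis imageE)
      then show "s \<in> m ` P" by (auto simp: F_def P_def)
    qed
    moreover have "finite (m ` P)" "card (m ` P) \<le> d" using P card_image_le[OF P(1), of m] by auto
    ultimately show ?thesis by (meson card_mono finite_subset order_trans)
  qed
  have exact: "topologically_exact_on {0..1} g"
  proof (rule exhausting_open_interval_map_exact[OF g_cont g_img g_open])
    show "finite {s\<in>{0..1}. g s = t}" if "t \<in> {0..1}" for t using g_card[OF that] by blast
    fix U :: "real set" assume U: "openin (top_of_set {0..1}) U" "U \<noteq> {}"
    then obtain G where G: "open G" "U = {0..1} \<inter> G" by (auto simp: openin_open)
    obtain u where u: "u \<in> U" using U by blast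
    then have "\<sigma> u \<in> X \<inter> m -` G" using \<sigma>[of u] G(2) by auto
    moreover have "openin (top_of_set X) (X \<inter> m -` G)" using continuous_openin_preimage_gen[OF mcont G(1)] .
    ultimately have cov: "X \<subseteq> (\<Union>n. (f ^^ n) ` (X \<inter> m -` G))" by (intro exhausting) blast+
    show "{0..1} \<subseteq> (\<Union>n. (g ^^ n) ` U)"
    proof
      fix t :: real assume t: "t \<in> {0..1}"
      obtain n z where z: "z \<in> X" "m z \<in> G" "\<sigma> t = (f ^^ n) z" using cov \<sigma>(1)[OF t] by blast
      then have "t = (g ^^ n) (m z)" using semi_pow[OF z(1), of n] \<sigma>(2)[OF t] by simp
      moreover have "m z \<in> U" using G(2) z m01 by blast
      ultimately show "t \<in> (\<Union>n. (g ^^ n) ` U)" by blast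
    qed
  qed
  have "\<exists>g :: real \<Rightarrow> real. continuous_on {0..1} g \<and> g ` {0..1} \<subseteq> {0..1} \<and> (\<forall>y\<in>X. m (f y) = g (m y)) \<and>
        (\<forall>U. openin (top_of_set {0..1}) U \<longrightarrow> openin (top_of_set {0..1}) (g ` U)) \<and>
        topologically_exact_on {0..1} g \<and>
        (\<forall>t\<in>{0..1}. finite {s\<in>{0..1}. g s = t} \<and> card {s\<in>{0..1}. g s = t} \<le> d)"
    using g_cont eq_refl[OF g_img] semi g_open exact g_card by (intro exI[of _ g] conjI ballI allI impI) simp_all
  moreover have "\<forall>t\<in>{0..1}. connected {y\<in>X. m y = t}"
    using continuumD(4)[OF F] unfolding F_def by blast
  moreover have "\<forall>t\<in>{0..1}. nowhere_dense_in X {y\<in>X. m y = t}" using thin by simp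
  ultimately show "\<exists>m :: 'a \<Rightarrow> real. continuous_on X m \<and> m ` X = {0..1} \<and>
      (\<forall>t\<in>{0..1}. connected {y\<in>X. m y = t}) \<and> (\<forall>t\<in>{0..1}. nowhere_dense_in X {y\<in>X. m y = t}) \<and>
      (\<exists>g :: real \<Rightarrow> real. continuous_on {0..1} g \<and> g ` {0..1} \<subseteq> {0..1} \<and> (\<forall>y\<in>X. m (f y) = g (m y)) \<and>
        (\<forall>U. openin (top_of_set {0..1}) U \<longrightarrow> openin (top_of_set {0..1}) (g ` U)) \<and>
        topologically_exact_on {0..1} g \<and>
        (\<forall>t\<in>{0..1}. finite {s\<in>{0..1}. g s = t} \<and> card {s\<in>{0..1}. g s = t} \<le> d))"
    using mcont m_img by (intro exI[of _ m] conjI) assumption+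
qed

end

section \<open>Homogeneous coordinates on the Riemann sphere\<close>

text \<open>The point with homogeneous coordinates \<open>[u : v]\<close>, up to normalisation the
  Hopf map. It treats infinity like any other point. The pair (0, 0) is sent by division by zero to
  the origin, off the sphere, whence the recurring non-vanishing hypotheses.\<close>

definition sphere_point :: "complex \<Rightarrow> complex \<Rightarrow> pt" where
  "sphere_point u v = (2 * Re (u * cnj v) / ((cmod u)\<^sup>2 + (cmod v)\<^sup>2),
     2 * Im (u * cnj v) / ((cmod u)\<^sup>2 + (cmod v)\<^sup>2),
     ((cmod u)\<^sup>2 - (cmod v)\<^sup>2) / ((cmod u)\<^sup>2 + (cmod v)\<^sup>2))"

lemma norm_pair_pos:
  fixes u v :: complex
  assumes "u \<noteq> 0 \<or> v \<noteq> 0"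
  shows "0 < (cmod u)\<^sup>2 + (cmod v)\<^sup>2"
  using assms by (auto simp: add_pos_nonneg add_nonneg_pos)

lemma sphere_point_scale:
  assumes "c \<noteq> 0"
  shows "sphere_point (c * u) (c * v) = sphere_point u v"
proof -
  define k where "k = (cmod c)\<^sup>2"
  have k: "k \<noteq> 0" using assms by (simp add: k_def)
  have eq: "c * u * cnj (c * v) = of_real k * (u * cnj v)"
    unfolding k_def complex_norm_square by (simp add: algebra_simps)
  have 1: "2 * Re (c * u * cnj (c * v)) = k * (2 * Re (u * cnj v))" "2 * Im (c * u * cnj (c * v)) = k * (2 * Im (u * cnj v))"
    unfolding eq by simp_all
  have 2: "(cmod (c * u))\<^sup>2 + (cmod (c * v))\<^sup>2 = k * ((cmod u)\<^sup>2 + (cmod v)\<^sup>2)"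
    "(cmod (c * u))\<^sup>2 - (cmod (c * v))\<^sup>2 = k * ((cmod u)\<^sup>2 - (cmod v)\<^sup>2)"
    by (simp_all add: k_def norm_mult power_mult_distrib algebra_simps)
  show ?thesis
    unfolding sphere_point_def 1 2 by (simp only: mult_divide_mult_cancel_left[OF k])
qed

lemma sphere_point_Some: "sphere_point z 1 = stereo_inv (Some z)"
  by (simp add: sphere_point_def stereo_inv_def add.commute)

lemma sphere_point_quotient: "v \<noteq> 0 \<Longrightarrow> sphere_point u v = stereo_inv (Some (u / v))"
  using sphere_point_scale[of v "u / v" 1] by (simp add: sphere_point_Some)

lemma sphere_point_None: "u \<noteq> 0 \<Longrightarrow> sphere_point u 0 = stereo_inv None"
  by (simp add: sphere_point_def stereo_inv_def)

lemma riemann_sphere_eq: "riemann_sphere = {sphere_point u v |u v. u \<noteq> 0 \<or> v \<noteq> 0}"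
proof (intro equalityI subsetI)
  fix x assume "x \<in> riemann_sphere"
  then obtain w where w: "x = stereo_inv w" by (auto simp: riemann_sphere_def)
  show "x \<in> {sphere_point u v |u v. u \<noteq> 0 \<or> v \<noteq> 0}"
  proof (cases w)
    case None
    then have "x = sphere_point 1 0" using w sphere_point_None[of 1] by simp
    then show ?thesis by (metis (mono_tags, lifting) mem_Collect_eq zero_neq_one)
  next
    case (Some z)
    then have "x = sphere_point z 1" using w by (simp add: sphere_point_Some)
    then show ?thesis by (metis (mono_tags, lifting) mem_Collect_eq zero_neq_one)
  qed
next
  fix x assume "x \<in> {sphere_point u v |u v. u \<noteq> 0 \<or> v \<noteq> 0}"
  then obtain u v where uv: "x = sphere_point u v" "u \<noteq> 0 \<or> v \<noteq> 0" by blast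
  then show "x \<in> riemann_sphere"
    unfolding riemann_sphere_def by (cases "v = 0") (auto simp: sphere_point_quotient sphere_point_None)
qed

lemma sphere_point_in: "u \<noteq> 0 \<or> v \<noteq> 0 \<Longrightarrow> sphere_point u v \<in> riemann_sphere"
  unfolding riemann_sphere_eq by blast

text \<open>The numerators form vectors of lengths \<open>n\<close> and \<open>k\<close>, so the
  squared distance is determined by their inner product, and \<open>cross\<close> expresses that
  product by the determinant of the two coordinate pairs.\<close>

lemma dist_sphere_point:
  assumes uv: "u \<noteq> 0 \<or> v \<noteq> 0" and ab: "a \<noteq> 0 \<or> b \<noteq> 0"
  shows "dist (sphere_point u v) (sphere_point a b) =
    2 * cmod (u * b - v * a) / (sqrt ((cmod u)\<^sup>2 + (cmod v)\<^sup>2) * sqrt ((cmod a)\<^sup>2 + (cmod b)\<^sup>2))"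
proof -
  define n where "n = (cmod u)\<^sup>2 + (cmod v)\<^sup>2"
  define k where "k = (cmod a)\<^sup>2 + (cmod b)\<^sup>2"
  have n: "0 < n" and k: "0 < k" unfolding n_def k_def using norm_pair_pos uv ab by blast+
  define x1 where "x1 = 2 * Re (u * cnj v)"
  define x2 where "x2 = 2 * Im (u * cnj v)"
  define x3 where "x3 = (cmod u)\<^sup>2 - (cmod v)\<^sup>2"
  define y1 where "y1 = 2 * Re (a * cnj b)"
  define y2 where "y2 = 2 * Im (a * cnj b)"
  define y3 where "y3 = (cmod a)\<^sup>2 - (cmod b)\<^sup>2"
  have nx: "x1\<^sup>2 + x2\<^sup>2 + x3\<^sup>2 = n\<^sup>2"
    unfolding x1_def x2_def x3_def n_def by (simp add: cmod_power2) algebra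
  have ny: "y1\<^sup>2 + y2\<^sup>2 + y3\<^sup>2 = k\<^sup>2"
    unfolding y1_def y2_def y3_def k_def by (simp add: cmod_power2) algebra
  have cross: "2 * n * k - 2 * (x1 * y1 + x2 * y2 + x3 * y3) = 4 * (cmod (u * b - v * a))\<^sup>2"
    unfolding x1_def x2_def x3_def y1_def y2_def y3_def n_def k_def by (simp add: cmod_power2) algebra
  have "(dist (sphere_point u v) (sphere_point a b))\<^sup>2 = (x1 / n - y1 / k)\<^sup>2 + ((x2 / n - y2 / k)\<^sup>2 + (x3 / n - y3 / k)\<^sup>2)"
    by (simp add: sphere_point_def dist_prod_def dist_real_def n_def k_def x1_def x2_def x3_def y1_def y2_def y3_def)
  also have "\<dots> = (x1\<^sup>2 + x2\<^sup>2 + x3\<^sup>2) / n\<^sup>2 + (y1\<^sup>2 + y2\<^sup>2 + y3\<^sup>2) / k\<^sup>2 - 2 * (x1 * y1 + x2 * y2 + x3 * y3) / (n * k)"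
  proof -
    have "(x / n - y / k)\<^sup>2 = x\<^sup>2 / n\<^sup>2 + y\<^sup>2 / k\<^sup>2 - 2 * (x * y) / (n * k)" for x y
      by (simp add: power2_diff power_divide)
    then show ?thesis by (simp add: add_divide_distrib distrib_left)
  qed
  also have "\<dots> = 2 - 2 * (x1 * y1 + x2 * y2 + x3 * y3) / (n * k)"
    unfolding nx ny using n k by simp
  also have "\<dots> = (2 * n * k - 2 * (x1 * y1 + x2 * y2 + x3 * y3)) / (n * k)"
    using n k by (simp add: field_simps)
  also have "\<dots> = (2 * cmod (u * b - v * a) / (sqrt n * sqrt k))\<^sup>2"
    unfolding cross using n k by (simp add: power_divide power_mult_distrib)
  finally have "dist (sphere_point u v) (sphere_point a b) = 2 * cmod (u * b - v * a) / (sqrt n * sqrt k)"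
    by (rule power2_eq_imp_eq) (use n k in auto)
  then show ?thesis unfolding n_def k_def .
qed

lemma sphere_point_eq_iff:
  assumes uv: "u \<noteq> 0 \<or> v \<noteq> 0" and ab: "a \<noteq> 0 \<or> b \<noteq> 0"
  shows "sphere_point u v = sphere_point a b \<longleftrightarrow> u * b = v * a"
proof -
  have "sphere_point u v = sphere_point a b \<longleftrightarrow> dist (sphere_point u v) (sphere_point a b) = 0" by simp
  also have "\<dots> \<longleftrightarrow> cmod (u * b - v * a) = 0"
    unfolding dist_sphere_point[OF assms] using uv ab by auto
  finally show ?thesis by simp
qed

lemma inj_stereo_inv: "inj stereo_inv"
proof (rule injI)
  fix w w' assume eq: "stereo_inv w = stereo_inv w'"
  show "w = w'"
  proof (cases w; cases w')
    fix z assume "w = None" "w' = Some z"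
    then have "sphere_point 1 0 = sphere_point z 1" using eq by (simp add: sphere_point_Some sphere_point_None)
    then show ?thesis using sphere_point_eq_iff[of 1 0 z 1] by simp
  next
    fix z assume "w = Some z" "w' = None"
    then have "sphere_point 1 0 = sphere_point z 1" using eq by (simp add: sphere_point_Some sphere_point_None)
    then show ?thesis using sphere_point_eq_iff[of 1 0 z 1] by simp
  next
    fix z z' assume z: "w = Some z" "w' = Some z'"
    then have "sphere_point z 1 = sphere_point z' 1" using eq by (simp add: sphere_point_Some)
    then show ?thesis using sphere_point_eq_iff[of z 1 z' 1] z by simp
  qed auto
qed

lemma continuous_on_sphere_point:
  assumes "continuous_on S u" "continuous_on S v" "\<And>x. x \<in> S \<Longrightarrow> u x \<noteq> 0 \<or> v x \<noteq> 0"
  shows "continuous_on S (\<lambda>x. sphere_point (u x) (v x))"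
  unfolding sphere_point_def
  using norm_pair_pos[OF assms(3)]
  by (intro continuous_intros assms ballI) (auto simp: less_le)

text \<open>Two continuous choices of homogeneous coordinates, each omitting one pole; a global
  choice is impossible because the Hopf bundle is nontrivial.\<close>

lemma sphere_point_section:
  assumes "(x1, x2, x3) \<in> riemann_sphere"
  shows "x3 \<noteq> 1 \<Longrightarrow> (x1, x2, x3) = sphere_point (Complex x1 x2) (of_real (1 - x3))"
    and "x3 \<noteq> -1 \<Longrightarrow> (x1, x2, x3) = sphere_point (of_real (1 + x3)) (Complex x1 (- x2))"
proof -
  have sq: "x1\<^sup>2 + x2\<^sup>2 = 1 - x3\<^sup>2"
  proof -
    obtain u v where uv: "(x1, x2, x3) = sphere_point u v" "u \<noteq> 0 \<or> v \<noteq> 0"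
      using assms unfolding riemann_sphere_eq by blast
    define n where "n = (cmod u)\<^sup>2 + (cmod v)\<^sup>2"
    have n: "0 < n" unfolding n_def by (rule norm_pair_pos[OF uv(2)])
    have x: "x1 * n = 2 * Re (u * cnj v)" "x2 * n = 2 * Im (u * cnj v)" "x3 * n = (cmod u)\<^sup>2 - (cmod v)\<^sup>2"
      using uv(1) n by (auto simp: sphere_point_def n_def)
    have "(x1 * n)\<^sup>2 + (x2 * n)\<^sup>2 + (x3 * n)\<^sup>2 = n\<^sup>2"
      unfolding x by (simp add: n_def cmod_power2) algebra
    then have "(x1\<^sup>2 + x2\<^sup>2 + x3\<^sup>2) * n\<^sup>2 = 1 * n\<^sup>2" by (simp add: algebra_simps power_mult_distrib)
    then have "x1\<^sup>2 + x2\<^sup>2 + x3\<^sup>2 = 1" using n by (metis mult_right_cancel power_not_zero less_irrefl)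
    then show ?thesis by simp
  qed
  have c1: "(cmod (Complex x1 x2))\<^sup>2 = 1 - x3\<^sup>2" "(cmod (Complex x1 (- x2)))\<^sup>2 = 1 - x3\<^sup>2"
    using sq by (simp_all add: cmod_power2)
  have c2: "(cmod (of_real r))\<^sup>2 = r\<^sup>2" for r by simp
  show "(x1, x2, x3) = sphere_point (Complex x1 x2) (of_real (1 - x3))" if "x3 \<noteq> 1"
  proof -
    define w where "w = 1 - x3"
    have d: "1 - x3\<^sup>2 + w\<^sup>2 = 2 * w" "1 - x3\<^sup>2 - w\<^sup>2 = 2 * w * x3"
      by (simp_all add: w_def power2_eq_square algebra_simps)
    have "w \<noteq> 0" using that by (simp add: w_def)
    then show ?thesis unfolding sphere_point_def w_def[symmetric] c1 c2 d by simp
  qed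
  show "(x1, x2, x3) = sphere_point (of_real (1 + x3)) (Complex x1 (- x2))" if "x3 \<noteq> -1"
  proof -
    define w where "w = 1 + x3"
    have d: "w\<^sup>2 + (1 - x3\<^sup>2) = 2 * w" "w\<^sup>2 - (1 - x3\<^sup>2) = 2 * w * x3"
      by (simp_all add: w_def power2_eq_square algebra_simps)
    have "w \<noteq> 0" using that by (simp add: w_def add_eq_0_iff)
    then show ?thesis unfolding sphere_point_def w_def[symmetric] c1 c2 d by simp
  qed
qed

text \<open>Continuity may be tested along continuous lifts to homogeneous coordinates, since the
  two sections cover the sphere by open sets.\<close>

lemma continuous_on_riemann_sphere:
  fixes f :: "pt \<Rightarrow> 'b::topological_space"
  assumes "\<And>(S::pt set) u v. continuous_on S u \<Longrightarrow> continuous_on S v \<Longrightarrow>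
      (\<And>x. x \<in> S \<Longrightarrow> u x \<noteq> 0 \<or> v x \<noteq> 0) \<Longrightarrow> continuous_on S (\<lambda>x. f (sphere_point (u x) (v x)))"
  shows "continuous_on riemann_sphere f"
proof -
  define S1 where "S1 = riemann_sphere \<inter> {x. snd (snd x) \<noteq> 1}"
  define S2 where "S2 = riemann_sphere \<inter> {x. snd (snd x) \<noteq> -1}"
  have c1: "continuous_on S1 f"
  proof -
    let ?u = "\<lambda>x::pt. Complex (fst x) (fst (snd x))" and ?v = "\<lambda>x::pt. complex_of_real (1 - snd (snd x))"
    have "continuous_on S1 (\<lambda>x. f (sphere_point (?u x) (?v x)))"
      by (rule assms) (auto simp: S1_def Complex_eq intro!: continuous_intros)
    moreover have "f (sphere_point (?u x) (?v x)) = f x" if "x \<in> S1" for x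
      using that sphere_point_section(1)[of "fst x" "fst (snd x)" "snd (snd x)"] by (simp add: S1_def)
    ultimately show ?thesis by (simp cong: continuous_on_cong)
  qed
  have c2: "continuous_on S2 f"
  proof -
    let ?u = "\<lambda>x::pt. complex_of_real (1 + snd (snd x))" and ?v = "\<lambda>x::pt. Complex (fst x) (- fst (snd x))"
    have "continuous_on S2 (\<lambda>x. f (sphere_point (?u x) (?v x)))"
    proof (rule assms)
      fix x assume "x \<in> S2"
      then have "1 + snd (snd x) \<noteq> 0" by (auto simp: S2_def add_eq_0_iff)
      then show "?u x \<noteq> 0 \<or> ?v x \<noteq> 0" by (metis of_real_eq_0_iff)
    qed (auto simp: Complex_eq intro!: continuous_intros)
    moreover have "f (sphere_point (?u x) (?v x)) = f x" if "x \<in> S2" for x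
      using that sphere_point_section(2)[of "fst x" "fst (snd x)" "snd (snd x)"] by (simp add: S2_def)
    ultimately show ?thesis by (simp cong: continuous_on_cong)
  qed
  have o1: "open {x::pt. snd (snd x) \<noteq> 1}" and o2: "open {x::pt. snd (snd x) \<noteq> -1}"
    by (intro open_Collect_neq continuous_intros)+
  show ?thesis
    unfolding continuous_on_eq_continuous_within
  proof
    fix x assume x: "x \<in> riemann_sphere"
    have *: "continuous (at x within riemann_sphere) f" if "continuous_on (riemann_sphere \<inter> G) f" "open G" "x \<in> G" for G
    proof -
      have "at x within riemann_sphere = at x within (riemann_sphere \<inter> G)"
        by (rule at_within_nhd[OF that(3,2)]) blast
      then show ?thesis using that x by (simp add: continuous_on_eq_continuous_within)
    qed
    show "continuous (at x within riemann_sphere) f"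
    proof (cases "snd (snd x) = 1")
      case True
      then show ?thesis using *[OF c2[unfolded S2_def] o2] by simp
    next
      case False
      then show ?thesis using *[OF c1[unfolded S1_def] o1] by simp
    qed
  qed
qed

text \<open>The disc chart centred at the point with homogeneous coordinates \<open>(u, v)\<close>; the second basis vector
  \<open>(- cnj v, cnj u)\<close> represents the antipode.\<close>

definition disc_chart :: "complex \<Rightarrow> complex \<Rightarrow> complex \<Rightarrow> pt" where
  "disc_chart u v z = sphere_point (u - z * cnj v) (v + z * cnj u)"

text \<open>The two basis vectors of the chart are orthogonal and of equal length.\<close>

lemma norm_disc_chart:
  "(cmod (u - z * cnj v))\<^sup>2 + (cmod (v + z * cnj u))\<^sup>2 = (1 + (cmod z)\<^sup>2) * ((cmod u)\<^sup>2 + (cmod v)\<^sup>2)"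
  by (simp add: cmod_power2) algebra

lemma disc_chart_nonzero:
  assumes "u \<noteq> 0 \<or> v \<noteq> 0"
  shows "u - z * cnj v \<noteq> 0 \<or> v + z * cnj u \<noteq> 0"
proof (rule ccontr)
  assume "\<not> ?thesis"
  then have "(cmod (u - z * cnj v))\<^sup>2 + (cmod (v + z * cnj u))\<^sup>2 = 0" by simp
  then have "(1 + (cmod z)\<^sup>2) * ((cmod u)\<^sup>2 + (cmod v)\<^sup>2) = 0"
    unfolding norm_disc_chart .
  moreover have "0 < (1 + (cmod z)\<^sup>2) * ((cmod u)\<^sup>2 + (cmod v)\<^sup>2)"
    using norm_pair_pos[OF assms] by (intro mult_pos_pos) (auto simp: add_pos_nonneg)
  ultimately show False by linarith
qed

lemma disc_chart_0: "disc_chart u v 0 = sphere_point u v"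
  by (simp add: disc_chart_def)

lemma continuous_on_disc_chart:
  "u \<noteq> 0 \<or> v \<noteq> 0 \<Longrightarrow> continuous_on S (disc_chart u v)"
  unfolding disc_chart_def[abs_def]
  by (intro continuous_on_sphere_point continuous_intros disc_chart_nonzero)

lemma disc_chart_in: "u \<noteq> 0 \<or> v \<noteq> 0 \<Longrightarrow> disc_chart u v z \<in> riemann_sphere"
  unfolding disc_chart_def by (rule sphere_point_in[OF disc_chart_nonzero])

text \<open>The chart coordinate is the quotient of the components of \<open>(a, b)\<close> along
  the two basis vectors; the denominator vanishes only at the antipode.\<close>

lemma sphere_point_eq_disc_chart:
  assumes uv: "u \<noteq> 0 \<or> v \<noteq> 0" and ab: "a * cnj u + b * cnj v \<noteq> 0"
  shows "sphere_point a b = disc_chart u v ((b * u - a * v) / (a * cnj u + b * cnj v))"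
proof -
  let ?s = "a * cnj u + b * cnj v"
  let ?z = "(b * u - a * v) / ?s"
  have ab0: "a \<noteq> 0 \<or> b \<noteq> 0" using ab by auto
  have "a * (v + ?z * cnj u) = b * (u - ?z * cnj v)"
    using ab by (simp add: field_simps)
  then show ?thesis
    unfolding disc_chart_def sphere_point_eq_iff[OF ab0 disc_chart_nonzero[OF uv]] by simp
qed

lemma dist_disc_chart:
  assumes uv: "u \<noteq> 0 \<or> v \<noteq> 0"
  shows "dist (sphere_point u v) (disc_chart u v z) = 2 * cmod z / sqrt (1 + (cmod z)\<^sup>2)"
proof -
  define n where "n = (cmod u)\<^sup>2 + (cmod v)\<^sup>2"
  have n: "0 < n" unfolding n_def by (rule norm_pair_pos[OF uv])
  have "u * (v + z * cnj u) - v * (u - z * cnj v) = z * of_real n"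
    unfolding n_def of_real_add complex_norm_square by (simp add: algebra_simps)
  then have "cmod (u * (v + z * cnj u) - v * (u - z * cnj v)) = cmod z * n"
    using n by (simp add: norm_mult)
  then have "dist (sphere_point u v) (disc_chart u v z) = 2 * (cmod z * n) / (sqrt n * (sqrt (1 + (cmod z)\<^sup>2) * sqrt n))"
    unfolding disc_chart_def dist_sphere_point[OF uv disc_chart_nonzero[OF uv]] norm_disc_chart
    by (simp add: n_def real_sqrt_mult)
  also have "\<dots> = 2 * cmod z / sqrt (1 + (cmod z)\<^sup>2)"
  proof -
    have eq: "sqrt n * (sqrt (1 + (cmod z)\<^sup>2) * sqrt n) = n * sqrt (1 + (cmod z)\<^sup>2)" using n by simp
    show ?thesis unfolding eq using n by simp
  qed
  finally show ?thesis .
qed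

lemma disc_chart_covers_nbhd:
  assumes uv: "u \<noteq> 0 \<or> v \<noteq> 0" and r: "0 < r"
  obtains \<rho> where "0 < \<rho>" "riemann_sphere \<inter> ball (sphere_point u v) \<rho> \<subseteq> disc_chart u v ` ball 0 r"
proof
  \<comment> \<open>The chordal distance from the centre to chart points with modulus
    \<open>r\<close>. Since it is below 2, the ball does not contain the antipode.\<close>
  define \<rho> where "\<rho> = 2 * r / sqrt (1 + r\<^sup>2)"
  show "0 < \<rho>" unfolding \<rho>_def using r by (simp add: add_pos_nonneg)
  show "riemann_sphere \<inter> ball (sphere_point u v) \<rho> \<subseteq> disc_chart u v ` ball 0 r"
  proof
    fix y assume y: "y \<in> riemann_sphere \<inter> ball (sphere_point u v) \<rho>"
    then obtain a b where ab: "y = sphere_point a b" "a \<noteq> 0 \<or> b \<noteq> 0" unfolding riemann_sphere_eq by blast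
    have d: "dist (sphere_point u v) y < \<rho>" using y by simp
    have s: "a * cnj u + b * cnj v \<noteq> 0"
    proof
      assume z: "a * cnj u + b * cnj v = 0"
      have "(cmod (a * cnj u + b * cnj v))\<^sup>2 + (cmod (u * b - v * a))\<^sup>2 = ((cmod u)\<^sup>2 + (cmod v)\<^sup>2) * ((cmod a)\<^sup>2 + (cmod b)\<^sup>2)"
        by (simp add: cmod_power2) algebra
      then have "(cmod (u * b - v * a))\<^sup>2 = ((cmod u)\<^sup>2 + (cmod v)\<^sup>2) * ((cmod a)\<^sup>2 + (cmod b)\<^sup>2)" using z by simp
      then have "cmod (u * b - v * a) = sqrt ((cmod u)\<^sup>2 + (cmod v)\<^sup>2) * sqrt ((cmod a)\<^sup>2 + (cmod b)\<^sup>2)"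
        by (metis norm_ge_zero real_sqrt_abs2 real_sqrt_mult real_sqrt_unique)
      then have "dist (sphere_point u v) y = 2"
        unfolding ab(1) dist_sphere_point[OF uv ab(2)] using uv ab(2) by auto
      moreover have "\<rho> < 2"
      proof -
        have "r < sqrt (1 + r\<^sup>2)" by (rule real_less_rsqrt) simp
        moreover have "0 < sqrt (1 + r\<^sup>2)" by (simp add: add_pos_nonneg)
        ultimately show ?thesis unfolding \<rho>_def by (simp add: pos_divide_less_eq)
      qed
      ultimately show False using d by simp
    qed
    define z where "z = (b * u - a * v) / (a * cnj u + b * cnj v)"
    have yz: "y = disc_chart u v z" unfolding ab(1) z_def by (rule sphere_point_eq_disc_chart[OF uv s])
    have "cmod z < r"
    proof (rule ccontr)
      assume "\<not> cmod z < r"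
      then have "r\<^sup>2 \<le> (cmod z)\<^sup>2" using r by (simp add: power_mono)
      have pos: "0 < sqrt (1 + r\<^sup>2)" "0 < sqrt (1 + (cmod z)\<^sup>2)" by (simp_all add: add_pos_nonneg)
      have "(r * sqrt (1 + (cmod z)\<^sup>2))\<^sup>2 \<le> (cmod z * sqrt (1 + r\<^sup>2))\<^sup>2"
        using \<open>r\<^sup>2 \<le> (cmod z)\<^sup>2\<close> by (simp add: power_mult_distrib algebra_simps)
      then have "r * sqrt (1 + (cmod z)\<^sup>2) \<le> cmod z * sqrt (1 + r\<^sup>2)"
        by (rule power2_le_imp_le) (use pos in auto)
      then have "\<rho> \<le> 2 * cmod z / sqrt (1 + (cmod z)\<^sup>2)"
        unfolding \<rho>_def using pos by (simp add: field_simps)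
      then show False using d unfolding yz dist_disc_chart[OF uv] by simp
    qed
    then show "y \<in> disc_chart u v ` ball 0 r" using yz by auto
  qed
qed

section \<open>Rational maps in homogeneous coordinates\<close>

text \<open>The binary form of degree \<open>d\<close> attached to \<open>p\<close>. The degree is a
  parameter because numerator and denominator must be homogenized to the same degree, even if one of
  them has smaller degree.\<close>

definition homogenize :: "nat \<Rightarrow> complex poly \<Rightarrow> complex \<Rightarrow> complex \<Rightarrow> complex" where
  "homogenize d p u v = (\<Sum>i\<le>d. coeff p i * u ^ i * v ^ (d - i))"

lemma homogenize_nonzero:
  assumes "degree p \<le> d" "v \<noteq> 0"
  shows "homogenize d p u v = v ^ d * poly p (u / v)"
proof -
  have "poly p (u / v) = (\<Sum>i\<le>d. coeff p i * (u / v) ^ i)"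
    unfolding poly_altdef using assms(1) by (intro sum.mono_neutral_left) (auto simp: coeff_eq_0)
  then have "v ^ d * poly p (u / v) = (\<Sum>i\<le>d. v ^ d * (coeff p i * (u / v) ^ i))" by (simp add: sum_distrib_left)
  also have "\<dots> = homogenize d p u v"
    unfolding homogenize_def using assms(2) by (intro sum.cong) (auto simp: power_divide power_diff)
  finally show ?thesis by simp
qed

lemma homogenize_zero: "homogenize d p u 0 = coeff p d * u ^ d"
proof -
  have "homogenize d p u 0 = (\<Sum>i\<le>d. if i = d then coeff p i * u ^ i else 0)"
    unfolding homogenize_def by (intro sum.cong) auto
  then show ?thesis by simp
qed

lemma homogenize_combination:
  "b * homogenize d p u v - a * homogenize d q u v = homogenize d (smult b p - smult a q) u v"
  by (simp add: homogenize_def sum_distrib_left sum_subtractf[symmetric] algebra_simps)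

lemma continuous_on_homogenize [continuous_intros]:
  "continuous_on S u \<Longrightarrow> continuous_on S v \<Longrightarrow> continuous_on S (\<lambda>x. homogenize d p (u x) (v x))"
  unfolding homogenize_def by (intro continuous_intros)

lemma holomorphic_on_homogenize [holomorphic_intros]:
  "u holomorphic_on S \<Longrightarrow> v holomorphic_on S \<Longrightarrow> (\<lambda>x. homogenize d p (u x) (v x)) holomorphic_on S"
  unfolding homogenize_def by (intro holomorphic_intros)

lemma disc_chart_inj:
  assumes uv: "u \<noteq> 0 \<or> v \<noteq> 0"
  shows "inj (disc_chart u v)"
proof (rule injI)
  fix z z' assume "disc_chart u v z = disc_chart u v z'"
  then have "(u - z * cnj v) * (v + z' * cnj u) = (v + z * cnj u) * (u - z' * cnj v)"
    unfolding disc_chart_def sphere_point_eq_iff[OF disc_chart_nonzero[OF uv] disc_chart_nonzero[OF uv]] .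
  then have "(z' - z) * (u * cnj u + v * cnj v) = 0" by (simp add: algebra_simps)
  moreover have "u * cnj u + v * cnj v \<noteq> 0"
  proof -
    have "u * cnj u + v * cnj v = of_real ((cmod u)\<^sup>2 + (cmod v)\<^sup>2)"
      unfolding of_real_add complex_norm_square ..
    then show ?thesis using norm_pair_pos[OF uv] by (metis less_irrefl of_real_eq_0_iff)
  qed
  ultimately show "z = z'" by simp
qed

locale rational_map =
  fixes p q :: "complex poly"
  assumes coprime: "coprime p q" and degree_ge_2: "2 \<le> rat_degree p q"
begin

abbreviation "deg \<equiv> rat_degree p q"
abbreviation "f \<equiv> sphere_map p q"
abbreviation "P \<equiv> homogenize deg p"
abbreviation "Q \<equiv> homogenize deg q"

lemma degree_le: "degree p \<le> deg" "degree q \<le> deg" by (auto simp: rat_degree_def)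

lemma top_coeff: "coeff p deg \<noteq> 0 \<or> coeff q deg \<noteq> 0"
proof -
  have "degree p = deg \<or> degree q = deg" by (auto simp: rat_degree_def max_def)
  then show ?thesis using degree_ge_2 by (metis leading_coeff_0_iff degree_0 not_numeral_le_zero)
qed

lemma lift_nonzero:
  assumes "u \<noteq> 0 \<or> v \<noteq> 0"
  shows "P u v \<noteq> 0 \<or> Q u v \<noteq> 0"
proof (cases "v = 0")
  case True
  then show ?thesis using assms top_coeff by (auto simp: homogenize_zero)
next
  case False
  then show ?thesis using coprime_poly_0[OF coprime, of "u / v"] by (auto simp: homogenize_nonzero[OF degree_le(1)] homogenize_nonzero[OF degree_le(2)])
qed

lemma sphere_map_sphere_point:
  assumes uv: "u \<noteq> 0 \<or> v \<noteq> 0"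
  shows "f (sphere_point u v) = sphere_point (P u v) (Q u v)"
proof -
  have inv: "inv stereo_inv (stereo_inv w) = w" for w by (rule inv_f_f[OF inj_stereo_inv])
  show ?thesis
  proof (cases "v = 0")
    case False
    have eq: "P u v = v ^ deg * poly p (u / v)" "Q u v = v ^ deg * poly q (u / v)"
      by (intro homogenize_nonzero degree_le False)+
    show ?thesis
    proof (cases "poly q (u / v) = 0")
      case True
      then have "poly p (u / v) \<noteq> 0" using coprime_poly_0[OF coprime] by blast
      then have "P u v \<noteq> 0" "Q u v = 0" unfolding eq using True False by simp_all
      then show ?thesis
        using True by (simp add: sphere_map_def sphere_point_quotient[OF False] inv rat_map_def sphere_point_None)
    next
      case q: False
      then have "Q u v \<noteq> 0" "P u v / Q u v = poly p (u / v) / poly q (u / v)" unfolding eq using False by simp_all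
      then show ?thesis
        using q by (simp add: sphere_map_def sphere_point_quotient[OF False] inv rat_map_def sphere_point_quotient)
    qed
  next
    case True
    then have u: "u \<noteq> 0" using uv by simp
    have eq: "P u v = coeff p deg * u ^ deg" "Q u v = coeff q deg * u ^ deg" unfolding True by (rule homogenize_zero)+
    have lhs: "f (sphere_point u v) = stereo_inv (rat_map p q None)"
      unfolding True sphere_point_None[OF u] sphere_map_def inv ..
    consider "degree p > degree q" | "degree p = degree q" | "degree p < degree q" by linarith
    then show ?thesis
    proof cases
      case 1
      then have "deg = degree p" by (simp add: rat_degree_def)
      then have "coeff q deg = 0" "coeff p deg \<noteq> 0" using 1 top_coeff by (auto simp: coeff_eq_0)
      then have "P u v \<noteq> 0" "Q u v = 0" unfolding eq using u by simp_all
      then show ?thesis using 1 by (simp add: lhs rat_map_def sphere_point_None)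
    next
      case 2
      then have d: "deg = degree p" "deg = degree q" by (simp_all add: rat_degree_def)
      then have "coeff q deg \<noteq> 0" using degree_ge_2 by (metis leading_coeff_0_iff degree_0 not_numeral_le_zero)
      then have "Q u v \<noteq> 0" "P u v / Q u v = coeff p (degree p) / coeff q (degree q)" unfolding eq using u d by simp_all
      then show ?thesis using 2 by (simp add: lhs rat_map_def sphere_point_quotient)
    next
      case 3
      then have "deg = degree q" by (simp add: rat_degree_def)
      then have "coeff p deg = 0" "coeff q deg \<noteq> 0" using 3 top_coeff by (auto simp: coeff_eq_0)
      then have "Q u v \<noteq> 0" "P u v = 0" unfolding eq using u by simp_all
      then show ?thesis using 3 by (simp add: lhs rat_map_def sphere_point_quotient)
    qed
  qed
qed

lemma combination_nonzero:
  assumes "a \<noteq> 0 \<or> b \<noteq> 0"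
  shows "smult b p - smult a q \<noteq> 0"
proof
  assume "smult b p - smult a q = 0"
  then have eq: "smult b p = smult a q" by simp
  have unit0: "degree r = 0" if "r dvd p" "r dvd q" for r
  proof -
    have "is_unit r" using coprime that by (rule coprime_common_divisor)
    then show ?thesis by (metis is_unit_polyE degree_pCons_0)
  qed
  show False
  proof (cases "b = 0")
    case True
    then have "q = 0" using eq assms by simp
    then have "degree p = 0" using unit0[of p] by simp
    then show False using \<open>q = 0\<close> degree_ge_2 by (simp add: rat_degree_def)
  next
    case False
    then have "p = smult (a / b) q"
      using arg_cong[OF eq, of "smult (1 / b)"] by simp
    then have "q dvd p" "degree p \<le> degree q" by (metis dvd_smult dvd_refl, metis degree_smult_le)
    then have "degree q = 0" "degree p = 0" using unit0[of q] by auto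
    then show False using degree_ge_2 by (simp add: rat_degree_def)
  qed
qed

lemma fibre_iff:
  assumes ab: "a \<noteq> 0 \<or> b \<noteq> 0" and uv: "u \<noteq> 0 \<or> v \<noteq> 0"
  shows "f (sphere_point u v) = sphere_point a b \<longleftrightarrow> homogenize deg (smult b p - smult a q) u v = 0"
  unfolding sphere_map_sphere_point[OF uv] sphere_point_eq_iff[OF lift_nonzero[OF uv] ab] homogenize_combination[symmetric]
  by (auto simp: mult.commute)

lemma degree_combination_le: "degree (smult b p - smult a q) \<le> deg"
  using degree_le by (meson degree_diff_le degree_smult_le order_trans)

lemma fibre_eq:
  assumes ab: "a \<noteq> 0 \<or> b \<noteq> 0"
  defines "w \<equiv> smult b p - smult a q"
  shows "{x\<in>riemann_sphere. f x = sphere_point a b} =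
    stereo_inv ` (Some ` {z. poly w z = 0} \<union> (if coeff w deg = 0 then {None} else {}))"
proof -
  have S: "f (stereo_inv (Some z)) = sphere_point a b \<longleftrightarrow> poly w z = 0" for z
    using fibre_iff[OF ab, of z 1] homogenize_nonzero[OF degree_combination_le, of 1] by (simp add: sphere_point_Some w_def)
  have N: "f (stereo_inv None) = sphere_point a b \<longleftrightarrow> coeff w deg = 0"
    using fibre_iff[OF ab, of 1 0] by (simp add: sphere_point_None homogenize_zero w_def)
  show ?thesis
  proof (intro equalityI subsetI)
    fix x assume x: "x \<in> {x\<in>riemann_sphere. f x = sphere_point a b}"
    then obtain o' where o': "x = stereo_inv o'" by (auto simp: riemann_sphere_def)
    show "x \<in> stereo_inv ` (Some ` {z. poly w z = 0} \<union> (if coeff w deg = 0 then {None} else {}))"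
      using x S N unfolding o' by (cases o') auto
  next
    fix x assume "x \<in> stereo_inv ` (Some ` {z. poly w z = 0} \<union> (if coeff w deg = 0 then {None} else {}))"
    then show "x \<in> {x\<in>riemann_sphere. f x = sphere_point a b}"
      using S N by (auto simp: riemann_sphere_def split: if_splits)
  qed
qed

text \<open>Infinity belongs to the fibre exactly when the coefficient of index \<open>deg\<close>
  in \<open>w\<close> vanishes, and then \<open>w\<close> has smaller degree, so the bound by
  \<open>deg\<close> persists. In the other case \<open>w\<close> has positive degree and a finite
  root exists.\<close>

lemma fibre_finite:
  assumes y: "y \<in> riemann_sphere"
  shows "finite {x\<in>riemann_sphere. f x = y}" "card {x\<in>riemann_sphere. f x = y} \<le> deg"
    "{x\<in>riemann_sphere. f x = y} \<noteq> {}"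
proof -
  obtain a b where ab: "y = sphere_point a b" "a \<noteq> 0 \<or> b \<noteq> 0" using y unfolding riemann_sphere_eq by blast
  define w where "w = smult b p - smult a q"
  have w: "w \<noteq> 0" "degree w \<le> deg" unfolding w_def by (rule combination_nonzero[OF ab(2)], rule degree_combination_le)
  let ?R = "{z. poly w z = 0}" and ?T = "if coeff w deg = 0 then {None :: complex option} else {}"
  have eq: "{x\<in>riemann_sphere. f x = y} = stereo_inv ` (Some ` ?R \<union> ?T)"
    unfolding ab(1) w_def by (rule fibre_eq[OF ab(2)])
  have fin: "finite ?R" using poly_roots_finite[OF w(1)] .
  show "finite {x\<in>riemann_sphere. f x = y}" unfolding eq using fin by auto
  have "card ?R + card ?T \<le> deg"
  proof (cases "coeff w deg = 0")
    case True
    then have "degree w \<noteq> deg" using w(1) by (metis leading_coeff_0_iff)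
    then show ?thesis using True card_poly_roots_bound[OF w(1)] w(2) by simp
  next
    case False
    then show ?thesis using card_poly_roots_bound[OF w(1)] w(2) by simp
  qed
  moreover have "card (stereo_inv ` (Some ` ?R \<union> ?T)) \<le> card (Some ` ?R \<union> ?T)"
    using fin by (intro card_image_le) auto
  moreover have "card (Some ` ?R \<union> ?T) \<le> card (Some ` ?R) + card ?T" by (rule card_Un_le)
  moreover have "card (Some ` ?R) = card ?R" by (intro card_image) auto
  ultimately show "card {x\<in>riemann_sphere. f x = y} \<le> deg" unfolding eq by linarith
  show "{x\<in>riemann_sphere. f x = y} \<noteq> {}"
  proof (cases "coeff w deg = 0")
    case False
    then have "degree w = deg" using w(2) by (metis le_antisym le_degree)
    then have "\<nexists>a l. a \<noteq> 0 \<and> l = 0 \<and> w = pCons a l" using degree_ge_2 by auto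
    then have "?R \<noteq> {}" using fundamental_theorem_of_algebra_alt[of w] by blast
    then show ?thesis unfolding eq by blast
  qed (simp add: eq)
qed

lemma f_in: "x \<in> riemann_sphere \<Longrightarrow> f x \<in> riemann_sphere"
  unfolding riemann_sphere_eq using sphere_map_sphere_point lift_nonzero by blast

lemma continuous_on_f: "continuous_on riemann_sphere f"
proof (rule continuous_on_riemann_sphere)
  fix S :: "pt set" and u v :: "pt \<Rightarrow> complex"
  assume uv: "continuous_on S u" "continuous_on S v" "\<And>x. x \<in> S \<Longrightarrow> u x \<noteq> 0 \<or> v x \<noteq> 0"
  have "continuous_on S (\<lambda>x. sphere_point (P (u x) (v x)) (Q (u x) (v x)))"
    by (intro continuous_on_sphere_point continuous_intros uv lift_nonzero)
  then show "continuous_on S (\<lambda>x. f (sphere_point (u x) (v x)))"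
    using sphere_map_sphere_point[OF uv(3)] by (simp cong: continuous_on_cong)
qed

text \<open>In disc charts centred at \<open>x\<close> and at \<open>f x\<close> the map becomes a
  holomorphic function \<open>\<theta>\<close> fixing 0; non-vanishing of \<open>s\<close> keeps the
  values away from the antipode of \<open>f x\<close>. Finite fibres make \<open>\<theta>\<close>
  non-constant, and the open mapping theorem applies.\<close>

lemma f_open:
  assumes U: "openin (top_of_set riemann_sphere) U"
  shows "openin (top_of_set riemann_sphere) (f ` U)"
  unfolding openin_contains_ball
proof (intro conjI ballI)
  have US: "U \<subseteq> riemann_sphere" by (rule openin_imp_subset[OF U])
  then show "f ` U \<subseteq> riemann_sphere" using f_in by blast
  fix y assume "y \<in> f ` U"
  then obtain x where x: "x \<in> U" "y = f x" by blast
  obtain u v where uv: "x = sphere_point u v" "u \<noteq> 0 \<or> v \<noteq> 0" using x US unfolding riemann_sphere_eq by blast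
  define a where "a = P u v"
  define b where "b = Q u v"
  have ab: "a \<noteq> 0 \<or> b \<noteq> 0" unfolding a_def b_def by (rule lift_nonzero[OF uv(2)])
  have yab: "y = sphere_point a b" unfolding x(2) uv(1) a_def b_def by (rule sphere_map_sphere_point[OF uv(2)])
  define A where "A z = P (u - z * cnj v) (v + z * cnj u)" for z
  define B where "B z = Q (u - z * cnj v) (v + z * cnj u)" for z
  define s where "s z = A z * cnj a + B z * cnj b" for z
  have A: "A holomorphic_on T" and B: "B holomorphic_on T" for T
    unfolding A_def[abs_def] B_def[abs_def] by (intro holomorphic_intros)+
  have s: "s holomorphic_on T" for T unfolding s_def[abs_def] by (intro holomorphic_intros A B)
  obtain G where G: "open G" "U = riemann_sphere \<inter> G" using U by (auto simp: openin_open)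
  have "open (disc_chart u v -` G)"
    by (rule open_vimage[OF G(1) continuous_on_disc_chart[OF uv(2)]])
  moreover have "open (s -` (- {0}))"
    by (rule open_vimage[OF _ holomorphic_on_imp_continuous_on[OF s]]) auto
  ultimately have "open (disc_chart u v -` G \<inter> s -` (- {0}))" by (rule open_Int)
  moreover have "0 \<in> disc_chart u v -` G \<inter> s -` (- {0})"
  proof -
    have "s 0 = of_real ((cmod a)\<^sup>2 + (cmod b)\<^sup>2)"
      unfolding of_real_add complex_norm_square by (simp add: s_def A_def B_def a_def b_def)
    then have "s 0 \<noteq> 0" using norm_pair_pos[OF ab] by (metis less_irrefl of_real_eq_0_iff)
    then show ?thesis using x(1) G(2) uv(1) by (simp add: disc_chart_0)
  qed
  ultimately obtain r where r: "0 < r" "ball 0 r \<subseteq> disc_chart u v -` G \<inter> s -` (- {0})"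
    using open_contains_ball by blast
  have sn: "s z \<noteq> 0" if "z \<in> ball 0 r" for z using r(2) that by auto
  have chartU: "disc_chart u v z \<in> U" if "z \<in> ball 0 r" for z
    using r(2) that G(2) disc_chart_in[OF uv(2)] by auto
  define \<theta> where "\<theta> z = (B z * a - A z * b) / s z" for z
  have \<theta>: "\<theta> holomorphic_on ball 0 r" unfolding \<theta>_def[abs_def] by (intro holomorphic_intros A B s sn)
  have fchart: "f (disc_chart u v z) = sphere_point (A z) (B z)" for z
    unfolding disc_chart_def A_def B_def by (rule sphere_map_sphere_point[OF disc_chart_nonzero[OF uv(2)]])
  have fchart': "f (disc_chart u v z) = disc_chart a b (\<theta> z)" if "z \<in> ball 0 r" for z
    unfolding fchart \<theta>_def s_def by (rule sphere_point_eq_disc_chart[OF ab]) (use sn[OF that] in \<open>simp add: s_def\<close>)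
  have \<theta>0: "\<theta> 0 = 0" by (simp add: \<theta>_def A_def B_def a_def b_def)
  have "\<not> \<theta> constant_on ball 0 r"
  proof
    assume "\<theta> constant_on ball 0 r"
    then obtain c where "\<And>z. z \<in> ball 0 r \<Longrightarrow> \<theta> z = c" unfolding constant_on_def by blast
    then have "\<theta> z = 0" if "z \<in> ball 0 r" for z using that \<theta>0 r(1) by (metis centre_in_ball)
    then have "f (disc_chart u v z) = y" if "z \<in> ball 0 r" for z
      using fchart'[OF that] that by (simp add: disc_chart_0 yab)
    then have "disc_chart u v ` ball 0 r \<subseteq> {x\<in>riemann_sphere. f x = y}"
      using disc_chart_in[OF uv(2)] by blast
    moreover have "y \<in> riemann_sphere" using x US f_in by blast
    ultimately have "finite (disc_chart u v ` ball 0 r)" using fibre_finite(1) finite_subset by blast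
    then have "finite (ball (0::complex) r)"
      using finite_imageD[OF _ inj_on_subset[OF disc_chart_inj[OF uv(2)] subset_UNIV]] by blast
    then show False using uncountable_ball[OF r(1), of "0::complex"] countable_finite by blast
  qed
  then have "open (\<theta> ` ball 0 r)"
    by (intro open_mapping_thm[OF \<theta>]) auto
  moreover have "0 \<in> \<theta> ` ball 0 r" using \<theta>0 r(1) by (metis centre_in_ball imageI)
  ultimately obtain r' where r': "0 < r'" "ball 0 r' \<subseteq> \<theta> ` ball 0 r" using open_contains_ball by blast
  obtain \<rho> where \<rho>: "0 < \<rho>" "riemann_sphere \<inter> ball (sphere_point a b) \<rho> \<subseteq> disc_chart a b ` ball 0 r'"
    using disc_chart_covers_nbhd[OF ab r'(1)] by blast
  have "ball y \<rho> \<inter> riemann_sphere \<subseteq> f ` U"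
  proof
    fix w assume "w \<in> ball y \<rho> \<inter> riemann_sphere"
    then have "w \<in> disc_chart a b ` ball 0 r'" using \<rho>(2) yab by blast
    then obtain t where t: "t \<in> ball 0 r'" "w = disc_chart a b t" by blast
    then obtain z where z: "z \<in> ball 0 r" "t = \<theta> z" using r'(2) by blast
    then have "w = f (disc_chart u v z)" using t(2) fchart' by simp
    then show "w \<in> f ` U" using chartU[OF z(1)] by blast
  qed
  then show "\<exists>e>0. ball y e \<inter> riemann_sphere \<subseteq> f ` U" using \<rho>(1) by blast
qed

lemma finite_open_self_map_f: "finite_open_self_map riemann_sphere deg f"
  unfolding finite_open_self_map_def
proof (intro conjI allI impI ballI)
  show "f ` riemann_sphere = riemann_sphere"
    using f_in fibre_finite(3) by blast
qed (use continuous_on_f f_open fibre_finite in auto)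

end

section \<open>The Julia set is completely invariant\<close>

lemma finite_open_self_map_restrict:
  assumes f: "finite_open_self_map S d f" and J: "J \<subseteq> S" and inv: "\<And>x. x \<in> S \<Longrightarrow> f x \<in> J \<longleftrightarrow> x \<in> J"
  shows "finite_open_self_map J d f"
  unfolding finite_open_self_map_def
proof (intro conjI allI impI ballI)
  show "continuous_on J f" by (rule continuous_on_subset[OF finite_open_self_mapD(1)[OF f] J])
  show "f ` J = J"
  proof
    show "f ` J \<subseteq> J" using inv J by blast
    show "J \<subseteq> f ` J"
    proof
      fix y assume y: "y \<in> J"
      then have "y \<in> f ` S" using finite_open_self_mapD(2)[OF f] J by blast
      then obtain x where "x \<in> S" "y = f x" by blast
      then show "y \<in> f ` J" using inv y by blast
    qed
  qed
  show "openin (top_of_set J) (f ` U)" if "openin (top_of_set J) U" for U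
  proof -
    obtain G where G: "open G" "U = J \<inter> G" using \<open>openin (top_of_set J) U\<close> by (auto simp: openin_open)
    have "openin (top_of_set S) (f ` (S \<inter> G))"
      by (intro finite_open_self_mapD(3)[OF f] openin_open_Int G)
    then obtain H where H: "open H" "f ` (S \<inter> G) = S \<inter> H" by (auto simp: openin_open)
    have "f ` U = J \<inter> f ` (S \<inter> G)" unfolding G(2) using inv J by blast
    then have "f ` U = J \<inter> H" using H(2) J by blast
    then show ?thesis using H(1) by (simp add: openin_open_Int)
  qed
  fix y assume y: "y \<in> J"
  have "{x\<in>J. f x = y} \<subseteq> {x\<in>S. f x = y}" using J by blast
  then show "finite {x\<in>J. f x = y}" "card {x\<in>J. f x = y} \<le> d"
    using finite_open_self_mapD(4,5)[OF f subsetD[OF J y]] by (auto intro: finite_subset card_mono order_trans)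
qed

text \<open>Normality is demanded for every index sequence, not only for increasing ones. If some
  value recurs infinitely often, one fixed iterate can be selected; otherwise the indices tend to
  infinity.\<close>

lemma nat_sequence_constant_or_unbounded:
  fixes n :: "nat \<Rightarrow> nat"
  obtains r v where "strict_mono (r :: nat \<Rightarrow> nat)" "\<And>k. n (r k) = v" | "filterlim n at_top sequentially"
proof (cases "\<exists>v. infinite {k. n k = v}")
  case True
  then obtain v where v: "infinite {k. n k = v}" by blast
  obtain r :: "nat \<Rightarrow> nat" where "strict_mono r" "\<And>k. r k \<in> {k. n k = v}"
    using infinite_enumerate[OF v] by blast
  then show thesis using that(1)[of r v] by blast
next
  case False
  have "eventually (\<lambda>k. M \<le> n k) sequentially" for M
  proof -
    have "{k. \<not> M \<le> n k} = (\<Union>v<M. {k. n k = v})" by auto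
    then have "finite {k. \<not> M \<le> n k}" using False by simp
    then show ?thesis unfolding cofinite_eq_sequentially[symmetric] eventually_cofinite .
  qed
  then show thesis using that(2) by (simp add: filterlim_at_top)
qed

context rational_map
begin

lemma funpow_in: "x \<in> riemann_sphere \<Longrightarrow> (f ^^ n) x \<in> riemann_sphere"
  by (induction n) (auto intro: f_in)

lemma fatou_if_image_fatou:
  assumes x: "x \<in> riemann_sphere" and fx: "f x \<in> fatou_set f"
  shows "x \<in> fatou_set f"
proof -
  obtain U where U: "openin (top_of_set riemann_sphere) U" "f x \<in> U" "normal_iterates_on f U"
    using fx unfolding fatou_set_def by blast
  have pre: "openin (top_of_set riemann_sphere) (riemann_sphere \<inter> f -` V)" if "openin (top_of_set riemann_sphere) V" for V
    using continuous_openin_preimage[OF continuous_on_f _ that] f_in by auto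
  define U' where "U' = riemann_sphere \<inter> f -` U"
  have "normal_iterates_on f U'"
    unfolding normal_iterates_on_def
  proof
    fix n :: "nat \<Rightarrow> nat"
    show "\<exists>r g. strict_mono r \<and> (\<forall>x\<in>U'. \<exists>V. openin (top_of_set riemann_sphere) V \<and> x \<in> V \<and> V \<subseteq> U' \<and>
             uniform_limit V (\<lambda>k. f ^^ n (r k)) g sequentially)"
    \<comment> \<open>Pulling back costs one iterate, so indices equal to 0 are treated separately:
      there the iterate is the identity. If they occur only finitely often, the truncated difference
      \<open>n k - 1\<close> is a true predecessor from some index on.\<close>
    proof (cases "infinite {k. n k = 0}")
      case True
      then obtain r :: "nat \<Rightarrow> nat" where r: "strict_mono r" "\<And>k. r k \<in> {k. n k = 0}"
        using infinite_enumerate by blast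
      then have "n (r k) = 0" for k by auto
      then have "uniform_limit U' (\<lambda>k. f ^^ n (r k)) (\<lambda>x. x) sequentially"
        by (simp add: uniform_limit_iff)
      moreover have "openin (top_of_set riemann_sphere) U'" unfolding U'_def by (rule pre[OF U(1)])
      ultimately show ?thesis using r(1) by blast
    next
      case False
      then have ev: "eventually (\<lambda>k. n k \<noteq> 0) sequentially"
        unfolding cofinite_eq_sequentially[symmetric] eventually_cofinite by simp
      obtain r g where r: "strict_mono r" and g: "\<forall>x\<in>U. \<exists>V. openin (top_of_set riemann_sphere) V \<and> x \<in> V \<and> V \<subseteq> U \<and>
             uniform_limit V (\<lambda>k. f ^^ (n (r k) - 1)) g sequentially"
        using spec[OF U(3)[unfolded normal_iterates_on_def], of "\<lambda>k. n k - 1"] by blast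
      have ev_r: "eventually (\<lambda>k. n (r k) \<noteq> 0) sequentially"
        using eventually_subseq[OF r ev] .
      have "\<exists>V. openin (top_of_set riemann_sphere) V \<and> x \<in> V \<and> V \<subseteq> U' \<and>
             uniform_limit V (\<lambda>k. f ^^ n (r k)) (\<lambda>x. g (f x)) sequentially" if "x \<in> U'" for x
      proof -
        have "f x \<in> U" "x \<in> riemann_sphere" using that by (auto simp: U'_def)
        then obtain V where V: "openin (top_of_set riemann_sphere) V" "f x \<in> V" "V \<subseteq> U"
          "uniform_limit V (\<lambda>k. f ^^ (n (r k) - 1)) g sequentially" using g by blast
        define V' where "V' = riemann_sphere \<inter> f -` V"
        have "uniform_limit V' (\<lambda>k. f ^^ n (r k)) (\<lambda>x. g (f x)) sequentially"
          unfolding uniform_limit_iff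
        proof (intro allI impI)
          fix e :: real assume "0 < e"
          then have "eventually (\<lambda>k. \<forall>y\<in>V. dist ((f ^^ (n (r k) - 1)) y) (g y) < e) sequentially"
            using V(4) unfolding uniform_limit_iff by blast
          with ev_r show "eventually (\<lambda>k. \<forall>x\<in>V'. dist ((f ^^ n (r k)) x) (g (f x)) < e) sequentially"
          proof eventually_elim
            case (elim k)
            then obtain j where j: "n (r k) = Suc j" by (metis not0_implies_Suc)
            show ?case using elim(2) unfolding j by (auto simp: V'_def funpow_swap1)
          qed
        qed
        moreover have "openin (top_of_set riemann_sphere) V'" unfolding V'_def by (rule pre[OF V(1)])
        moreover have "x \<in> V'" "V' \<subseteq> U'" using V \<open>x \<in> riemann_sphere\<close> by (auto simp: V'_def U'_def)
        ultimately show ?thesis by blast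
      qed
      then show ?thesis using r by blast
    qed
  qed
  moreover have "openin (top_of_set riemann_sphere) U'" unfolding U'_def by (rule pre[OF U(1)])
  moreover have "x \<in> U'" using x U(2) by (simp add: U'_def)
  ultimately show ?thesis unfolding fatou_set_def using x by blast
qed

lemma image_fatou:
  assumes x: "x \<in> fatou_set f"
  shows "f x \<in> fatou_set f"
proof -
  obtain U where U: "openin (top_of_set riemann_sphere) U" "x \<in> U" "normal_iterates_on f U"
    using x unfolding fatou_set_def by blast
  have US: "U \<subseteq> riemann_sphere" by (rule openin_imp_subset[OF U(1)])
  have "normal_iterates_on f (f ` U)"
    unfolding normal_iterates_on_def
  proof
    fix n :: "nat \<Rightarrow> nat"
    obtain r g where r: "strict_mono r" and g: "\<And>x. x \<in> U \<Longrightarrow> \<exists>V. openin (top_of_set riemann_sphere) V \<and> x \<in> V \<and> V \<subseteq> U \<and>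
             uniform_limit V (\<lambda>k. f ^^ Suc (n (r k))) g sequentially"
      using spec[OF U(3)[unfolded normal_iterates_on_def], of "\<lambda>k. Suc (n k)"] by blast
    have lim: "(\<lambda>k. (f ^^ n (r k)) (f x)) \<longlonglongrightarrow> g x" if x: "x \<in> U" for x
    proof -
      obtain V where "x \<in> V" "uniform_limit V (\<lambda>k. f ^^ Suc (n (r k))) g sequentially" using g[OF x] by blast
      then have "(\<lambda>k. (f ^^ Suc (n (r k))) x) \<longlonglongrightarrow> g x" by (intro tendsto_uniform_limitI)
      then show ?thesis by (simp add: funpow_swap1)
    qed
    \<comment> \<open>The limit is constant on the fibres of \<open>f\<close> by uniqueness of
      pointwise limits, so the arbitrary choice of a preimage does not matter.\<close>
    define g' where "g' y = g (SOME x. x \<in> U \<and> f x = y)" for y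
    have g': "g' (f v) = g v" if v: "v \<in> U" for v
    proof -
      have "\<exists>x. x \<in> U \<and> f x = f v" using v by blast
      then have s: "(SOME x. x \<in> U \<and> f x = f v) \<in> U \<and> f (SOME x. x \<in> U \<and> f x = f v) = f v" by (rule someI_ex)
      then have "(\<lambda>k. (f ^^ n (r k)) (f v)) \<longlonglongrightarrow> g' (f v)"
        using lim[of "SOME x. x \<in> U \<and> f x = f v"] unfolding g'_def by simp
      then show ?thesis using lim[OF v] LIMSEQ_unique by blast
    qed
    have "\<exists>V. openin (top_of_set riemann_sphere) V \<and> y \<in> V \<and> V \<subseteq> f ` U \<and>
             uniform_limit V (\<lambda>k. f ^^ n (r k)) g' sequentially" if yU: "y \<in> f ` U" for y
    proof -
      obtain x where x: "x \<in> U" "y = f x" using yU by blast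
      obtain V where V: "openin (top_of_set riemann_sphere) V" "x \<in> V" "V \<subseteq> U"
        "uniform_limit V (\<lambda>k. f ^^ Suc (n (r k))) g sequentially" using g[OF x(1)] by blast
      have "uniform_limit (f ` V) (\<lambda>k. f ^^ n (r k)) g' sequentially"
        unfolding uniform_limit_iff
      proof (intro allI impI)
        fix e :: real assume "0 < e"
        then have "eventually (\<lambda>k. \<forall>v\<in>V. dist ((f ^^ Suc (n (r k))) v) (g v) < e) sequentially"
          using V(4) unfolding uniform_limit_iff by blast
        then show "eventually (\<lambda>k. \<forall>y\<in>f ` V. dist ((f ^^ n (r k)) y) (g' y) < e) sequentially"
        proof eventually_elim
          case (elim k)
          show ?case
          proof
            fix y assume "y \<in> f ` V"
            then obtain v where v: "v \<in> V" "y = f v" by blast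
            then show "dist ((f ^^ n (r k)) y) (g' y) < e"
              using elim g'[of v] V(3) by (auto simp: funpow_swap1)
          qed
        qed
      qed
      moreover have "openin (top_of_set riemann_sphere) (f ` V)" by (rule f_open[OF V(1)])
      moreover have "y \<in> f ` V" "f ` V \<subseteq> f ` U" using V x by blast+
      ultimately show ?thesis by blast
    qed
    then show "\<exists>r g. strict_mono r \<and> (\<forall>x\<in>f ` U. \<exists>V. openin (top_of_set riemann_sphere) V \<and> x \<in> V \<and> V \<subseteq> f ` U \<and>
             uniform_limit V (\<lambda>k. f ^^ n (r k)) g sequentially)"
      using r by blast
  qed
  moreover have "openin (top_of_set riemann_sphere) (f ` U)" by (rule f_open[OF U(1)])
  moreover have "f x \<in> f ` U" "f x \<in> riemann_sphere" using U(2) US f_in by blast+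
  ultimately show ?thesis unfolding fatou_set_def by blast
qed

lemma julia_completely_invariant:
  assumes "x \<in> riemann_sphere"
  shows "f x \<in> julia_set f \<longleftrightarrow> x \<in> julia_set f"
  using assms fatou_if_image_fatou[OF assms] image_fatou[of x] f_in[OF assms] unfolding julia_set_def by blast

lemma julia_subset: "julia_set f \<subseteq> riemann_sphere" by (auto simp: julia_set_def)

lemma finite_open_self_map_julia: "finite_open_self_map (julia_set f) deg f"
  by (rule finite_open_self_map_restrict[OF finite_open_self_map_f julia_subset julia_completely_invariant])

end

section \<open>Finite backward invariant sets lie in the Fatou set\<close>

context rational_map
begin

lemma unit_representative:
  assumes "y \<in> riemann_sphere"
  obtains u v where "y = sphere_point u v" "(cmod u)\<^sup>2 + (cmod v)\<^sup>2 = 1" "u \<noteq> 0 \<or> v \<noteq> 0"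
proof -
  obtain a b where ab: "y = sphere_point a b" "a \<noteq> 0 \<or> b \<noteq> 0" using assms unfolding riemann_sphere_eq by blast
  define n where "n = (cmod a)\<^sup>2 + (cmod b)\<^sup>2"
  have n: "0 < n" unfolding n_def by (rule norm_pair_pos[OF ab(2)])
  define c where "c = complex_of_real (1 / sqrt n)"
  have c: "c \<noteq> 0" "(cmod c)\<^sup>2 = 1 / n" using n by (simp_all add: c_def norm_divide power_divide)
  have "(cmod (c * a))\<^sup>2 + (cmod (c * b))\<^sup>2 = (cmod c)\<^sup>2 * n"
    by (simp add: n_def norm_mult power_mult_distrib algebra_simps)
  then have unit: "(cmod (c * a))\<^sup>2 + (cmod (c * b))\<^sup>2 = 1" using c n by simp
  show thesis
  proof (rule that)
    show "y = sphere_point (c * a) (c * b)" unfolding ab(1) by (rule sphere_point_scale[OF c(1), symmetric])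
    show "(cmod (c * a))\<^sup>2 + (cmod (c * b))\<^sup>2 = 1" by (rule unit)
    show "c * a \<noteq> 0 \<or> c * b \<noteq> 0" using c ab(2) by simp
  qed
qed

text \<open>A binary form with only one zero on the projective line is a multiple of a power of one
  linear form. The zero at infinity corresponds to a constant \<open>w\<close>, a finite zero to a
  \<open>w\<close> of full degree with a single root.\<close>

lemma homogenize_single_root:
  assumes uv': "u' \<noteq> 0 \<or> v' \<noteq> 0" and w: "degree w \<le> deg"
    and root: "\<And>u v. u \<noteq> 0 \<or> v \<noteq> 0 \<Longrightarrow> homogenize deg w u v = 0 \<longleftrightarrow> u * v' = v * u'"
  obtains \<kappa> where "\<And>u v. homogenize deg w u v = \<kappa> * (u * v' - v * u') ^ deg"
proof -
  have hz: "homogenize deg w z 1 = poly w z" for z using homogenize_nonzero[OF w, of 1 z] by simp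
  have poly_root: "poly w z = 0 \<longleftrightarrow> z * v' = u'" for z using root[of z 1] hz by simp
  have d0: "deg \<noteq> 0" using degree_ge_2 by simp
  show thesis
  proof (cases "v' = 0")
    case True
    then have u': "u' \<noteq> 0" using uv' by simp
    have "\<nexists>z. poly w z = 0" using poly_root True u' by auto
    then obtain c l where "c \<noteq> 0" "l = 0" "w = pCons c l" using fundamental_theorem_of_algebra_alt[of w] by blast
    then have wc: "w = [:c:]" by simp
    have "homogenize deg w u v = c * v ^ deg" for u v
    proof (cases "v = 0")
      case True
      then show ?thesis using d0 by (cases deg) (simp_all add: homogenize_zero wc)
    next
      case False
      then show ?thesis using homogenize_nonzero[OF w False, of u] by (simp add: wc)
    qed
    moreover have "(u * v' - v * u') ^ deg = (- u') ^ deg * v ^ deg" for u v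
    proof -
      have "u * v' - v * u' = - u' * v" by (simp add: True)
      then show ?thesis by (simp only: power_mult_distrib)
    qed
    ultimately have "homogenize deg w u v = (c / (- u') ^ deg) * (u * v' - v * u') ^ deg" for u v
      using u' by simp
    then show thesis using that[of "c / (- u') ^ deg"] by simp
  next
    case False
    define c where "c = u' / v'"
    have roots: "{z. poly w z = 0} = {c}"
    proof -
      have "z * v' = u' \<longleftrightarrow> z = u' / v'" for z using False by (simp add: eq_divide_eq)
      then show ?thesis unfolding poly_root c_def by simp
    qed
    have "coeff w deg \<noteq> 0" using root[of 1 0] False by (simp add: homogenize_zero)
    then have dw: "degree w = deg" using w by (metis le_antisym le_degree)
    define l where "l = lead_coeff w"
    have l: "l \<noteq> 0" using \<open>coeff w deg \<noteq> 0\<close> by (simp add: l_def dw)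
    have decomp: "w = smult l ([:- c, 1:] ^ order c w)"
      using complex_poly_decompose[of w] unfolding roots l_def by simp
    have "degree w = order c w"
      by (subst decomp) (use l in \<open>simp add: degree_power_eq\<close>)
    then have wl: "w = smult l ([:- c, 1:] ^ deg)" using decomp dw by metis
    have pw: "poly w z = l * (z - c) ^ deg" for z by (subst wl) (simp add: poly_power)
    have "homogenize deg w u v = (l / v' ^ deg) * (u * v' - v * u') ^ deg" for u v
    proof -
      have e: "(u * v' - v * u') ^ deg = v' ^ deg * (u - c * v) ^ deg"
      proof -
        have "u * v' - v * u' = v' * (u - c * v)" using False by (simp add: c_def field_simps)
        then show ?thesis by (simp only: power_mult_distrib)
      qed
      show ?thesis
      proof (cases "v = 0")
        case True
        then show ?thesis unfolding e using False by (simp add: homogenize_zero l_def dw)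
      next
        case v: False
        have "v ^ deg * (u / v - c) ^ deg = (u - c * v) ^ deg"
        proof -
          have "u - c * v = v * (u / v - c)" using v by (simp add: field_simps)
          then show ?thesis by (simp only: power_mult_distrib)
        qed
        then show ?thesis unfolding e homogenize_nonzero[OF w v] pw using False by simp
      qed
    qed
    then show thesis using that[of "l / v' ^ deg"] by simp
  qed
qed

lemma lift_norm_lower_bound:
  "\<exists>c>0. \<forall>u v. (cmod u)\<^sup>2 + (cmod v)\<^sup>2 = 1 \<longrightarrow> c \<le> sqrt ((cmod (P u v))\<^sup>2 + (cmod (Q u v))\<^sup>2)"
proof -
  let ?F = "\<lambda>x::complex \<times> complex. sqrt ((cmod (P (fst x) (snd x)))\<^sup>2 + (cmod (Q (fst x) (snd x)))\<^sup>2)"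
  have cont: "continuous_on (sphere 0 1) ?F" by (intro continuous_intros)
  have comp: "compact (sphere (0::complex \<times> complex) 1)" by simp
  have sph: "(u, v) \<in> sphere 0 1 \<longleftrightarrow> (cmod u)\<^sup>2 + (cmod v)\<^sup>2 = 1" for u v :: complex
    by (simp add: norm_prod_def)
  have "(1, 0) \<in> sphere (0::complex \<times> complex) 1" unfolding sph by simp
  then have "sphere (0::complex \<times> complex) 1 \<noteq> {}" by blast
  from continuous_attains_inf[OF comp this cont] obtain x where x: "x \<in> sphere 0 1" "\<And>y. y \<in> sphere 0 1 \<Longrightarrow> ?F x \<le> ?F y"
    by blast
  obtain u v where uv: "x = (u, v)" by (cases x)
  have "u \<noteq> 0 \<or> v \<noteq> 0" using x(1) unfolding uv sph by auto
  then have "0 < ?F x" using norm_pair_pos[OF lift_nonzero] by (simp add: uv)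
  moreover have "?F x \<le> sqrt ((cmod (P a b))\<^sup>2 + (cmod (Q a b))\<^sup>2)" if "(cmod a)\<^sup>2 + (cmod b)\<^sup>2 = 1" for a b
    using x(2)[of "(a, b)"] that sph by simp
  ultimately show ?thesis by (intro exI[of _ "?F x"]) simp
qed

text \<open>The distance of \<open>f y\<close> to \<open>f e\<close> has the form
  \<open>b * P - a * Q\<close> in its numerator. As \<open>e\<close> is the only preimage of
  \<open>f e\<close>, this form is a multiple of the power of order \<open>deg\<close> of the
  determinant measuring \<open>dist y e\<close>, so it decays at least quadratically. Compactness of
  the unit sphere bounds the denominators from below.\<close>

lemma superattracting_estimate:
  assumes e: "e \<in> riemann_sphere" and single: "\<And>x. x \<in> riemann_sphere \<Longrightarrow> f x = f e \<Longrightarrow> x = e"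
  obtains K where "0 \<le> K" "\<And>y. y \<in> riemann_sphere \<Longrightarrow> dist (f y) (f e) \<le> K * (dist y e)\<^sup>2"
proof -
  obtain u' v' where uv': "e = sphere_point u' v'" "(cmod u')\<^sup>2 + (cmod v')\<^sup>2 = 1" "u' \<noteq> 0 \<or> v' \<noteq> 0"
    using unit_representative[OF e] .
  obtain c where c: "0 < c" "\<And>u v. (cmod u)\<^sup>2 + (cmod v)\<^sup>2 = 1 \<Longrightarrow> c \<le> sqrt ((cmod (P u v))\<^sup>2 + (cmod (Q u v))\<^sup>2)"
    using lift_norm_lower_bound by auto
  define a where "a = P u' v'"
  define b where "b = Q u' v'"
  have ab: "a \<noteq> 0 \<or> b \<noteq> 0" unfolding a_def b_def by (rule lift_nonzero[OF uv'(3)])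
  have fe: "f e = sphere_point a b" unfolding uv'(1) a_def b_def by (rule sphere_map_sphere_point[OF uv'(3)])
  define w where "w = smult b p - smult a q"
  have root: "homogenize deg w u v = 0 \<longleftrightarrow> u * v' = v * u'" if uv: "u \<noteq> 0 \<or> v \<noteq> 0" for u v
  proof -
    have "homogenize deg w u v = 0 \<longleftrightarrow> f (sphere_point u v) = f e"
      unfolding fe w_def by (rule fibre_iff[OF ab uv, symmetric])
    also have "\<dots> \<longleftrightarrow> sphere_point u v = e" using single[OF sphere_point_in[OF uv]] by auto
    also have "\<dots> \<longleftrightarrow> u * v' = v * u'" unfolding uv'(1) by (rule sphere_point_eq_iff[OF uv uv'(3)])
    finally show ?thesis .
  qed
  have "degree w \<le> deg" unfolding w_def by (rule degree_combination_le)
  then obtain \<kappa> where \<kappa>: "\<And>u v. homogenize deg w u v = \<kappa> * (u * v' - v * u') ^ deg"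
    using homogenize_single_root[OF uv'(3) _ root] by blast
  \<comment> \<open>With unit coordinates \<open>dist y e\<close> is \<open>2 * t\<close>; this
    accounts for the factor 2 in the denominator.\<close>
  define K where "K = cmod \<kappa> / (2 * c\<^sup>2)"
  show thesis
  proof (rule that)
    show "0 \<le> K" by (simp add: K_def)
    fix y assume y: "y \<in> riemann_sphere"
    obtain u v where uv: "y = sphere_point u v" "(cmod u)\<^sup>2 + (cmod v)\<^sup>2 = 1" "u \<noteq> 0 \<or> v \<noteq> 0"
      using unit_representative[OF y] .
    define t where "t = cmod (u * v' - v * u')"
    have dye: "dist y e = 2 * t"
      unfolding uv(1) uv'(1) dist_sphere_point[OF uv(3) uv'(3)] uv(2) uv'(2) by (simp add: t_def)
    have "t \<le> cmod u * cmod v' + cmod v * cmod u'"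
      unfolding t_def using norm_triangle_ineq4[of "u * v'" "v * u'"] by (simp add: norm_mult)
    also have "\<dots> \<le> ((cmod u)\<^sup>2 + (cmod v')\<^sup>2) / 2 + ((cmod v)\<^sup>2 + (cmod u')\<^sup>2) / 2"
    proof -
      have "a * b \<le> (a\<^sup>2 + b\<^sup>2) / 2" for a b :: real using sum_squares_bound[of a b] by simp
      then show ?thesis by (intro add_mono)
    qed
    also have "\<dots> = (((cmod u)\<^sup>2 + (cmod v)\<^sup>2) + ((cmod u')\<^sup>2 + (cmod v')\<^sup>2)) / 2"
      by (simp add: add_divide_distrib)
    also have "\<dots> = 1" unfolding uv(2) uv'(2) by simp
    finally have t1: "t \<le> 1" .
    have t0: "0 \<le> t" by (simp add: t_def)
    have td: "t ^ deg \<le> t\<^sup>2" by (rule power_decreasing[OF degree_ge_2 t0 t1])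
    have num: "P u v * b - Q u v * a = \<kappa> * (u * v' - v * u') ^ deg"
      unfolding \<kappa>[symmetric] w_def homogenize_combination[symmetric] by (simp add: mult.commute)
    have ge: "c * c \<le> sqrt ((cmod (P u v))\<^sup>2 + (cmod (Q u v))\<^sup>2) * sqrt ((cmod a)\<^sup>2 + (cmod b)\<^sup>2)"
      unfolding a_def b_def using c(1) by (intro mult_mono c(2) uv(2) uv'(2)) auto
    have "dist (f y) (f e) = 2 * (cmod \<kappa> * t ^ deg) / (sqrt ((cmod (P u v))\<^sup>2 + (cmod (Q u v))\<^sup>2) * sqrt ((cmod a)\<^sup>2 + (cmod b)\<^sup>2))"
      unfolding fe uv(1) sphere_map_sphere_point[OF uv(3)] dist_sphere_point[OF lift_nonzero[OF uv(3)] ab] num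
      by (simp add: norm_mult norm_power t_def)
    also have "\<dots> \<le> 2 * (cmod \<kappa> * t\<^sup>2) / (c * c)"
      using c(1) t0 td ge by (intro frac_le mult_left_mono) auto
    also have "\<dots> = K * (dist y e)\<^sup>2"
      unfolding dye K_def using c(1) by (simp add: field_simps power2_eq_square)
    finally show "dist (f y) (f e) \<le> K * (dist y e)\<^sup>2" .
  qed
qed

text \<open>Counting shows that \<open>f\<close> permutes \<open>E\<close> and that each point of
  \<open>E\<close> has exactly one preimage, so the quadratic estimate holds along the whole orbit
  of \<open>e\<close>. Iterates contract a small ball around \<open>e\<close> towards that finite
  orbit.\<close>

lemma backward_invariant_finite_in_fatou:
  assumes E: "finite E" "E \<subseteq> riemann_sphere" and bwd: "\<And>x. x \<in> riemann_sphere \<Longrightarrow> f x \<in> E \<Longrightarrow> x \<in> E"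
    and e: "e \<in> E"
  shows "e \<in> fatou_set f"
proof -
  define E' where "E' = {x\<in>riemann_sphere. f x \<in> E}"
  have E'E: "E' \<subseteq> E" unfolding E'_def using bwd by blast
  have "f ` E' = E"
  proof
    show "E \<subseteq> f ` E'"
    proof
      fix y assume y: "y \<in> E"
      then obtain x where "x \<in> riemann_sphere" "f x = y" using fibre_finite(3)[of y] E(2) by blast
      then show "y \<in> f ` E'" using y unfolding E'_def by blast
    qed
  qed (auto simp: E'_def)
  then have "card E \<le> card E'" using card_image_le[OF finite_subset[OF E'E E(1)], of f] by simp
  then have "E' = E" using card_seteq[OF E(1) E'E] by blast
  then have fE: "f ` E = E" using \<open>f ` E' = E\<close> by simp
  then have inj: "inj_on f E" using finite_surj_inj[OF E(1)] by blast
  have "\<exists>K. 0 \<le> K \<and> (\<forall>y\<in>riemann_sphere. dist (f y) (f s) \<le> K * (dist y s)\<^sup>2)" if s: "s \<in> E" for s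
  proof -
    have single: "x = s" if x: "x \<in> riemann_sphere" "f x = f s" for x
    proof -
      have "f x \<in> E" using x(2) s fE by auto
      then have "x \<in> E" using bwd x(1) by blast
      then show ?thesis using inj s x(2) by (meson inj_onD)
    qed
    have "s \<in> riemann_sphere" using s E(2) by blast
    then obtain K where "0 \<le> K" "\<And>y. y \<in> riemann_sphere \<Longrightarrow> dist (f y) (f s) \<le> K * (dist y s)\<^sup>2"
      using superattracting_estimate[OF _ single] by blast
    then show ?thesis by (intro exI[of _ K]) simp
  qed
  then have "\<forall>s\<in>E. \<exists>K. 0 \<le> K \<and> (\<forall>y\<in>riemann_sphere. dist (f y) (f s) \<le> K * (dist y s)\<^sup>2)" by (intro ballI)
  from bchoice[OF this] obtain Kf where Kf: "\<And>s. s \<in> E \<Longrightarrow> 0 \<le> Kf s \<and> (\<forall>y\<in>riemann_sphere. dist (f y) (f s) \<le> Kf s * (dist y s)\<^sup>2)"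
    by blast
  define K where "K = (\<Sum>s\<in>E. Kf s)"
  have KfK: "Kf s \<le> K" if "s \<in> E" for s
    unfolding K_def using E(1) Kf that by (intro member_le_sum) auto
  have K0: "0 \<le> K" unfolding K_def using Kf by (intro sum_nonneg) auto
  \<comment> \<open>Chosen so that the quadratic bound becomes contraction by one half;
    \<open>K + 1\<close> avoids division by zero.\<close>
  define \<delta> where "\<delta> = 1 / (2 * (K + 1))"
  have \<delta>: "0 < \<delta>" "K * \<delta> \<le> 1/2" using K0 by (auto simp: \<delta>_def field_simps)
  have contract: "dist (f y) (f s) \<le> 1/2 * dist y s" if s: "s \<in> E" and y: "y \<in> riemann_sphere" "dist y s \<le> \<delta>" for s y
  proof -
    have "dist (f y) (f s) \<le> Kf s * (dist y s)\<^sup>2" using Kf[OF s] y(1) by blast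
    also have "\<dots> \<le> K * (dist y s)\<^sup>2" using KfK[OF s] by (intro mult_right_mono) auto
    also have "\<dots> = (K * dist y s) * dist y s" by (simp add: power2_eq_square)
    also have "\<dots> \<le> (K * \<delta>) * dist y s" using K0 y(2) by (intro mult_right_mono mult_left_mono) auto
    also have "\<dots> \<le> 1/2 * dist y s" using \<delta>(2) by (intro mult_right_mono) auto
    finally show ?thesis .
  qed
  have fEn: "(f ^^ n) e \<in> E" for n by (induction n) (use e fE in auto)
  have iter: "dist ((f ^^ n) y) ((f ^^ n) e) \<le> (1/2) ^ n * \<delta>" if y: "y \<in> riemann_sphere" "dist y e \<le> \<delta>" for n y
  proof (induction n)
    case 0
    then show ?case using y(2) by simp
  next
    case (Suc n)
    have "(1/2::real) ^ n * \<delta> \<le> 1 * \<delta>" using \<delta>(1) by (intro mult_right_mono power_le_one) auto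
    then have "dist ((f ^^ n) y) ((f ^^ n) e) \<le> \<delta>" using Suc by simp
    then have "dist (f ((f ^^ n) y)) (f ((f ^^ n) e)) \<le> 1/2 * dist ((f ^^ n) y) ((f ^^ n) e)"
      by (intro contract fEn funpow_in y)
    then show ?case using Suc by simp
  qed
  define U where "U = riemann_sphere \<inter> ball e \<delta>"
  have U_open: "openin (top_of_set riemann_sphere) U" unfolding U_def by (simp add: openin_open_Int)
  have "normal_iterates_on f U"
    unfolding normal_iterates_on_def
  proof
    fix n :: "nat \<Rightarrow> nat"
    have "\<exists>r g. strict_mono r \<and> uniform_limit U (\<lambda>k. f ^^ n (r k)) g sequentially"
    proof (rule nat_sequence_constant_or_unbounded[of n])
      fix r :: "nat \<Rightarrow> nat" and v assume r: "strict_mono r" "\<And>k. n (r k) = v"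
      then have "uniform_limit U (\<lambda>k. f ^^ n (r k)) (f ^^ v) sequentially" by (simp add: uniform_limit_iff)
      then show ?thesis using r(1) by blast
    next
      assume n: "filterlim n at_top sequentially"
      \<comment> \<open>The orbit of \<open>e\<close> lies in the finite set \<open>E\<close>, so
        along a subsequence the centres of the shrinking images are one and the same point, which is
        the uniform limit.\<close>
      have "finite ((\<lambda>k. (f ^^ n k) e) ` UNIV)" using fEn by (intro finite_subset[OF _ E(1)]) auto
      then obtain k0 where "infinite {k\<in>UNIV. (f ^^ n k) e = (f ^^ n k0) e}"
        using pigeonhole_infinite[of UNIV "\<lambda>k. (f ^^ n k) e"] by auto
      then obtain r :: "nat \<Rightarrow> nat" where r: "strict_mono r" "\<And>k. r k \<in> {k\<in>UNIV. (f ^^ n k) e = (f ^^ n k0) e}"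
        using infinite_enumerate by blast
      have "filterlim (\<lambda>k. n (r k)) at_top sequentially"
        using filterlim_compose[OF n filterlim_subseq[OF r(1)]] .
      then have "((\<lambda>k. (1/2::real) ^ n (r k)) \<longlongrightarrow> 0) sequentially"
        by (rule filterlim_compose[OF LIMSEQ_realpow_zero, rotated 2]) auto
      then have lim: "((\<lambda>k. (1/2::real) ^ n (r k) * \<delta>) \<longlongrightarrow> 0) sequentially"
        by (rule tendsto_mult_left_zero)
      have "uniform_limit U (\<lambda>k. f ^^ n (r k)) (\<lambda>_. (f ^^ n k0) e) sequentially"
        unfolding uniform_limit_iff
      proof (intro allI impI)
        fix \<epsilon> :: real assume "0 < \<epsilon>"
        then have "eventually (\<lambda>k. (1/2::real) ^ n (r k) * \<delta> < \<epsilon>) sequentially"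
          using order_tendstoD(2)[OF lim] by blast
        then show "eventually (\<lambda>k. \<forall>x\<in>U. dist ((f ^^ n (r k)) x) ((f ^^ n k0) e) < \<epsilon>) sequentially"
        proof eventually_elim
          case (elim k)
          show ?case
          proof
            fix x assume "x \<in> U"
            then have "x \<in> riemann_sphere" "dist x e \<le> \<delta>" by (auto simp: U_def dist_commute)
            from iter[OF this, of "n (r k)"] have "dist ((f ^^ n (r k)) x) ((f ^^ n (r k)) e) < \<epsilon>" using elim by linarith
            then show "dist ((f ^^ n (r k)) x) ((f ^^ n k0) e) < \<epsilon>" using r(2)[of k] by simp
          qed
        qed
      qed
      then show ?thesis using r(1) by blast
    qed
    then show "\<exists>r g. strict_mono r \<and> (\<forall>x\<in>U. \<exists>V. openin (top_of_set riemann_sphere) V \<and> x \<in> V \<and> V \<subseteq> U \<and>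
             uniform_limit V (\<lambda>k. f ^^ n (r k)) g sequentially)"
      using U_open by blast
  qed
  moreover have "e \<in> U" "e \<in> riemann_sphere" using e E(2) \<delta>(1) by (auto simp: U_def)
  ultimately show ?thesis unfolding fatou_set_def using U_open by blast
qed

end

section \<open>Montel's theorem and the exhausting property on the Julia set\<close>

text \<open>The two omitted values and the bound at the centre give bounds on compact sets
  (\<open>GPicard3\<close>, a Schottky-type estimate), after which Montel's theorem for locally
  bounded families applies.\<close>

lemma omitting_zero_one_subsequence:
  fixes H :: "nat \<Rightarrow> complex \<Rightarrow> complex"
  assumes R: "0 < R" and hol: "\<And>j. H j holomorphic_on ball 0 R"
    and omit: "\<And>j z. z \<in> ball 0 R \<Longrightarrow> H j z \<noteq> 0 \<and> H j z \<noteq> 1" and le1: "\<And>j. cmod (H j 0) \<le> 1"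
  obtains s g where "strict_mono (s :: nat \<Rightarrow> nat)" "continuous_on (cball 0 (R / 2)) g"
    "uniform_limit (cball 0 (R / 2)) (\<lambda>j. H (s j)) g sequentially"
proof -
  have bounded: "\<exists>B. \<forall>h\<in>range H. \<forall>z\<in>K. cmod (h z) \<le> B" if K: "compact K" "K \<subseteq> ball 0 R" for K
  proof -
    obtain B where "\<And>h z. \<lbrakk>h \<in> range H; z \<in> K\<rbrakk> \<Longrightarrow> cmod (h z) \<le> B"
    proof (rule GPicard3[of "ball 0 R" 0 "range H" "range H" K])
      show "h holomorphic_on ball 0 R" if "h \<in> range H" for h using hol that by auto
      show "h z \<noteq> 0 \<and> h z \<noteq> 1" if "h \<in> range H" "z \<in> ball 0 R" for h z using omit that by auto
      show "cmod (h 0) \<le> 1" if "h \<in> range H" for h using le1 that by auto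
    qed (use R K in auto)
    then show ?thesis by blast
  qed
  have hol': "h holomorphic_on ball 0 R" if "h \<in> range H" for h using hol that by auto
  obtain g s where gs: "g holomorphic_on ball 0 R" "strict_mono (s :: nat \<Rightarrow> nat)"
    "\<And>K. \<lbrakk>compact K; K \<subseteq> ball 0 R\<rbrakk> \<Longrightarrow> uniform_limit K (H \<circ> s) g sequentially"
    by (rule Montel[of "ball 0 R" "range H" H, OF open_ball hol' bounded order_refl]) blast+
  have sub: "cball 0 (R / 2) \<subseteq> ball (0::complex) R" using R by auto
  show thesis
  proof (rule that)
    show "strict_mono s" by (rule gs(2))
    show "continuous_on (cball 0 (R / 2)) g"
      by (rule continuous_on_subset[OF holomorphic_on_imp_continuous_on[OF gs(1)] sub])
    show "uniform_limit (cball 0 (R / 2)) (\<lambda>j. H (s j)) g sequentially"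
      using gs(3)[OF compact_cball sub] by (simp add: o_def)
  qed
qed

text \<open>The limit is bounded on \<open>C\<close>, so the functions eventually take values in one
  compact disc, on which \<open>\<psi>\<close> is uniformly continuous.\<close>

lemma uniform_limit_continuous_compose:
  fixes g :: "'a::metric_space \<Rightarrow> complex" and \<psi> :: "complex \<Rightarrow> 'b::metric_space"
  assumes C: "compact C" and lim: "uniform_limit C G g sequentially" and g: "continuous_on C g"
    and \<psi>: "continuous_on UNIV \<psi>"
  shows "uniform_limit C (\<lambda>j z. \<psi> (G j z)) (\<lambda>z. \<psi> (g z)) sequentially"
proof -
  have "bounded (g ` C)" using compact_continuous_image[OF g C] by (rule compact_imp_bounded)
  then obtain B where B: "\<And>z. z \<in> C \<Longrightarrow> cmod (g z) \<le> B" unfolding bounded_iff by blast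
  have "eventually (\<lambda>j. \<forall>z\<in>C. dist (G j z) (g z) < 1) sequentially"
    using lim unfolding uniform_limit_iff by (simp add: zero_less_one)
  then have ev: "eventually (\<lambda>j. G j ` C \<subseteq> cball 0 (B + 1)) sequentially"
  proof eventually_elim
    case (elim j)
    show ?case
    proof
      fix w assume "w \<in> G j ` C"
      then obtain z where z: "z \<in> C" "w = G j z" by blast
      have "cmod (G j z) \<le> cmod (g z) + dist (G j z) (g z)"
        using norm_triangle_ineq2[of "G j z" "g z"] by (simp add: dist_norm)
      then show "w \<in> cball 0 (B + 1)" using B[OF z(1)] elim z by fastforce
    qed
  qed
  have uc: "uniformly_continuous_on (cball 0 (B + 1)) \<psi>"
    by (rule compact_uniformly_continuous[OF continuous_on_subset[OF \<psi>] compact_cball]) simp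
  have gB: "g ` C \<subseteq> cball 0 (B + 1)" using B by fastforce
  show ?thesis using uniform_limit_compose[OF lim uc ev gB] by (simp add: o_def)
qed

context rational_map
begin

text \<open>Montel's theorem for three omitted values on the sphere. In a Moebius coordinate the
  iterates become holomorphic functions omitting 0 and 1, and convergence there is carried back to
  the sphere by a continuous parametrisation.\<close>

lemma omitting_three_points_fatou:
  assumes V: "openin (top_of_set riemann_sphere) V" "x \<in> V"
    and e: "e1 \<in> riemann_sphere" "e2 \<in> riemann_sphere" "e3 \<in> riemann_sphere" "e1 \<noteq> e2" "e1 \<noteq> e3" "e2 \<noteq> e3"
    and omit: "\<And>n y. y \<in> V \<Longrightarrow> (f ^^ n) y \<noteq> e1 \<and> (f ^^ n) y \<noteq> e2 \<and> (f ^^ n) y \<noteq> e3"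
  shows "x \<in> fatou_set f"
proof -
  have xS: "x \<in> riemann_sphere" using V openin_imp_subset by blast
  obtain u v where uv: "x = sphere_point u v" "u \<noteq> 0 \<or> v \<noteq> 0" using xS unfolding riemann_sphere_eq by blast
  obtain a1 b1 where e1: "e1 = sphere_point a1 b1" "a1 \<noteq> 0 \<or> b1 \<noteq> 0" using e(1) unfolding riemann_sphere_eq by blast
  obtain a2 b2 where e2: "e2 = sphere_point a2 b2" "a2 \<noteq> 0 \<or> b2 \<noteq> 0" using e(2) unfolding riemann_sphere_eq by blast
  obtain a3 b3 where e3: "e3 = sphere_point a3 b3" "a3 \<noteq> 0 \<or> b3 \<noteq> 0" using e(3) unfolding riemann_sphere_eq by blast
  have ne: "a1 * b2 \<noteq> b1 * a2" "a1 * b3 \<noteq> b1 * a3" "a2 * b3 \<noteq> b2 * a3"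
    using e(4-6) unfolding e1(1) e2(1) e3(1) sphere_point_eq_iff[OF e1(2) e2(2)]
      sphere_point_eq_iff[OF e1(2) e3(2)] sphere_point_eq_iff[OF e2(2) e3(2)] .
  define \<phi> where "\<phi> = disc_chart u v"
  obtain G where G: "open G" "V = riemann_sphere \<inter> G" using V(1) by (auto simp: openin_open)
  have "open (\<phi> -` G)" unfolding \<phi>_def by (rule open_vimage[OF G(1) continuous_on_disc_chart[OF uv(2)]])
  moreover have "0 \<in> \<phi> -` G" using V(2) G(2) uv(1) by (simp add: \<phi>_def disc_chart_0)
  ultimately obtain R where R: "0 < R" "ball 0 R \<subseteq> \<phi> -` G" using open_contains_ball by blast
  have \<phi>V: "\<phi> z \<in> V" if "z \<in> ball 0 R" for z
    using R(2) that G(2) disc_chart_in[OF uv(2)] unfolding \<phi>_def by blast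
  \<comment> \<open>A lift of all iterates to homogeneous coordinates, starting from the disc chart.
    Its components are entire, so poles need no separate treatment.\<close>
  define l where "l = rec_nat (\<lambda>z. (u - z * cnj v, v + z * cnj u))
    (\<lambda>_ L z. (P (fst (L z)) (snd (L z)), Q (fst (L z)) (snd (L z))))"
  define A where "A n z = fst (l n z)" for n z
  define B where "B n z = snd (l n z)" for n z
  have l0: "A 0 z = u - z * cnj v" "B 0 z = v + z * cnj u"
    and lSuc: "A (Suc n) z = P (A n z) (B n z)" "B (Suc n) z = Q (A n z) (B n z)" for n z
    by (simp_all add: A_def B_def l_def)
  have nz: "A n z \<noteq> 0 \<or> B n z \<noteq> 0" for n z
    by (induction n) (simp_all only: l0 lSuc disc_chart_nonzero[OF uv(2)] lift_nonzero)
  have iter: "(f ^^ n) (\<phi> z) = sphere_point (A n z) (B n z)" for n z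
    by (induction n) (simp_all add: \<phi>_def disc_chart_def l0 lSuc sphere_map_sphere_point[OF nz])
  have "A n holomorphic_on UNIV \<and> B n holomorphic_on UNIV" for n
  proof (induction n)
    case 0
    have "A 0 = (\<lambda>z. u - z * cnj v)" "B 0 = (\<lambda>z. v + z * cnj u)" using l0 by (auto simp: fun_eq_iff)
    then show ?case by (auto intro!: holomorphic_intros)
  next
    case (Suc n)
    have "A (Suc n) = (\<lambda>z. P (A n z) (B n z))" "B (Suc n) = (\<lambda>z. Q (A n z) (B n z))"
      using lSuc by (auto simp: fun_eq_iff)
    then show ?case using Suc by (auto intro!: holomorphic_intros)
  qed
  then have AB: "A n holomorphic_on ball 0 R" "B n holomorphic_on ball 0 R" for n
    by (meson holomorphic_on_subset subset_UNIV)+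
  \<comment> \<open>\<open>c * l1 / l3\<close> is the Moebius coordinate sending \<open>e1, e2, e3\<close> to \<open>0, 1, \<infinity>\<close>.\<close>
  define l1 where "l1 n z = b1 * A n z - a1 * B n z" for n z
  define l3 where "l3 n z = b3 * A n z - a3 * B n z" for n z
  define c where "c = (b3 * a2 - a3 * b2) / (b1 * a2 - a1 * b2)"
  define \<Delta> where "\<Delta> = a1 * b3 - a3 * b1"
  have \<Delta>: "\<Delta> \<noteq> 0" using ne(2) by (simp add: \<Delta>_def mult.commute)
  have c0: "c \<noteq> 0" using ne by (simp add: c_def mult.commute)
  have omit_l: "l1 n z \<noteq> 0" "l3 n z \<noteq> 0" "c * l1 n z \<noteq> l3 n z" if z: "z \<in> ball 0 R" for n z
  proof -
    have om: "sphere_point (A n z) (B n z) \<noteq> e1" "sphere_point (A n z) (B n z) \<noteq> e2" "sphere_point (A n z) (B n z) \<noteq> e3"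
      using omit[OF \<phi>V[OF z], of n] unfolding iter by blast+
    show "l1 n z \<noteq> 0" using om(1) unfolding e1(1) sphere_point_eq_iff[OF nz e1(2)] l1_def by (simp add: mult.commute)
    show "l3 n z \<noteq> 0" using om(3) unfolding e3(1) sphere_point_eq_iff[OF nz e3(2)] l3_def by (simp add: mult.commute)
    have l2: "b2 * A n z - a2 * B n z \<noteq> 0"
      using om(2) unfolding e2(1) sphere_point_eq_iff[OF nz e2(2)] by (simp add: mult.commute)
    have dn: "b1 * a2 - a1 * b2 \<noteq> 0" using ne(1) by (simp add: mult.commute)
    have "(b3 * a2 - a3 * b2) * l1 n z - (b1 * a2 - a1 * b2) * l3 n z = \<Delta> * (b2 * A n z - a2 * B n z)"
      unfolding l1_def l3_def \<Delta>_def by (simp add: algebra_simps)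
    then have "(b3 * a2 - a3 * b2) * l1 n z \<noteq> (b1 * a2 - a1 * b2) * l3 n z" using \<Delta> l2 by auto
    then show "c * l1 n z \<noteq> l3 n z" unfolding c_def using dn by (simp add: field_simps)
  qed
  have point: "(f ^^ n) (\<phi> z) = sphere_point (a1 * l3 n z - a3 * l1 n z) (b1 * l3 n z - b3 * l1 n z)" for n z
  proof -
    have "a1 * l3 n z - a3 * l1 n z = \<Delta> * A n z" "b1 * l3 n z - b3 * l1 n z = \<Delta> * B n z"
      unfolding l1_def l3_def \<Delta>_def by (simp_all add: algebra_simps)
    then show ?thesis unfolding iter using sphere_point_scale[OF \<Delta>] by simp
  qed
  define h where "h n z = c * l1 n z / l3 n z" for n z
  \<comment> \<open>\<open>\<psi>\<close> inverts the Moebius coordinate, and \<open>\<psi>'\<close>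
    does the same for its reciprocal; each is continuous on the whole plane, the value at 0 being
    \<open>e1\<close> and \<open>e3\<close> respectively.\<close>
  define \<psi> where "\<psi> w = sphere_point (a1 - a3 * (w / c)) (b1 - b3 * (w / c))" for w
  define \<psi>' where "\<psi>' w = sphere_point (a1 * w - a3 / c) (b1 * w - b3 / c)" for w
  have \<psi>: "continuous_on UNIV \<psi>"
    unfolding \<psi>_def[abs_def]
  proof (rule continuous_on_sphere_point)
    fix w
    show "a1 - a3 * (w / c) \<noteq> 0 \<or> b1 - b3 * (w / c) \<noteq> 0"
    proof (rule ccontr)
      assume "\<not> ?thesis"
      then have "a1 = a3 * (w / c)" "b1 = b3 * (w / c)" by auto
      then show False using \<Delta> unfolding \<Delta>_def by simp
    qed
  qed (use c0 in \<open>auto intro!: continuous_intros\<close>)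
  have \<psi>': "continuous_on UNIV \<psi>'"
    unfolding \<psi>'_def[abs_def]
  proof (rule continuous_on_sphere_point)
    fix w
    show "a1 * w - a3 / c \<noteq> 0 \<or> b1 * w - b3 / c \<noteq> 0"
    proof (rule ccontr)
      assume "\<not> ?thesis"
      then have "a3 = c * (a1 * w)" "b3 = c * (b1 * w)" using c0 by (auto simp: field_simps)
      then show False using \<Delta> unfolding \<Delta>_def by simp
    qed
  qed (auto intro!: continuous_intros)
  have f\<psi>: "(f ^^ n) (\<phi> z) = \<psi> (h n z)" if z: "z \<in> ball 0 R" for n z
  proof -
    have "a1 * l3 n z - a3 * l1 n z = l3 n z * (a1 - a3 * (h n z / c))" "b1 * l3 n z - b3 * l1 n z = l3 n z * (b1 - b3 * (h n z / c))"
    proof -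
      have eq: "h n z / c = l1 n z / l3 n z" unfolding h_def using c0 by simp
      have "l3 n z * (a - b * (l1 n z / l3 n z)) = a * l3 n z - b * l1 n z" for a b
        using omit_l(2)[OF z, of n] by (simp add: right_diff_distrib mult.commute)
      then show "a1 * l3 n z - a3 * l1 n z = l3 n z * (a1 - a3 * (h n z / c))"
        "b1 * l3 n z - b3 * l1 n z = l3 n z * (b1 - b3 * (h n z / c))" unfolding eq by simp_all
    qed
    then show ?thesis unfolding point \<psi>_def using sphere_point_scale[OF omit_l(2)[OF z]] by simp
  qed
  have f\<psi>': "(f ^^ n) (\<phi> z) = \<psi>' (1 / h n z)" if z: "z \<in> ball 0 R" for n z
  proof -
    have "a1 * l3 n z - a3 * l1 n z = (c * l1 n z) * (a1 * (1 / h n z) - a3 / c)" "b1 * l3 n z - b3 * l1 n z = (c * l1 n z) * (b1 * (1 / h n z) - b3 / c)"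
    proof -
      have eq: "1 / h n z = l3 n z / (c * l1 n z)" unfolding h_def by simp
      have "(c * l1 n z) * (a * (l3 n z / (c * l1 n z)) - b / c) = a * l3 n z - b * l1 n z" for a b
        using omit_l(1)[OF z, of n] c0 by (simp add: right_diff_distrib mult.commute)
      then show "a1 * l3 n z - a3 * l1 n z = (c * l1 n z) * (a1 * (1 / h n z) - a3 / c)"
        "b1 * l3 n z - b3 * l1 n z = (c * l1 n z) * (b1 * (1 / h n z) - b3 / c)" unfolding eq by simp_all
    qed
    moreover have "c * l1 n z \<noteq> 0" using c0 omit_l(1)[OF z] by simp
    ultimately show ?thesis unfolding point \<psi>'_def using sphere_point_scale by simp
  qed
  have h_hol: "h n holomorphic_on ball 0 R" for n
    unfolding h_def[abs_def] l1_def[abs_def] l3_def[abs_def]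
    by (intro holomorphic_intros AB) (use omit_l(2) in \<open>simp add: l3_def\<close>)
  have h01: "h n z \<noteq> 0" "h n z \<noteq> 1" if "z \<in> ball 0 R" for n z
    using omit_l[OF that, of n] c0 by (simp_all add: h_def)
  obtain \<rho> where \<rho>: "0 < \<rho>" "riemann_sphere \<inter> ball (sphere_point u v) \<rho> \<subseteq> \<phi> ` ball 0 (R / 2)"
    using disc_chart_covers_nbhd[OF uv(2), of "R / 2"] R(1) unfolding \<phi>_def by auto
  define U where "U = riemann_sphere \<inter> ball x \<rho>"
  have U\<phi>: "U \<subseteq> \<phi> ` ball 0 (R / 2)" using \<rho>(2) by (simp add: U_def uv(1))
  have U_open: "openin (top_of_set riemann_sphere) U" unfolding U_def by (simp add: openin_open_Int)
  have conclude: "\<exists>r g. strict_mono r \<and> uniform_limit U (\<lambda>k. f ^^ n (r k)) g sequentially"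
    if r1: "strict_mono (r1 :: nat \<Rightarrow> nat)" and hol: "\<And>j. H j holomorphic_on ball 0 R"
      and H01: "\<And>j z. z \<in> ball 0 R \<Longrightarrow> H j z \<noteq> 0 \<and> H j z \<noteq> 1" and le1: "\<And>j. cmod (H j 0) \<le> 1"
      and \<Psi>: "continuous_on UNIV \<Psi>" and eq: "\<And>j z. z \<in> ball 0 R \<Longrightarrow> (f ^^ n (r1 j)) (\<phi> z) = \<Psi> (H j z)"
    for n r1 H \<Psi>
  proof -
    obtain s g where s: "strict_mono (s :: nat \<Rightarrow> nat)" "continuous_on (cball 0 (R / 2)) g"
      "uniform_limit (cball 0 (R / 2)) (\<lambda>j. H (s j)) g sequentially"
      using omitting_zero_one_subsequence[of R H, OF R(1) hol H01 le1] .
    have lim: "uniform_limit (cball 0 (R / 2)) (\<lambda>j z. \<Psi> (H (s j) z)) (\<lambda>z. \<Psi> (g z)) sequentially"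
      by (rule uniform_limit_continuous_compose[OF compact_cball s(3,2) \<Psi>])
    define t where "t = inv_into (ball 0 (R / 2)) \<phi>"
    have t: "t y \<in> ball 0 (R / 2)" "\<phi> (t y) = y" if "y \<in> U" for y
      using inv_into_into[of y \<phi> "ball 0 (R / 2)"] f_inv_into_f[of y \<phi> "ball 0 (R / 2)"] U\<phi> that
      unfolding t_def by blast+
    have "uniform_limit U (\<lambda>k. f ^^ n (r1 (s k))) (\<lambda>y. \<Psi> (g (t y))) sequentially"
      unfolding uniform_limit_iff
    proof (intro allI impI)
      fix \<epsilon> :: real assume "0 < \<epsilon>"
      then have "eventually (\<lambda>j. \<forall>z\<in>cball 0 (R / 2). dist (\<Psi> (H (s j) z)) (\<Psi> (g z)) < \<epsilon>) sequentially"
        using lim unfolding uniform_limit_iff by blast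
      then show "eventually (\<lambda>k. \<forall>y\<in>U. dist ((f ^^ n (r1 (s k))) y) (\<Psi> (g (t y))) < \<epsilon>) sequentially"
      proof eventually_elim
        case (elim k)
        show ?case
        proof
          fix y assume y: "y \<in> U"
          have tR: "t y \<in> ball 0 R" "t y \<in> cball 0 (R / 2)" using t(1)[OF y] R(1) by auto
          have "(f ^^ n (r1 (s k))) y = \<Psi> (H (s k) (t y))" using eq[OF tR(1), of "s k"] t(2)[OF y] by simp
          then show "dist ((f ^^ n (r1 (s k))) y) (\<Psi> (g (t y))) < \<epsilon>" using elim tR(2) by simp
        qed
      qed
    qed
    moreover have "strict_mono (\<lambda>k. r1 (s k))" using strict_mono_o[OF r1 s(1)] by (simp add: o_def)
    ultimately show ?thesis by (intro exI[of _ "\<lambda>k. r1 (s k)"] exI conjI)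
  qed
  have "normal_iterates_on f U"
    unfolding normal_iterates_on_def
  proof
    fix n :: "nat \<Rightarrow> nat"
    have "\<exists>r g. strict_mono r \<and> uniform_limit U (\<lambda>k. f ^^ n (r k)) g sequentially"
    proof (cases "infinite {k. cmod (h (n k) 0) \<le> 1}")
      case True
      then obtain r1 :: "nat \<Rightarrow> nat" where r1: "strict_mono r1" "\<And>j. r1 j \<in> {k. cmod (h (n k) 0) \<le> 1}"
        using infinite_enumerate by blast
      show ?thesis
      proof (rule conclude[OF r1(1), of "\<lambda>j. h (n (r1 j))" \<psi>])
        show "cmod (h (n (r1 j)) 0) \<le> 1" for j using r1(2)[of j] by simp
      qed (use h_hol h01 \<psi> f\<psi> in auto)
    next
      \<comment> \<open>When the coordinates are large at the centre, their reciprocals are used: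
        these also omit 0 and 1 and are bounded by 1 at the centre, so convergence to the pole is
        covered as well.\<close>
      case False
      then have "infinite (- {k. cmod (h (n k) 0) \<le> 1})" by (simp add: finite_compl)
      then obtain r1 :: "nat \<Rightarrow> nat" where r1: "strict_mono r1" "\<And>j. r1 j \<in> - {k. cmod (h (n k) 0) \<le> 1}"
        using infinite_enumerate by blast
      show ?thesis
      proof (rule conclude[OF r1(1), of "\<lambda>j z. 1 / h (n (r1 j)) z" \<psi>'])
        show "cmod (1 / h (n (r1 j)) 0) \<le> 1" for j
        proof -
          have "1 < cmod (h (n (r1 j)) 0)" using r1(2)[of j] by simp
          then show ?thesis by (simp add: norm_divide divide_le_eq_1)
        qed
        show "(\<lambda>z. 1 / h (n (r1 j)) z) holomorphic_on ball 0 R" for j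
          by (intro holomorphic_intros h_hol h01)
        show "1 / h (n (r1 j)) z \<noteq> 0 \<and> 1 / h (n (r1 j)) z \<noteq> 1" if "z \<in> ball 0 R" for j z
          using h01[OF that, of "n (r1 j)"] by simp
      qed (use \<psi>' f\<psi>' in auto)
    qed
    then show "\<exists>r g. strict_mono r \<and> (\<forall>x\<in>U. \<exists>V. openin (top_of_set riemann_sphere) V \<and> x \<in> V \<and> V \<subseteq> U \<and>
             uniform_limit V (\<lambda>k. f ^^ n (r k)) g sequentially)"
      using U_open by blast
  qed
  moreover have "x \<in> U" using xS \<rho>(1) by (simp add: U_def)
  ultimately show ?thesis unfolding fatou_set_def using U_open xS by blast
qed

text \<open>Montel's theorem needs a set open in the sphere, so \<open>U\<close> is thickened to
  \<open>V\<close>. Complete invariance brings the result back: a point of \<open>V\<close> with an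
  iterate in the Julia set lies in the Julia set, hence in \<open>U\<close>.\<close>

lemma julia_exhausting:
  assumes U: "openin (top_of_set (julia_set f)) U" "U \<noteq> {}"
  shows "julia_set f \<subseteq> (\<Union>n. (f ^^ n) ` U)"
proof -
  obtain G where G: "open G" "U = julia_set f \<inter> G" using U(1) by (auto simp: openin_open)
  define V where "V = riemann_sphere \<inter> G"
  have V: "openin (top_of_set riemann_sphere) V" unfolding V_def using G(1) by (rule openin_open_Int)
  obtain x where x: "x \<in> U" using U(2) by blast
  then have xV: "x \<in> V" "x \<notin> fatou_set f" using G(2) julia_subset by (auto simp: V_def julia_set_def)
  define E where "E = riemann_sphere - (\<Union>n. (f ^^ n) ` V)"
  have "finite E"
  proof (rule ccontr)
    assume "infinite E"
    then obtain T where T: "T \<subseteq> E" "finite T" "card T = 3" using infinite_arbitrarily_large by blast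
    then obtain e1 e2 e3 where e: "T = {e1, e2, e3}" "e1 \<noteq> e2" "e1 \<noteq> e3" "e2 \<noteq> e3" by (metis card_3_iff)
    have "(f ^^ n) y \<noteq> e1 \<and> (f ^^ n) y \<noteq> e2 \<and> (f ^^ n) y \<noteq> e3" if "y \<in> V" for n y
      using T(1) e(1) that unfolding E_def by blast
    moreover have "e1 \<in> riemann_sphere" "e2 \<in> riemann_sphere" "e3 \<in> riemann_sphere" using T(1) e(1) unfolding E_def by blast+
    ultimately show False using omitting_three_points_fatou[OF V xV(1)] e(2-4) xV(2) by blast
  qed
  have bwd: "y \<in> E" if y: "y \<in> riemann_sphere" "f y \<in> E" for y
  proof (rule ccontr)
    assume "y \<notin> E"
    then obtain n v where "v \<in> V" "y = (f ^^ n) v" using y(1) unfolding E_def by blast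
    then have "f y \<in> (f ^^ Suc n) ` V" by auto
    then show False using y(2) unfolding E_def by blast
  qed
  have ES: "E \<subseteq> riemann_sphere" unfolding E_def by blast
  have "E \<subseteq> fatou_set f"
    using backward_invariant_finite_in_fatou[OF \<open>finite E\<close> ES bwd] by blast
  have inv: "(f ^^ n) v \<in> julia_set f \<longleftrightarrow> v \<in> julia_set f" if "v \<in> riemann_sphere" for n v
    by (induction n) (use that in \<open>simp_all add: julia_completely_invariant funpow_in\<close>)
  show ?thesis
  proof
    fix y assume y: "y \<in> julia_set f"
    then have "y \<notin> E" "y \<in> riemann_sphere" using \<open>E \<subseteq> fatou_set f\<close> by (auto simp: julia_set_def)
    then obtain n v where v: "v \<in> V" "y = (f ^^ n) v" unfolding E_def by blast
    then have "v \<in> julia_set f" using inv[of v n] y by (auto simp: V_def)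
    then have "v \<in> U" using v G(2) by (auto simp: V_def)
    then show "y \<in> (\<Union>n. (f ^^ n) ` U)" using v by blast
  qed
qed

end

lemma interior_of_nowhere_dense:
  assumes N: "nowhere_dense_in X N" "closed N" "N \<subseteq> X"
  shows "(top_of_set X) interior_of ((top_of_set X) closure_of N) = {}"
proof -
  have "(top_of_set X) closure_of N = N" using N(2,3) by (simp add: closure_of_closedin closed_subset)
  moreover have "U = {}" if U: "openin (top_of_set X) U" "U \<subseteq> N" for U
  proof -
    obtain G where "open G" "U = X \<inter> G" using U(1) by (auto simp: openin_open)
    then show ?thesis using N(1) U(2) unfolding nowhere_dense_in_iff_open by (metis Int_commute)
  qed
  ultimately show ?thesis by (metis interior_of_subset openin_interior_of)
qed

theorem mainTheorem6:
  fixes p q :: "complex poly"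
  assumes "coprime p q"
    and "rat_degree p q \<ge> 2"
    and "continuum (julia_set (sphere_map p q))"
    and "finitely_irreducible (julia_set (sphere_map p q))"
  shows "(\<exists>K. K \<subseteq> julia_set (sphere_map p q) \<and> indecomposable K \<and>
             (top_of_set (julia_set (sphere_map p q))) interior_of K \<noteq> {})
       \<or> ((\<exists>a b. irreducible_between (julia_set (sphere_map p q)) a b) \<and>
          (\<exists>m :: pt \<Rightarrow> real.
             continuous_on (julia_set (sphere_map p q)) m \<and>
             m ` julia_set (sphere_map p q) = {0..1} \<and>
             (\<forall>t\<in>{0..1}. connected {y \<in> julia_set (sphere_map p q). m y = t}) \<and>
             (\<forall>t\<in>{0..1}. (top_of_set (julia_set (sphere_map p q))) interior_of
                 ((top_of_set (julia_set (sphere_map p q))) closure_of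
                    {y \<in> julia_set (sphere_map p q). m y = t}) = {}) \<and>
             (\<exists>g :: real \<Rightarrow> real.
                continuous_on {0..1} g \<and> g ` {0..1} \<subseteq> {0..1} \<and>
                (\<forall>y\<in>julia_set (sphere_map p q). m (sphere_map p q y) = g (m y)) \<and>
                (\<forall>U. openin (top_of_set {0..1}) U \<longrightarrow> openin (top_of_set {0..1}) (g ` U)) \<and>
                topologically_exact_on {0..1} g \<and>
                (\<forall>t\<in>{0..1}. finite {s\<in>{0..1}. g s = t} \<and>
                              card {s\<in>{0..1}. g s = t} \<le> rat_degree p q))))"
proof (unfold disj_imp, rule impI, goal_cases)
  case 1
  define J where "J = julia_set (sphere_map p q)"
  interpret rational_map p q using assms(1,2) by unfold_locales
  interpret exhausting_map J "sphere_map p q" "rat_degree p q"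
  proof
    show "continuum J" unfolding J_def by (rule assms(3))
    \<comment> \<open>Failure of alternative (1) means that an indecomposable \<open>K\<close> has
      empty relative interior, which is the assumption of the locale.\<close>
    show "nowhere_dense_in J K" if K: "K \<subseteq> J" "indecomposable K" for K
      unfolding nowhere_dense_in_iff_open
    proof (intro allI impI)
      fix V assume V: "open V \<and> V \<inter> J \<subseteq> K"
      have "openin (top_of_set J) (J \<inter> V)" using V by (simp add: openin_open_Int)
      then have "J \<inter> V \<subseteq> (top_of_set J) interior_of K" using V by (intro interior_of_maximal) blast+
      then show "V \<inter> J = {}" using 1 K unfolding J_def by blast
    qed
    show "finite_open_self_map J (rat_degree p q) (sphere_map p q)" unfolding J_def by (rule finite_open_self_map_julia)
    show "J \<subseteq> (\<Union>n. (sphere_map p q ^^ n) ` U)" if "openin (top_of_set J) U" "U \<noteq> {}" for U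
      using julia_exhausting that unfolding J_def by blast
  qed
  have fin: "finitely_irreducible J" unfolding J_def by (rule assms(4))
  obtain m where m: "continuous_on J m" "m ` J = {0..1}" "\<forall>t\<in>{0..1}. connected {y\<in>J. m y = t}"
    "\<forall>t\<in>{0..1}. nowhere_dense_in J {y\<in>J. m y = t}"
    and g: "\<exists>g :: real \<Rightarrow> real. continuous_on {0..1} g \<and> g ` {0..1} \<subseteq> {0..1} \<and> (\<forall>y\<in>J. m (sphere_map p q y) = g (m y)) \<and>
        (\<forall>U. openin (top_of_set {0..1}) U \<longrightarrow> openin (top_of_set {0..1}) (g ` U)) \<and>
        topologically_exact_on {0..1} g \<and>
        (\<forall>t\<in>{0..1}. finite {s\<in>{0..1}. g s = t} \<and> card {s\<in>{0..1}. g s = t} \<le> rat_degree p q)"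
    using semiconjugate_to_interval_map(2)[OF fin] by (elim exE conjE) (rule that, assumption+, intro exI conjI, assumption+)
  have int: "\<forall>t\<in>{0..1}. (top_of_set J) interior_of ((top_of_set J) closure_of {y\<in>J. m y = t}) = {}"
  proof (intro ballI interior_of_nowhere_dense)
    fix t :: real assume "t \<in> {0..1}"
    then show "nowhere_dense_in J {y\<in>J. m y = t}" using m(4) by blast
    have "{y\<in>J. m y = t} = J \<inter> m -` {t}" by auto
    then show "closed {y\<in>J. m y = t}" using continuous_closed_preimage[OF m(1) closed_X closed_singleton] by simp
  qed auto
  show ?case
    unfolding J_def[symmetric]
    using semiconjugate_to_interval_map(1)[OF fin] m(1-3) int g by (intro conjI exI[of _ m]) assumption+
qed

end
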